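(* Let $G\mathcal{G}$ be a graph group which can be expressed as the direct product of a non-trivial free abelian group and a graph group whose defining graph is disconnected. Then $\Sigma^1(G\mathcal{G})=\Sigma^k(G\mathcal{G})$ for all positive integers $k$.
   Context: For a finite simplicial graph $\mathcal{G}$ with vertex set $V(\mathcal{G})$, the graph group $G\mathcal{G}$ is $\langle V(\mathcal{G}) \mid xy=yx \text{ for all adjacent } x,y\in V(\mathcal{G})\rangle$. A character of a finitely generated group $G$ is a non-zero homomorphism $\chi: G\to\mathbb{R}$; put $[\chi]=\{r\chi\mid r>0\}$ and let $S(G)$ be the set of all such rays. The (homotopical) Bieri-Neumann-Strebel invariants $\Sigma^k(G)\subseteq S(G)$, $k\ge 1$, are defined as follows for a group $G$ admitting a $K(G,1)$ with finitely many cells in each dimension (graph groups do). Let $K$ be such a $K(G,1)$ with a single vertex and let $\tilde K$ be its universal cover, whose vertices are identified with $G$. Extend $\chi$ (linearly over cells) to a continuous $G$-equivariant map $\tilde\chi:\tilde K\to\mathbb{R}$ agreeing with $\chi$ on vertices, where $G$ acts on $\mathbb{R}$ by translations via $\chi$. For $s\in\mathbb{R}$ let $\tilde K_{\ge s}$ be the maximal subcomplex of $\tilde K$ contained in $\tilde\chi^{-1}([s,\infty))$. Then $[\chi]\in\Sigma^k(G)$ if and only if there is $d\ge0$ such that the inclusion $\tilde K_{\ge 0}\hookrightarrow\tilde K_{\ge -d}$ induces the trivial map on $\pi_i$ for all $0\le i\le k-1$ and all base points (for $i=0$: any two points of $\tilde K_{\ge0}$ lie in the same component of $\tilde K_{\ge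 -d}$). This is independent of the choices. In particular, if $\tilde K_{\ge0}$ is $(k-1)$-connected then $[\chi]\in\Sigma^k(G)$. For $k=1$ this is equivalent to: the maximal subgraph of a Cayley graph of $G$ (with respect to a finite generating set) on the vertices $g$ with $\chi(g)\ge0$ is connected. One has $\Sigma^1(G)\supseteq\Sigma^2(G)\supseteq\cdots$. *)

theory Defs
  imports "HOL-Analysis.Analysis" "HOL-Algebra.Free_Abelian_Groups" "HOL-Algebra.Group_Action"
begin

section \<open>Graph groups\<close>

definition finite_simplicial_graph :: "'v set \<Rightarrow> ('v \<times> 'v) set \<Rightarrow> bool" where
  "finite_simplicial_graph V E \<longleftrightarrow> finite V \<and> E \<subseteq> V \<times> V \<and> sym E \<and> irrefl E"

definition disconnected_graph :: "'v set \<Rightarrow> ('v \<times> 'v) set \<Rightarrow> bool" where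
  "disconnected_graph V E \<longleftrightarrow> (\<exists>x\<in>V. \<exists>y\<in>V. (x, y) \<notin> E\<^sup>*)"

text \<open>The letter \<open>(x, True)\<close> stands for the generator \<open>x\<close> and \<open>(x, False)\<close> for its formal
  inverse. Two words over \<open>V\<close> are related iff they represent the same element of
  \<open>\<langle>V | xy = yx for adjacent x, y\<rangle>\<close>.\<close>

inductive graph_group_eq ::
    "'v set \<Rightarrow> ('v \<times> 'v) set \<Rightarrow> ('v \<times> bool) list \<Rightarrow> ('v \<times> bool) list \<Rightarrow> bool"
  for V :: "'v set" and E :: "('v \<times> 'v) set" where
  refl: "u \<in> lists (V \<times> UNIV) \<Longrightarrow> graph_group_eq V E u u"
| sym: "graph_group_eq V E u v \<Longrightarrow> graph_group_eq V E v u"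
| trans: "graph_group_eq V E u v \<Longrightarrow> graph_group_eq V E v w \<Longrightarrow> graph_group_eq V E u w"
| append: "graph_group_eq V E u u' \<Longrightarrow> graph_group_eq V E v v' \<Longrightarrow>
    graph_group_eq V E (u @ v) (u' @ v')"
| cancel: "x \<in> V \<Longrightarrow> graph_group_eq V E [(x, b), (x, \<not> b)] []"
| commute: "x \<in> V \<Longrightarrow> y \<in> V \<Longrightarrow> (x, y) \<in> E \<Longrightarrow>
    graph_group_eq V E [(x, True), (y, True)] [(y, True), (x, True)]"

definition graph_group_rel ::
    "'v set \<Rightarrow> ('v \<times> 'v) set \<Rightarrow> (('v \<times> bool) list \<times> ('v \<times> bool) list) set" where
  "graph_group_rel V E = {(u, v). graph_group_eq V E u v}"

definition graph_group :: "'v set \<Rightarrow> ('v \<times> 'v) set \<Rightarrow> ('v \<times> bool) list set monoid" where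
  "graph_group V E =
    \<lparr>carrier = lists (V \<times> UNIV) // graph_group_rel V E,
     monoid.mult = (\<lambda>A B. \<Union>u\<in>A. \<Union>v\<in>B. graph_group_rel V E `` {u @ v}),
     one = graph_group_rel V E `` {[]}\<rparr>"


section \<open>Characters and the character sphere\<close>

definition real_group :: "real monoid" where
  "real_group = \<lparr>carrier = UNIV, monoid.mult = (+), one = 0\<rparr>"

text \<open>Characters are taken extensional, so that equality of characters (and of rays) is equality
  on the carrier.\<close>

definition characters :: "('g, 'b) monoid_scheme \<Rightarrow> ('g \<Rightarrow> real) set" where
  "characters G =
    {chi \<in> hom G real_group \<inter> extensional (carrier G). \<exists>g\<in>carrier G. chi g \<noteq> 0}"

definition char_ray :: "('g, 'b) monoid_scheme \<Rightarrow> ('g \<Rightarrow> real) \<Rightarrow> ('g \<Rightarrow> real) set" where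
  "char_ray G chi = {(\<lambda>g\<in>carrier G. r * chi g) | r. r > 0}"


section \<open>CW complexes\<close>

definition closed_disk :: "nat \<Rightarrow> (nat \<Rightarrow> real) topology" where
  "closed_disk n = subtopology (Euclidean_space n) {x. (\<Sum>i<n. x i ^ 2) \<le> 1}"

definition open_disk :: "nat \<Rightarrow> (nat \<Rightarrow> real) topology" where
  "open_disk n = subtopology (Euclidean_space n) {x. (\<Sum>i<n. x i ^ 2) < 1}"

definition disk_boundary :: "nat \<Rightarrow> (nat \<Rightarrow> real) set" where
  "disk_boundary n = topspace (closed_disk n) - topspace (open_disk n)"

text \<open>A CW complex with underlying space \<open>X\<close>, cells indexed by \<open>I\<close>, of dimension \<open>cdim c\<close> and with
  characteristic map \<open>\<Phi> c\<close> defined on the closed disk of that dimension.\<close>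

locale CW_complex =
  fixes X :: "'p topology" and I :: "'c set" and cdim :: "'c \<Rightarrow> nat"
    and \<Phi> :: "'c \<Rightarrow> (nat \<Rightarrow> real) \<Rightarrow> 'p"
  assumes Hausdorff: "Hausdorff_space X"
    and continuous_char: "c \<in> I \<Longrightarrow> continuous_map (closed_disk (cdim c)) X (\<Phi> c)"
    and embedding_char: "c \<in> I \<Longrightarrow> embedding_map (open_disk (cdim c)) X (\<Phi> c)"
    and disjoint_cells: "c \<in> I \<Longrightarrow> c' \<in> I \<Longrightarrow> c \<noteq> c' \<Longrightarrow>
      \<Phi> c ` topspace (open_disk (cdim c)) \<inter> \<Phi> c' ` topspace (open_disk (cdim c')) = {}"
    and covering_cells: "topspace X = (\<Union>c\<in>I. \<Phi> c ` topspace (open_disk (cdim c)))"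
    and closure_finite: "c \<in> I \<Longrightarrow>
      \<exists>J\<subseteq>I. finite J \<and> (\<forall>j\<in>J. cdim j < cdim c) \<and>
        \<Phi> c ` disk_boundary (cdim c) \<subseteq> (\<Union>j\<in>J. \<Phi> j ` topspace (open_disk (cdim j)))"
    and weak_topology: "C \<subseteq> topspace X \<Longrightarrow>
      (\<And>c. c \<in> I \<Longrightarrow> closedin X (C \<inter> \<Phi> c ` topspace (closed_disk (cdim c)))) \<Longrightarrow> closedin X C"

text \<open>A union of open cells containing the closure of each of its cells.\<close>

definition subcomplex ::
    "'p topology \<Rightarrow> 'c set \<Rightarrow> ('c \<Rightarrow> nat) \<Rightarrow> ('c \<Rightarrow> (nat \<Rightarrow> real) \<Rightarrow> 'p) \<Rightarrow> 'p set \<Rightarrow> bool" where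
  "subcomplex X I cdim \<Phi> S \<longleftrightarrow> S \<subseteq> topspace X \<and>
    (\<forall>c\<in>I. \<Phi> c ` topspace (open_disk (cdim c)) \<inter> S \<noteq> {} \<longrightarrow>
       \<Phi> c ` topspace (closed_disk (cdim c)) \<subseteq> S)"

definition maximal_subcomplex ::
    "'p topology \<Rightarrow> 'c set \<Rightarrow> ('c \<Rightarrow> nat) \<Rightarrow> ('c \<Rightarrow> (nat \<Rightarrow> real) \<Rightarrow> 'p) \<Rightarrow> 'p set \<Rightarrow> 'p set" where
  "maximal_subcomplex X I cdim \<Phi> A = \<Union>{S. subcomplex X I cdim \<Phi> S \<and> S \<subseteq> A}"


section \<open>Classifying spaces and their universal covers\<close>

definition covering_map :: "'p topology \<Rightarrow> 'q topology \<Rightarrow> ('p \<Rightarrow> 'q) \<Rightarrow> bool" where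
  "covering_map X K p \<longleftrightarrow> continuous_map X K p \<and> p ` topspace X = topspace K \<and>
    (\<forall>y\<in>topspace K. \<exists>U. openin K U \<and> y \<in> U \<and>
      (\<exists>\<V>. \<Union>\<V> = {x \<in> topspace X. p x \<in> U} \<and> pairwise disjnt \<V> \<and>
        (\<forall>V\<in>\<V>. openin X V \<and> homeomorphic_map (subtopology X V) (subtopology K U) p)))"

text \<open>\<open>K\<close> is a \<open>K(G,1)\<close>, i.e. a connected complex with fundamental group \<open>G\<close> and contractible
  universal cover \<open>p : X \<rightarrow> K\<close>. The identification of \<open>\<pi>\<^sub>1(K)\<close> with \<open>G\<close> is recorded as the action
  \<open>act\<close> of \<open>G\<close> on \<open>X\<close> by deck transformations: it is simply transitive on the fibres of \<open>p\<close>, and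
  since \<open>X\<close> is simply connected this makes \<open>G\<close> the full deck group, hence the fundamental group
  of \<open>K\<close>.

  \<open>\<Psi> c\<close> is a chosen lift of the characteristic map \<open>\<Phi> c\<close>; the cells of \<open>X\<close> are the translates
  of these lifts, so they are indexed by \<open>carrier G \<times> I\<close>. In particular the vertices of \<open>X\<close> are
  the points \<open>act g v\<close>, where \<open>v\<close> is the chosen lift of the only vertex of \<open>K\<close>.
  That \<open>X\<close> is a CW complex with these cells is a consequence of the other conditions; it is
  included for convenience.\<close>

definition cover_dim :: "('c \<Rightarrow> nat) \<Rightarrow> 'g \<times> 'c \<Rightarrow> nat" where
  "cover_dim cdim = (\<lambda>(g, c). cdim c)"

definition cover_char ::
    "('g \<Rightarrow> 'p \<Rightarrow> 'p) \<Rightarrow> ('c \<Rightarrow> (nat \<Rightarrow> real) \<Rightarrow> 'p) \<Rightarrow> 'g \<times> 'c \<Rightarrow> (nat \<Rightarrow> real) \<Rightarrow> 'p" where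
  "cover_char act \<Psi> = (\<lambda>(g, c) x. act g (\<Psi> c x))"

locale finite_type_K_G_1 =
  base: CW_complex K I cdim \<Phi> +
  cover: CW_complex X "carrier G \<times> I" "cover_dim cdim" "cover_char act \<Psi>" +
  group_action G "topspace X" act
  for G :: "('g, 'b) monoid_scheme"
    and K :: "'q topology" and I :: "'c set" and cdim :: "'c \<Rightarrow> nat"
    and \<Phi> :: "'c \<Rightarrow> (nat \<Rightarrow> real) \<Rightarrow> 'q"
    and X :: "'p topology" and p :: "'p \<Rightarrow> 'q"
    and act :: "'g \<Rightarrow> 'p \<Rightarrow> 'p" and \<Psi> :: "'c \<Rightarrow> (nat \<Rightarrow> real) \<Rightarrow> 'p" +
  assumes finitely_many_cells: "finite {c \<in> I. cdim c = n}"
    and single_vertex: "\<exists>!c. c \<in> I \<and> cdim c = 0"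
    and covering: "covering_map X K p"
    and contractible: "contractible_space X"
    and act_homeomorphism: "g \<in> carrier G \<Longrightarrow> homeomorphic_map X X (act g)"
    and act_fibres: "x \<in> topspace X \<Longrightarrow> y \<in> topspace X \<Longrightarrow>
      p x = p y \<longleftrightarrow> (\<exists>g\<in>carrier G. act g x = y)"
    and act_free: "g \<in> carrier G \<Longrightarrow> x \<in> topspace X \<Longrightarrow> act g x = x \<Longrightarrow> g = \<one>\<^bsub>G\<^esub>"
    and lift_continuous: "c \<in> I \<Longrightarrow> continuous_map (closed_disk (cdim c)) X (\<Psi> c)"
    and lift: "c \<in> I \<Longrightarrow> z \<in> topspace (closed_disk (cdim c)) \<Longrightarrow> p (\<Psi> c z) = \<Phi> c z"


section \<open>The homotopical Bieri-Neumann-Strebel invariants\<close>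

text \<open>The equivariant extension of \<open>chi\<close> to \<open>X\<close>; \<open>\<lambda>_. 0\<close> is the only point of the 0-disk, so
  \<open>act g (\<Psi> c (\<lambda>_. 0))\<close> is the vertex of \<open>X\<close> identified with \<open>g\<close>.\<close>

definition height_function ::
    "('g, 'b) monoid_scheme \<Rightarrow> 'c set \<Rightarrow> ('c \<Rightarrow> nat) \<Rightarrow> 'p topology \<Rightarrow> ('g \<Rightarrow> 'p \<Rightarrow> 'p) \<Rightarrow>
      ('c \<Rightarrow> (nat \<Rightarrow> real) \<Rightarrow> 'p) \<Rightarrow> ('g \<Rightarrow> real) \<Rightarrow> ('p \<Rightarrow> real) \<Rightarrow> bool" where
  "height_function G I cdim X act \<Psi> chi h \<longleftrightarrow>
    continuous_map X euclideanreal h \<and>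
    (\<forall>g\<in>carrier G. \<forall>x\<in>topspace X. h (act g x) = chi g + h x) \<and>
    (\<forall>g\<in>carrier G. \<forall>c\<in>I. cdim c = 0 \<longrightarrow> h (act g (\<Psi> c (\<lambda>_. 0))) = chi g)"

definition superlevel ::
    "('g, 'b) monoid_scheme \<Rightarrow> 'c set \<Rightarrow> ('c \<Rightarrow> nat) \<Rightarrow> 'p topology \<Rightarrow> ('g \<Rightarrow> 'p \<Rightarrow> 'p) \<Rightarrow>
      ('c \<Rightarrow> (nat \<Rightarrow> real) \<Rightarrow> 'p) \<Rightarrow> ('p \<Rightarrow> real) \<Rightarrow> real \<Rightarrow> 'p set" where
  "superlevel G I cdim X act \<Psi> h s =
    maximal_subcomplex X (carrier G \<times> I) (cover_dim cdim) (cover_char act \<Psi>)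
      {x \<in> topspace X. s \<le> h x}"

definition sphere_base :: "nat \<Rightarrow> real" where
  "sphere_base = (\<lambda>i. if i = 0 then 1 else 0)"

text \<open>For \<open>A \<subseteq> B \<subseteq> X\<close>, the inclusion of \<open>A\<close> into \<open>B\<close> is trivial on \<open>\<pi>\<^sub>i\<close> for every base point in \<open>A\<close>.
  For \<open>i = 0\<close> this says that any two points of \<open>A\<close> are joined by a path in \<open>B\<close>.\<close>

definition trivial_on_pi :: "nat \<Rightarrow> 'p topology \<Rightarrow> 'p set \<Rightarrow> 'p set \<Rightarrow> bool" where
  "trivial_on_pi i X A B \<longleftrightarrow>
    (\<forall>a f. a \<in> A \<and> continuous_map (nsphere i) (subtopology X A) f \<and> f sphere_base = a \<longrightarrow>
      homotopic_with (\<lambda>f'. f' sphere_base = a) (nsphere i) (subtopology X B) f (\<lambda>_. a))"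

definition essentially_connected ::
    "nat \<Rightarrow> ('g, 'b) monoid_scheme \<Rightarrow> 'c set \<Rightarrow> ('c \<Rightarrow> nat) \<Rightarrow> 'p topology \<Rightarrow> ('g \<Rightarrow> 'p \<Rightarrow> 'p) \<Rightarrow>
      ('c \<Rightarrow> (nat \<Rightarrow> real) \<Rightarrow> 'p) \<Rightarrow> ('p \<Rightarrow> real) \<Rightarrow> bool" where
  "essentially_connected k G I cdim X act \<Psi> h \<longleftrightarrow>
    (\<exists>d\<ge>0. \<forall>i<k. trivial_on_pi i X
       (superlevel G I cdim X act \<Psi> h 0) (superlevel G I cdim X act \<Psi> h (- d)))"

text \<open>\<open>\<Sigma>\<^sup>k(G)\<close> for \<open>k \<ge> 1\<close>. The condition does not depend on the \<open>K(G,1)\<close>, its universal cover and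
  the height function, so quantifying over them existentially is as good as fixing a choice. As there
  are finitely many cells in each dimension, natural numbers suffice to index the cells of \<open>K\<close>, and
  both \<open>K\<close> and its universal cover have at most continuum many points, so up to homeomorphism every
  \<open>K\<close> and \<open>X\<close> occurs as a topology on a subset of \<open>nat \<Rightarrow> real\<close> (these topologies are arbitrary,
  not subspace topologies).\<close>

definition BNS_Sigma :: "nat \<Rightarrow> ('g, 'b) monoid_scheme \<Rightarrow> ('g \<Rightarrow> real) set set" where
  "BNS_Sigma k G = {char_ray G chi | chi. chi \<in> characters G \<and>
    (\<exists>(K :: (nat \<Rightarrow> real) topology) (I :: nat set) cdim \<Phi> (X :: (nat \<Rightarrow> real) topology) p act \<Psi> h.
       finite_type_K_G_1 G K I cdim \<Phi> X p act \<Psi> \<and>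
       height_function G I cdim X act \<Psi> chi h \<and>
       essentially_connected k G I cdim X act \<Psi> h)}"

end

theory Submission
  imports Defs
begin

text \<open>
  Let \<open>G = A \<times> H\<close> with \<open>A\<close> free abelian and \<open>H\<close> the graph group of a disconnected graph. Both
  invariants consist of the rays of the characters that do not vanish on \<open>A\<close>; the proof compares
  them on one and the same \<open>K(G,1)\<close>.

  If \<open>[\<chi>]\<close> is in the first invariant and \<open>\<chi>\<close> vanishes on \<open>A\<close>, then \<open>\<chi>\<close> lives on \<open>H\<close>, a free product
  of two graph groups, and is nonzero on a generator \<open>x\<close> of one factor. For \<open>y\<close> in the other factor, a
  path in the Cayley graph from \<open>1\<close> to \<open>x\<^sup>-\<^sup>N y x\<^sup>N\<close> passes near \<open>x\<^sup>-\<^sup>N\<close>, which has arbitrarily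
  negative height, a contradiction. Hence some central element \<open>z\<close> has \<open>\<chi>(z) > 0\<close>.

  The action of \<open>z\<close> on the universal cover \<open>X\<close> commutes with that of \<open>G\<close>, so over any skeleton it is
  equivariantly homotopic to the inclusion by a homotopy that lowers heights by a bounded amount. A
  sphere in \<open>X\<^sub>\<ge>\<^sub>0\<close> is first pushed into a skeleton of bounded dimension and then upwards by powers of
  \<open>z\<close>, until its translate bounds a disk that has been lifted above height \<open>0\<close> as well.
\<close>

section \<open>Disks and quotient maps\<close>

text \<open>Membership in an invariant is witnessed by some complex, so the inclusion is proved one
  complex at a time: a witness for \<open>1\<close> is shown to be a witness for \<open>k\<close>.
  The depth \<open>d\<close> has to be fixed before the sphere is known. The homotopy from the
  identity to the translation by \<open>z\<close> is built cell by cell, and its drop is a bound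
  over orbits of cells, so there must be finitely many of them; this forces spheres into a skeleton
  whose dimension depends on \<open>i\<close> alone. The bound \<open>2 ^ Suc i\<close> is far from
  the optimal \<open>i\<close>, but it is uniform. It comes from interpolation on a cubical lattice,
  where \<open>2 ^ n\<close> corners influence a point of an \<open>n\<close>-dimensional cube. The
  number of translations depends on the sphere, yet the drops do not add up, because every step
  starts again at nonnegative height. In degree 0 the passage from topology to the group avoids edge
  paths: a \<open>bool\<close>-valued label of the vertices that is constant along edges is extended
  to all cells and must then be constant along every path. The separating label is the side of the
  oldest syllable of a free product normal form.\<close>

lemma continuous_map_compact_quotient:
  assumes "compact_space Z" "Hausdorff_space Y" "continuous_map Z Y q"
    and "q ` topspace Z = topspace Y" and "continuous_map Z T (f \<circ> q)"
  shows "continuous_map Y T f"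
proof -
  have "quotient_map Z Y q"
    using assms continuous_imp_closed_map continuous_closed_imp_quotient_map by metis
  then show ?thesis
    using assms(5) continuous_compose_quotient_map_eq by metis
qed

lemma continuous_map_finite_closed_cover:
  assumes "finite J" "\<And>j. j \<in> J \<Longrightarrow> closedin Y (C j)" "topspace Y \<subseteq> (\<Union>j\<in>J. C j)"
    and "\<And>j. j \<in> J \<Longrightarrow> continuous_map (subtopology Y (C j)) T f"
  shows "continuous_map Y T f"
  unfolding continuous_map_closedin
proof (intro conjI allI impI ballI)
  show "f \<in> topspace Y \<rightarrow> topspace T"
    using assms(3,4) by (fastforce simp: continuous_map_def Pi_iff)
next
  fix D assume D: "closedin T D"
  have "closedin Y {x \<in> C j. f x \<in> D}" if "j \<in> J" for j
  proof -
    have "closedin (subtopology Y (C j)) {x \<in> topspace (subtopology Y (C j)). f x \<in> D}"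
      using assms(4)[OF that] D by (simp add: continuous_map_closedin)
    moreover have "topspace (subtopology Y (C j)) = C j"
      using assms(2)[OF that] closedin_subset by fastforce
    ultimately show ?thesis
      using closedin_closed_subtopology assms(2)[OF that] by metis
  qed
  then have "closedin Y (\<Union>j\<in>J. {x \<in> C j. f x \<in> D})"
    using assms(1) by (intro closedin_Union) auto
  moreover have "(\<Union>j\<in>J. {x \<in> C j. f x \<in> D}) = {x \<in> topspace Y. f x \<in> D}"
    using assms(2,3) closedin_subset by fastforce
  ultimately show "closedin Y {x \<in> topspace Y. f x \<in> D}" by simp
qed

section \<open>Disks as subspaces of the product space \<open>nat \<Rightarrow> real\<close>\<close>

lemma L2_set_le_1_iff: "L2_set x A \<le> 1 \<longleftrightarrow> (\<Sum>i\<in>A. x i ^ 2) \<le> 1"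
  by (simp add: L2_set_def)

lemma L2_set_less_1_iff: "L2_set x A < 1 \<longleftrightarrow> (\<Sum>i\<in>A. x i ^ 2) < 1"
  by (simp add: L2_set_def)

lemma topspace_closed_disk:
  "topspace (closed_disk m) = {x. (\<forall>i\<ge>m. x i = 0) \<and> L2_set x {..<m} \<le> 1}"
  by (auto simp: closed_disk_def topspace_Euclidean_space L2_set_le_1_iff)

lemma topspace_open_disk:
  "topspace (open_disk m) = {x. (\<forall>i\<ge>m. x i = 0) \<and> L2_set x {..<m} < 1}"
  by (auto simp: open_disk_def topspace_Euclidean_space L2_set_less_1_iff)

lemma open_disk_subset: "topspace (open_disk m) \<subseteq> topspace (closed_disk m)"
  by (auto simp: topspace_open_disk topspace_closed_disk)

lemma disk_boundary_eq:
  "disk_boundary m = {x. (\<forall>i\<ge>m. x i = 0) \<and> L2_set x {..<m} = 1}"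
  by (auto simp: disk_boundary_def topspace_closed_disk topspace_open_disk)

lemma Euclidean_space_eq: "Euclidean_space n = top_of_set {x. \<forall>i\<ge>n. x i = 0}"
  by (simp add: Euclidean_space_def euclidean_product_topology)

lemma closed_disk_eq:
  "closed_disk m = top_of_set {x. (\<forall>i\<ge>m. x i = 0) \<and> L2_set x {..<m} \<le> 1}"
  unfolding closed_disk_def Euclidean_space_eq L2_set_le_1_iff
  by (simp add: subtopology_subtopology Collect_conj_eq)

lemma open_disk_eq:
  "open_disk m = top_of_set {x. (\<forall>i\<ge>m. x i = 0) \<and> L2_set x {..<m} < 1}"
  unfolding open_disk_def Euclidean_space_eq L2_set_less_1_iff
  by (simp add: subtopology_subtopology Collect_conj_eq)

lemma continuous_on_L2_set [continuous_intros]: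
  fixes f :: "'a::topological_space \<Rightarrow> nat \<Rightarrow> real"
  assumes "\<And>i. i \<in> A \<Longrightarrow> continuous_on S (\<lambda>x. f x i)"
  shows "continuous_on S (\<lambda>x. L2_set (f x) A)"
  unfolding L2_set_def using assms by (intro continuous_intros) auto

text \<open>The ambient space is an infinite product, where closed and bounded does not give
  compact. The disk is a closed subset of a Tychonoff cube instead.\<close>

lemma compact_disk: "compact {x :: nat \<Rightarrow> real. (\<forall>i\<ge>m. x i = 0) \<and> L2_set x {..<m} \<le> 1}"
proof -
  have "compactin (product_topology (\<lambda>i. euclideanreal) UNIV) (PiE UNIV (\<lambda>i::nat. {-1..1::real}))"
    by (simp add: compactin_PiE)
  then have c: "compact (PiE UNIV (\<lambda>i::nat. {-1..1::real}))"
    by (simp add: euclidean_product_topology)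
  have "closed {x :: nat \<Rightarrow> real. x i = 0}" for i
    by (intro closed_Collect_eq continuous_intros) (auto intro: continuous_on_coordinatewise_then_product continuous_on_product_coordinates)
  then have "closed (\<Inter>i\<in>{m..}. {x :: nat \<Rightarrow> real. x i = 0})" by blast
  moreover have "closed {x :: nat \<Rightarrow> real. L2_set x {..<m} \<le> 1}"
    by (intro closed_Collect_le continuous_intros continuous_on_product_coordinates)
  ultimately have "closed ((\<Inter>i\<in>{m..}. {x :: nat \<Rightarrow> real. x i = 0}) \<inter> {x. L2_set x {..<m} \<le> 1})"
    by blast
  also have "\<dots> = {x :: nat \<Rightarrow> real. (\<forall>i\<ge>m. x i = 0) \<and> L2_set x {..<m} \<le> 1}" by auto
  finally have cl: "closed {x :: nat \<Rightarrow> real. (\<forall>i\<ge>m. x i = 0) \<and> L2_set x {..<m} \<le> 1}" .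
  have "{x. (\<forall>i\<ge>m. x i = 0) \<and> L2_set x {..<m} \<le> 1} \<subseteq> PiE UNIV (\<lambda>i::nat. {-1..1::real})"
  proof clarify
    fix x :: "nat \<Rightarrow> real" assume x: "\<forall>i\<ge>m. x i = 0" "L2_set x {..<m} \<le> 1"
    have "\<bar>x i\<bar> \<le> 1" for i
    proof (cases "i < m")
      case True
      then have "\<bar>x i\<bar> \<le> L2_set (\<lambda>i. \<bar>x i\<bar>) {..<m}"
        by (intro member_le_L2_set) auto
      moreover have "L2_set (\<lambda>i. \<bar>x i\<bar>) {..<m} = L2_set x {..<m}"
        by (simp add: L2_set_def)
      ultimately show ?thesis using x(2) by linarith
    qed (use x in auto)
    then show "x \<in> PiE UNIV (\<lambda>i::nat. {-1..1::real})"
      by (auto simp: abs_le_iff minus_le_iff)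
  qed
  then show ?thesis using compact_Int_closed[OF c cl] by (simp add: Int_absorb1)
qed

lemma compact_space_closed_disk: "compact_space (closed_disk m)"
  unfolding closed_disk_eq by (simp add: compact_space_subtopology compact_disk)

lemma Hausdorff_space_closed_disk: "Hausdorff_space (closed_disk m)"
  unfolding closed_disk_eq by (simp add: Hausdorff_space_subtopology)

section \<open>Subcomplexes and compact sets\<close>

context CW_complex
begin

definition ocell :: "'c \<Rightarrow> 'p set" where
  "ocell c = \<Phi> c ` topspace (open_disk (cdim c))"

definition ccell :: "'c \<Rightarrow> 'p set" where
  "ccell c = \<Phi> c ` topspace (closed_disk (cdim c))"

definition cells :: "'c set \<Rightarrow> 'p set" where
  "cells J = (\<Union>c\<in>J. ocell c)"

text \<open>Subcomplexes described by their index sets, so that finiteness and dimension of a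
  subcomplex can be read off the indices; \<open>subcomplex_cells\<close> and
  \<open>subcomplex_eq_cells\<close> translate between the two forms.\<close>

definition closed_family :: "'c set \<Rightarrow> bool" where
  "closed_family J \<longleftrightarrow> J \<subseteq> I \<and> (\<forall>c\<in>J. ccell c \<subseteq> cells J)"

lemma ccell_eq: "ccell c = ocell c \<union> \<Phi> c ` disk_boundary (cdim c)"
proof -
  have "topspace (closed_disk (cdim c)) = topspace (open_disk (cdim c)) \<union> disk_boundary (cdim c)"
    by (auto simp: disk_boundary_eq topspace_closed_disk topspace_open_disk)
  then show ?thesis by (auto simp: ccell_def ocell_def)
qed

lemma ocell_subset_ccell: "ocell c \<subseteq> ccell c"
  by (simp add: ccell_eq)

lemma in_cellsE: assumes "x \<in> cells J" obtains c where "c \<in> J" "x \<in> ocell c"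
  using assms by (auto simp: cells_def)

lemma in_ccellE: assumes "x \<in> ccell c" obtains y where "y \<in> topspace (closed_disk (cdim c))" "x = \<Phi> c y"
  using assms by (auto simp: ccell_def)

lemma in_cellsI: "c \<in> J \<Longrightarrow> x \<in> ocell c \<Longrightarrow> x \<in> cells J"
  by (auto simp: cells_def)

lemma ocell_nonempty: "ocell c \<noteq> {}"
proof -
  have "(\<lambda>_. 0) \<in> topspace (open_disk (cdim c))" by (simp add: topspace_open_disk L2_set_def)
  then show ?thesis unfolding ocell_def by blast
qed

lemma ocell_disjoint: "c \<in> I \<Longrightarrow> c' \<in> I \<Longrightarrow> x \<in> ocell c \<Longrightarrow> x \<in> ocell c' \<Longrightarrow> c = c'"
  unfolding ocell_def using disjoint_cells[of c c'] by blast

lemma ccell_subset_topspace: "c \<in> I \<Longrightarrow> ccell c \<subseteq> topspace X"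
  using continuous_char by (auto simp: ccell_def continuous_map_def)

lemma compactin_ccell: "c \<in> I \<Longrightarrow> compactin X (ccell c)"
  unfolding ccell_def
  by (rule image_compactin[OF _ continuous_char])
    (simp_all add: compact_space_closed_disk compact_space_def[symmetric])

lemma closedin_ccell: "c \<in> I \<Longrightarrow> closedin X (ccell c)"
  by (rule compactin_imp_closedin[OF Hausdorff compactin_ccell])

lemma ocell_in_cells_iff: "J \<subseteq> I \<Longrightarrow> c \<in> I \<Longrightarrow> x \<in> ocell c \<Longrightarrow> x \<in> cells J \<longleftrightarrow> c \<in> J"
  unfolding cells_def by (metis UN_E UN_I ocell_disjoint subset_iff)

lemma cells_subset_topspace: "J \<subseteq> I \<Longrightarrow> cells J \<subseteq> topspace X"
proof -
  assume "J \<subseteq> I"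
  then have "ocell c \<subseteq> topspace X" if "c \<in> J" for c
    using that ocell_subset_ccell[of c] ccell_subset_topspace[of c] by blast
  then show ?thesis by (auto simp: cells_def)
qed

lemma obtain_cell:
  assumes "x \<in> topspace X" obtains c where "c \<in> I" "x \<in> ocell c"
proof -
  have "x \<in> (\<Union>c\<in>I. ocell c)" using assms covering_cells by (simp add: ocell_def)
  then show ?thesis using that by blast
qed

lemma subcomplex_cells: "closed_family J \<Longrightarrow> subcomplex X I cdim \<Phi> (cells J)"
  unfolding subcomplex_def ocell_def[symmetric] ccell_def[symmetric]
proof (intro conjI ballI impI)
  assume J: "closed_family J"
  then show "cells J \<subseteq> topspace X" by (simp add: closed_family_def cells_subset_topspace)
  fix c assume "c \<in> I" "ocell c \<inter> cells J \<noteq> {}"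
  then have "c \<in> J" using J ocell_in_cells_iff[of J c] by (auto simp: closed_family_def)
  then show "ccell c \<subseteq> cells J" using J by (simp add: closed_family_def)
qed

lemma subcomplex_eq_cells:
  assumes "subcomplex X I cdim \<Phi> S"
  shows "closed_family {c \<in> I. ocell c \<inter> S \<noteq> {}}" "S = cells {c \<in> I. ocell c \<inter> S \<noteq> {}}"
proof -
  have *: "ccell c \<subseteq> S" if "c \<in> I" "ocell c \<inter> S \<noteq> {}" for c
    using assms that unfolding subcomplex_def ocell_def ccell_def by blast
  have "S \<subseteq> topspace X" using assms by (simp add: subcomplex_def)
  then show S: "S = cells {c \<in> I. ocell c \<inter> S \<noteq> {}}"
  proof (intro equalityI subsetI)
    fix x assume x: "x \<in> S"
    then obtain c where "c \<in> I" "x \<in> ocell c" using \<open>S \<subseteq> topspace X\<close> obtain_cell by blast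
    then show "x \<in> cells {c \<in> I. ocell c \<inter> S \<noteq> {}}" using x unfolding cells_def by blast
  next
    fix x assume "x \<in> cells {c \<in> I. ocell c \<inter> S \<noteq> {}}"
    then obtain c where "c \<in> I" "ocell c \<inter> S \<noteq> {}" "x \<in> ocell c" unfolding cells_def by blast
    then show "x \<in> S" using *[of c] ocell_subset_ccell[of c] by blast
  qed
  show "closed_family {c \<in> I. ocell c \<inter> S \<noteq> {}}"
    unfolding closed_family_def S[symmetric] using * by blast
qed

lemma subcomplex_ccell:
  "subcomplex X I cdim \<Phi> S \<Longrightarrow> c \<in> I \<Longrightarrow> x \<in> ocell c \<Longrightarrow> x \<in> S \<Longrightarrow> ccell c \<subseteq> S"
proof -
  assume "subcomplex X I cdim \<Phi> S" "c \<in> I" "x \<in> ocell c" "x \<in> S"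
  then have "ocell c \<inter> S \<noteq> {} \<longrightarrow> ccell c \<subseteq> S"
    by (simp add: subcomplex_def ocell_def ccell_def)
  then show ?thesis using \<open>x \<in> ocell c\<close> \<open>x \<in> S\<close> by blast
qed

lemma subcomplex_closure_finite:
  assumes "subcomplex X I cdim \<Phi> S" "c \<in> I" "ccell c \<subseteq> S"
  obtains J where "J \<subseteq> I" "finite J" "ccell c \<subseteq> cells J" "cells J \<subseteq> S" "c \<in> J"
    "\<And>j. j \<in> J \<Longrightarrow> j \<noteq> c \<Longrightarrow> cdim j < cdim c" "\<Phi> c ` disk_boundary (cdim c) \<subseteq> cells (J - {c})"
proof -
  obtain J where J: "J \<subseteq> I" "finite J" "\<forall>j\<in>J. cdim j < cdim c"
    "\<Phi> c ` disk_boundary (cdim c) \<subseteq> cells J"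
    using closure_finite[OF assms(2)] unfolding cells_def ocell_def by blast
  \<comment> \<open>The family given by closure finiteness may contain cells that have nothing to do
    with \<open>c\<close>. Those that meet the boundary of \<open>c\<close> meet \<open>S\<close>
    and hence lie in \<open>S\<close>.\<close>
  define J' where "J' = {j \<in> J. ocell j \<inter> \<Phi> c ` disk_boundary (cdim c) \<noteq> {}}"
  have 1: "\<Phi> c ` disk_boundary (cdim c) \<subseteq> cells J'"
    using J(4) unfolding J'_def cells_def by blast
  have 2: "cells J' \<subseteq> S"
  proof -
    have "ccell j \<subseteq> S" if "j \<in> J'" for j
    proof -
      obtain x where "x \<in> ocell j" "x \<in> \<Phi> c ` disk_boundary (cdim c)"
        using \<open>j \<in> J'\<close> J'_def by blast
      then show ?thesis
        using assms subcomplex_ccell[OF assms(1), of j x] J(1) \<open>j \<in> J'\<close>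
        unfolding ccell_eq[of c] J'_def by blast
    qed
    then show ?thesis unfolding cells_def using ocell_subset_ccell by blast
  qed
  have "c \<notin> J'" using J(3) unfolding J'_def by auto
  show ?thesis
  proof (rule that[of "insert c J'"])
    show "ccell c \<subseteq> cells (insert c J')" using 1 by (auto simp: ccell_eq cells_def)
    show "cells (insert c J') \<subseteq> S"
      using 2 assms(3) ocell_subset_ccell[of c] by (auto simp: cells_def)
    show "\<Phi> c ` disk_boundary (cdim c) \<subseteq> cells (insert c J' - {c})"
      using 1 \<open>c \<notin> J'\<close> by simp
  qed (use J assms(2) in \<open>auto simp: J'_def\<close>)
qed

text \<open>By the weak topology it is enough to look inside one closed cell. That cell is covered
  by finitely many open cells, and each of those that meets \<open>S\<close> has its closure in
  \<open>S\<close>, which leaves a finite union of closed sets.\<close>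

lemma closedin_subcomplex:
  assumes S: "subcomplex X I cdim \<Phi> S" shows "closedin X S"
proof (rule weak_topology)
  show "S \<subseteq> topspace X" using S by (simp add: subcomplex_def)
  fix c assume c: "c \<in> I"
  have "subcomplex X I cdim \<Phi> (topspace X)"
    using ccell_subset_topspace by (auto simp: subcomplex_def ccell_def)
  then obtain J where J: "J \<subseteq> I" "finite J" "ccell c \<subseteq> cells J"
    using subcomplex_closure_finite[OF _ c ccell_subset_topspace[OF c]] by metis
  have "S \<inter> ccell c = (\<Union>j\<in>{j \<in> J. ocell j \<inter> S \<noteq> {}}. ccell j \<inter> ccell c)"
  proof (intro equalityI subsetI)
    fix x assume x: "x \<in> S \<inter> ccell c"
    then obtain j where "j \<in> J" "x \<in> ocell j" using J(3) cells_def by auto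
    then show "x \<in> (\<Union>j\<in>{j \<in> J. ocell j \<inter> S \<noteq> {}}. ccell j \<inter> ccell c)"
      using x ocell_subset_ccell by blast
  next
    fix x assume "x \<in> (\<Union>j\<in>{j \<in> J. ocell j \<inter> S \<noteq> {}}. ccell j \<inter> ccell c)"
    then show "x \<in> S \<inter> ccell c" using subcomplex_ccell[OF S] J(1) by blast
  qed
  moreover have "closedin X (\<Union>j\<in>{j \<in> J. ocell j \<inter> S \<noteq> {}}. ccell j \<inter> ccell c)"
    using J(1,2) closedin_ccell c by (intro closedin_Union) (auto intro!: closedin_Int)
  ultimately show "closedin X (S \<inter> \<Phi> c ` topspace (closed_disk (cdim c)))"
    by (simp add: ccell_def)
qed

lemma closedin_cells: "closed_family J \<Longrightarrow> closedin X (cells J)"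
  by (simp add: closedin_subcomplex subcomplex_cells)

lemma subcomplex_skeleton_part:
  assumes "closed_family J" shows "closed_family {c \<in> J. cdim c \<le> n}"
  unfolding closed_family_def
proof (intro conjI ballI)
  show "{c \<in> J. cdim c \<le> n} \<subseteq> I" using assms by (auto simp: closed_family_def)
  fix c assume c: "c \<in> {c \<in> J. cdim c \<le> n}"
  then have cJ: "ccell c \<subseteq> cells J" "c \<in> I" "J \<subseteq> I" using assms by (auto simp: closed_family_def)
  obtain K where K: "K \<subseteq> I" "finite K" "ccell c \<subseteq> cells K" "cells K \<subseteq> cells J" "c \<in> K"
    "\<And>j. j \<in> K \<Longrightarrow> j \<noteq> c \<Longrightarrow> cdim j < cdim c"
    using subcomplex_closure_finite[OF subcomplex_cells[OF assms] cJ(2,1)] by metis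
  have "K \<subseteq> J"
  proof
    fix j assume j: "j \<in> K"
    obtain x where "x \<in> ocell j" using ocell_nonempty by auto
    then show "j \<in> J" using ocell_in_cells_iff[OF cJ(3), of j x] K(1,4) j
      unfolding cells_def by blast
  qed
  then have "K \<subseteq> {c \<in> J. cdim c \<le> n}" using K(6) c by fastforce
  then show "ccell c \<subseteq> cells {c \<in> J. cdim c \<le> n}"
    using K(3) unfolding cells_def by blast
qed

lemma cells_UN: "cells (\<Union>a\<in>A. J a) = (\<Union>a\<in>A. cells (J a))"
  by (auto simp: cells_def)

lemma closed_family_UN:
  "(\<And>a. a \<in> A \<Longrightarrow> closed_family (J a)) \<Longrightarrow> closed_family (\<Union>a\<in>A. J a)"
proof -
  assume J: "\<And>a. a \<in> A \<Longrightarrow> closed_family (J a)"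
  show ?thesis
    unfolding closed_family_def
  proof (intro conjI ballI)
    show "(\<Union>a\<in>A. J a) \<subseteq> I" using J by (auto simp: closed_family_def)
    fix c assume "c \<in> (\<Union>a\<in>A. J a)"
    then obtain a where "a \<in> A" "c \<in> J a" by blast
    then have "ccell c \<subseteq> cells (J a)" using J by (auto simp: closed_family_def)
    then show "ccell c \<subseteq> cells (\<Union>a\<in>A. J a)" unfolding cells_UN using \<open>a \<in> A\<close> by blast
  qed
qed

text \<open>Induction on the dimension: the hull is the cell together with the hulls of the finitely
  many cells that its boundary meets. The clause on \<open>S\<close> makes it the least subcomplex
  containing the cell.\<close>

lemma finite_hull:
  assumes "c \<in> I"
  shows "\<exists>J. finite J \<and> closed_family J \<and> c \<in> J \<and>
    (\<forall>S. subcomplex X I cdim \<Phi> S \<longrightarrow> ocell c \<inter> S \<noteq> {} \<longrightarrow> cells J \<subseteq> S)"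
  using assms
proof (induction "cdim c" arbitrary: c rule: less_induct)
  case less
  have top: "subcomplex X I cdim \<Phi> (topspace X)"
    using ccell_subset_topspace by (auto simp: subcomplex_def ccell_def)
  obtain J where J: "J \<subseteq> I" "finite J" "\<forall>j\<in>J. cdim j < cdim c"
    "\<Phi> c ` disk_boundary (cdim c) \<subseteq> cells J"
    using closure_finite[OF less(2)] unfolding cells_def ocell_def by blast
  define J' where "J' = {j \<in> J. ocell j \<inter> \<Phi> c ` disk_boundary (cdim c) \<noteq> {}}"
  have J': "\<Phi> c ` disk_boundary (cdim c) \<subseteq> cells J'" 
    using J(4) unfolding J'_def cells_def by blast
  have finJ': "finite J'" using J(2) unfolding J'_def by simp
  have "\<forall>j\<in>J'. \<exists>K. finite K \<and> closed_family K \<and> j \<in> K \<and>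
    (\<forall>S. subcomplex X I cdim \<Phi> S \<longrightarrow> ocell j \<inter> S \<noteq> {} \<longrightarrow> cells K \<subseteq> S)"
    using less(1) J(1,3) unfolding J'_def by blast
  then obtain K where K: "\<And>j. j \<in> J' \<Longrightarrow> finite (K j) \<and> closed_family (K j) \<and> j \<in> K j \<and>
    (\<forall>S. subcomplex X I cdim \<Phi> S \<longrightarrow> ocell j \<inter> S \<noteq> {} \<longrightarrow> cells (K j) \<subseteq> S)"
    by metis
  define L where "L = (\<Union>j\<in>J'. K j)"
  have L: "closed_family L" "finite L" "cells J' \<subseteq> cells L"
    subgoal using K unfolding L_def by (intro closed_family_UN) blast
    subgoal using K finJ' unfolding L_def by blast
    subgoal using K unfolding L_def cells_def by blast
    done
  show ?case
  proof (intro exI[of _ "insert c L"] conjI allI impI)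
    show "finite (insert c L)" "c \<in> insert c L" using L by auto
    show "closed_family (insert c L)"
    proof -
      have "ccell c \<subseteq> cells (insert c L)"
        using J' L(3) unfolding ccell_eq[of c] cells_def by blast
      then show ?thesis using L(1) less(2) unfolding closed_family_def cells_def by blast
    qed
    fix S assume S: "subcomplex X I cdim \<Phi> S" "ocell c \<inter> S \<noteq> {}"
    then have cS: "ccell c \<subseteq> S" using subcomplex_ccell less(2) by blast
    have "cells (K j) \<subseteq> S" if "j \<in> J'" for j
    proof -
      have "ocell j \<inter> S \<noteq> {}" using that cS unfolding J'_def ccell_eq[of c] by blast
      then show ?thesis using K[OF that] S(1) by blast
    qed
    then have "cells L \<subseteq> S" unfolding L_def cells_UN by blast
    then show "cells (insert c L) \<subseteq> S" using cS ocell_subset_ccell[of c] by (auto simp: cells_def)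
  qed
qed

text \<open>Choose one point of \<open>C\<close> in every cell that meets \<open>C\<close>. Any set
  of chosen points meets each closed cell in a finite set and is therefore closed, so the chosen
  points form a closed discrete subset of a compact set.\<close>

lemma compactin_finite_cells:
  assumes C: "compactin X C"
  shows "finite {c \<in> I. ocell c \<inter> C \<noteq> {}}"
proof -
  let ?I = "{c \<in> I. ocell c \<inter> C \<noteq> {}}"
  define pt where "pt c = (SOME x. x \<in> ocell c \<inter> C)" for c
  have pt: "pt c \<in> ocell c \<inter> C" if "c \<in> ?I" for c
  proof -
    have "\<exists>x. x \<in> ocell c \<inter> C" using that by blast
    then show ?thesis unfolding pt_def by (rule someI_ex)
  qed
  have inj: "inj_on pt ?I"
  proof (rule inj_onI)
    fix c c' assume "c \<in> ?I" "c' \<in> ?I" "pt c = pt c'"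
    then show "c = c'" using ocell_disjoint[of c c' "pt c"] pt[of c] pt[of c'] by auto
  qed
  have sub: "pt ` ?I \<subseteq> C" using pt by blast
  have Csub: "C \<subseteq> topspace X" using C compactin_subset_topspace by blast
  have closed: "closedin X P" if P: "P \<subseteq> pt ` ?I" for P
  proof (rule weak_topology)
    show "P \<subseteq> topspace X" using P sub Csub by blast
    fix c assume c: "c \<in> I"
    obtain J where "finite J" "closed_family J" "c \<in> J"
      using finite_hull[OF c] by auto
    then have J: "J \<subseteq> I" "finite J" "ccell c \<subseteq> cells J"
      by (auto simp: closed_family_def)
    have "P \<inter> ccell c \<subseteq> pt ` J"
    proof
      fix x assume x: "x \<in> P \<inter> ccell c"
      then obtain c' where c': "c' \<in> ?I" "x = pt c'" using P by blast
      obtain j where j: "j \<in> J" "x \<in> ocell j" using x J(3) cells_def by auto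
      then have "j = c'" using ocell_disjoint[of j c' x] pt[OF c'(1)] c' J(1) by blast
      then show "x \<in> pt ` J" using j c' by blast
    qed
    then have "finite (P \<inter> ccell c)" using J(2) finite_subset by blast
    moreover have "P \<inter> ccell c \<subseteq> topspace X" using P sub Csub by blast
    ultimately show "closedin X (P \<inter> \<Phi> c ` topspace (closed_disk (cdim c)))"
      unfolding ccell_def[symmetric]
      using Hausdorff Hausdorff_imp_t1_space t1_space_closedin_finite by blast
  qed
  have "compactin X (pt ` ?I)"
    using closed[of "pt ` ?I"] C sub closed_compactin by blast
  moreover have "subtopology X (pt ` ?I) = discrete_topology (pt ` ?I)"
  proof -
    let ?Y = "subtopology X (pt ` ?I)"
    have top: "topspace ?Y = pt ` ?I" using sub Csub by auto
    have "openin ?Y {x}" if "x \<in> pt ` ?I" for x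
    proof -
      have "closedin ?Y (pt ` ?I - {x})"
        by (intro closedin_subset_topspace closed) auto
      then have "openin ?Y (topspace ?Y - (pt ` ?I - {x}))" by blast
      moreover have "topspace ?Y - (pt ` ?I - {x}) = {x}" using top that by blast
      ultimately show ?thesis by simp
    qed
    then show ?thesis using top discrete_topology_unique[of "pt ` ?I" ?Y] by simp
  qed
  ultimately have "finite (pt ` ?I)"
    by (simp add: compactin_subspace compact_space_discrete_topology)
  then show ?thesis using inj finite_imageD by blast
qed

text \<open>The minimality clause is what keeps later homotopies inside superlevel sets: if the
  compact set lies in such a subcomplex, so does its hull.\<close>

lemma compactin_finite_subcomplex:
  assumes C: "compactin X C"
  obtains J where "finite J" "closed_family J" "C \<subseteq> cells J"
    "\<And>S. subcomplex X I cdim \<Phi> S \<Longrightarrow> C \<subseteq> S \<Longrightarrow> cells J \<subseteq> S"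
proof -
  let ?I = "{c \<in> I. ocell c \<inter> C \<noteq> {}}"
  have Csub: "C \<subseteq> topspace X" using C compactin_subset_topspace by blast
  obtain K where K: "\<And>c. c \<in> ?I \<Longrightarrow> finite (K c) \<and> closed_family (K c) \<and> c \<in> K c \<and>
    (\<forall>S. subcomplex X I cdim \<Phi> S \<longrightarrow> ocell c \<inter> S \<noteq> {} \<longrightarrow> cells (K c) \<subseteq> S)"
    using finite_hull by (metis (no_types, lifting) mem_Collect_eq)
  show ?thesis
  proof (rule that[of "\<Union>c\<in>?I. K c"])
    show "finite (\<Union>c\<in>?I. K c)" using compactin_finite_cells[OF C] K by blast
    show "closed_family (\<Union>c\<in>?I. K c)" using K by (intro closed_family_UN) blast
    show "C \<subseteq> cells (\<Union>c\<in>?I. K c)"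
    proof
      fix x assume x: "x \<in> C"
      then obtain c where "c \<in> I" "x \<in> ocell c" using Csub obtain_cell by blast
      then show "x \<in> cells (\<Union>c\<in>?I. K c)" using x K unfolding cells_def by blast
    qed
    fix S assume "subcomplex X I cdim \<Phi> S" "C \<subseteq> S"
    then show "cells (\<Union>c\<in>?I. K c) \<subseteq> S" using K unfolding cells_UN by blast
  qed
qed

lemma compactin_cells:
  assumes "finite J" "closed_family J" shows "compactin X (cells J)"
proof -
  have "cells J = (\<Union>c\<in>J. ccell c)"
    using assms(2) ocell_subset_ccell unfolding closed_family_def cells_def by blast
  moreover have "compactin X (\<Union>c\<in>J. ccell c)"
    using assms compactin_ccell unfolding closed_family_def by (intro compactin_Union) auto
  ultimately show ?thesis by simp
qed

text \<open>With finitely many cells the weak topology need not be exchanged with the factor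
  \<open>{0..1}\<close>: the closed cells form a finite closed cover, and each cylinder over a
  closed cell is a quotient of a compact cylinder over a disk.\<close>

lemma continuous_map_cellwise:
  assumes J: "finite J" "J \<subseteq> I" and S: "S \<subseteq> (\<Union>c\<in>J. ccell c)"
    and H: "\<And>c. c \<in> J \<Longrightarrow> continuous_map (prod_topology (top_of_set {0..1::real}) (closed_disk (cdim c))) T
      (\<lambda>(t, y). H (t, \<Phi> c y))"
  shows "continuous_map (prod_topology (top_of_set {0..1}) (subtopology X S)) T H"
proof -
  let ?U = "\<Union>c\<in>J. ccell c"
  let ?P = "prod_topology (top_of_set {0..1::real}) (subtopology X ?U)"
  have U: "?U \<subseteq> topspace X" using ccell_subset_topspace J(2) by blast
  have "continuous_map ?P T H"
  proof (rule continuous_map_finite_closed_cover[OF J(1), where C = "\<lambda>c. {0..1} \<times> ccell c"])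
    show "topspace ?P \<subseteq> (\<Union>c\<in>J. {0..1} \<times> ccell c)" by auto
    fix c assume c: "c \<in> J"
    then have cI: "c \<in> I" using J by blast
    have "closedin (subtopology X ?U) (ccell c)"
      using closedin_ccell[OF cI] c by (intro closedin_subset_topspace) auto
    moreover have "closedin (top_of_set {0..1::real}) {0..1}" by simp
    ultimately show "closedin ?P ({0..1} \<times> ccell c)"
      by (simp add: closedin_prod_Times_iff)
    have eq: "subtopology ?P ({0..1} \<times> ccell c) =
      prod_topology (top_of_set {0..1::real}) (subtopology X (ccell c))"
    proof -
      have "?U \<inter> ccell c = ccell c" using c by blast
      then show ?thesis
        by (simp add: subtopology_Times subtopology_subtopology)
    qed
    have q: "continuous_map (closed_disk (cdim c)) (subtopology X (ccell c)) (\<Phi> c)"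
      using continuous_char[OF cI] by (auto simp: continuous_map_in_subtopology ccell_def)
    show "continuous_map (subtopology ?P ({0..1} \<times> ccell c)) T H"
      unfolding eq
    proof (rule continuous_map_compact_quotient)
      show "compact_space (prod_topology (top_of_set {0..1::real}) (closed_disk (cdim c)))"
        by (simp add: compact_space_prod_topology compact_space_closed_disk compact_space_subtopology)
      show "Hausdorff_space (prod_topology (top_of_set {0..1::real}) (subtopology X (ccell c)))"
        by (simp add: Hausdorff_space_prod_topology Hausdorff_space_subtopology Hausdorff)
      show "continuous_map (prod_topology (top_of_set {0..1::real}) (closed_disk (cdim c)))
         (prod_topology (top_of_set {0..1::real}) (subtopology X (ccell c))) (\<lambda>(t, y). (t, \<Phi> c y))"
        using q by (simp add: continuous_map_prod_top)
      show "(\<lambda>(t, y). (t, \<Phi> c y)) ` topspace (prod_topology (top_of_set {0..1::real}) (closed_disk (cdim c)))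
        = topspace (prod_topology (top_of_set {0..1::real}) (subtopology X (ccell c)))"
        using ccell_subset_topspace[OF cI] by (auto simp: ccell_def image_iff)
      show "continuous_map (prod_topology (top_of_set {0..1::real}) (closed_disk (cdim c))) T
         (H \<circ> (\<lambda>(t, y). (t, \<Phi> c y)))"
        using H[OF c] by (simp add: o_def case_prod_unfold)
    qed
  qed
  then have "continuous_map (subtopology ?P ({0..1} \<times> S)) T H"
    by (rule continuous_map_from_subtopology)
  moreover have "subtopology ?P ({0..1} \<times> S) = prod_topology (top_of_set {0..1}) (subtopology X S)"
    using S by (simp add: subtopology_Times subtopology_subtopology inf.absorb2)
  ultimately show ?thesis by simp
qed

end

section \<open>Approximation by maps of small local rank\<close>

text \<open>Gaussian elimination: an equation with a nonzero coefficient at \<open>r\<close>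
  determines the unknown \<open>r\<close>, and substituting it away costs one equation and one
  unknown.\<close>

lemma homogeneous_system_nontrivial_solution:
  fixes p :: "'v \<Rightarrow> 'j \<Rightarrow> real"
  assumes "finite A" "finite B" "card A < card B"
  shows "\<exists>a. (\<exists>j\<in>B. a j \<noteq> 0) \<and> (\<forall>v\<in>A. (\<Sum>j\<in>B. a j * p v j) = 0)"
  using assms
proof (induction A arbitrary: B p rule: finite_induct)
  case empty
  then have "B \<noteq> {}" by auto
  then show ?case by (intro exI[of _ "\<lambda>_. 1"]) auto
next
  case (insert v A)
  show ?case
  proof (cases "\<forall>j\<in>B. p v j = 0")
    case True
    have "card A < card B" using insert by simp
    then obtain a where "\<exists>j\<in>B. a j \<noteq> 0" "\<forall>v\<in>A. (\<Sum>j\<in>B. a j * p v j) = 0"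
      using insert.IH[OF insert.prems(1)] by blast
    then show ?thesis using True by (intro exI[of _ a]) simp
  next
    case False
    then obtain r where r: "r \<in> B" "p v r \<noteq> 0" by blast
    have "card A < card (B - {r})" using insert r by simp
    then obtain a where a: "\<exists>j\<in>B - {r}. a j \<noteq> 0"
      "\<And>w. w \<in> A \<Longrightarrow> (\<Sum>j\<in>B - {r}. a j * (p w j - p w r * p v j / p v r)) = 0"
      using insert.IH[of "B - {r}" "\<lambda>w j. p w j - p w r * p v j / p v r"] insert.prems by auto
    define s where "s = - (\<Sum>j\<in>B - {r}. a j * p v j) / p v r"
    define b where "b = a(r := s)"
    have sum: "(\<Sum>j\<in>B. b j * p w j) = s * p w r + (\<Sum>j\<in>B - {r}. a j * p w j)" for w
      using r(1) insert.prems(1) by (simp add: sum.remove b_def)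
    have "(\<Sum>j\<in>B. b j * p w j) = 0" if "w \<in> A" for w
    proof -
      have "0 = (\<Sum>j\<in>B - {r}. a j * p w j - (p w r / p v r) * (a j * p v j))"
        using a(2)[OF that] by (simp add: algebra_simps)
      also have "\<dots> = (\<Sum>j\<in>B - {r}. a j * p w j) - (p w r / p v r) * (\<Sum>j\<in>B - {r}. a j * p v j)"
        by (simp add: sum_subtractf sum_distrib_left)
      also have "\<dots> = (\<Sum>j\<in>B. b j * p w j)"
        unfolding sum by (simp add: s_def)
      finally show ?thesis by simp
    qed
    moreover have "(\<Sum>j\<in>B. b j * p v j) = 0"
      unfolding sum using r(2) by (simp add: s_def)
    moreover have "\<exists>j\<in>B. b j \<noteq> 0" using a(1) by (auto simp: b_def)
    ultimately show ?thesis by (intro exI[of _ b]) auto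
  qed
qed

text \<open>Finitely many hyperplanes meet the moment curve in finitely many points.\<close>

lemma exists_point_off_small_spans:
  fixes p :: "'v \<Rightarrow> nat \<Rightarrow> real"
  assumes V: "finite V" and N: "N < m" and e: "0 < e"
  obtains q where "\<And>j. \<bar>q j\<bar> \<le> e"
    "\<And>A c. A \<subseteq> V \<Longrightarrow> card A \<le> N \<Longrightarrow> \<exists>j<m. q j \<noteq> (\<Sum>v\<in>A. c v * p v j)"
proof -
  \<comment> \<open>Since \<open>N < m\<close>, every family of at most \<open>N\<close> vectors
    lies in a hyperplane through the origin; \<open>a A\<close> is a normal vector of it.\<close>
  have "\<forall>A\<in>{A. A \<subseteq> V \<and> card A \<le> N}. \<exists>a. (\<exists>j\<in>{..<m}. a j \<noteq> 0) \<and>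
    (\<forall>v\<in>A. (\<Sum>j<m. a j * p v j) = 0)"
    using N finite_subset[OF _ V]
    by (auto intro!: homogeneous_system_nontrivial_solution)
  from bchoice[OF this] obtain a where a0: "\<forall>A\<in>{A. A \<subseteq> V \<and> card A \<le> N}. (\<exists>j\<in>{..<m}. a A j \<noteq> 0) \<and>
    (\<forall>v\<in>A. (\<Sum>j<m. a A j * p v j) = 0)" by blast
  have a: "\<exists>j<m. a A j \<noteq> 0" "\<And>v. v \<in> A \<Longrightarrow> (\<Sum>j<m. a A j * p v j) = 0"
    if "A \<subseteq> V" "card A \<le> N" for A
    using a0 that by auto
  define R where "R = (\<Union>A\<in>{A. A \<subseteq> V \<and> card A \<le> N}. {t::real. (\<Sum>j\<le>m-1. a A j * t^j) = 0})"
  have "finite R"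
    unfolding R_def
  proof (intro finite_UN_I)
    show "finite {A. A \<subseteq> V \<and> card A \<le> N}" using V by simp
    fix A assume "A \<in> {A. A \<subseteq> V \<and> card A \<le> N}"
    then obtain j where "j < m" "a A j \<noteq> 0" using a(1) by blast
    then show "finite {t::real. (\<Sum>j\<le>m-1. a A j * t^j) = 0}"
      by (subst polyfun_finite_roots) (auto intro!: exI[of _ j])
  qed
  moreover have "infinite {0<..<1::real}" by simp
  ultimately obtain t where t: "t \<in> {0<..<1}" "t \<notin> R"
    by (metis finite_subset subsetI)
  have m: "{..m-1} = {..<m}" using N by auto
  show ?thesis
  proof (rule that[of "\<lambda>j. e * t^j"])
    show "\<bar>e * t ^ j\<bar> \<le> e" for j
      using e t by (simp add: abs_mult power_le_one mult_left_le)
    fix A c assume A: "A \<subseteq> V" "card A \<le> N"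
    show "\<exists>j<m. e * t ^ j \<noteq> (\<Sum>v\<in>A. c v * p v j)"
    proof (rule ccontr)
      assume "\<not> ?thesis"
      then have eq: "e * t ^ j = (\<Sum>v\<in>A. c v * p v j)" if "j < m" for j using that by blast
      have "e * (\<Sum>j<m. a A j * t^j) = (\<Sum>j<m. a A j * (e * t^j))"
        by (simp add: sum_distrib_left mult_ac)
      also have "\<dots> = (\<Sum>j<m. \<Sum>v\<in>A. c v * (a A j * p v j))"
        by (intro sum.cong) (auto simp: eq sum_distrib_left mult_ac)
      also have "\<dots> = (\<Sum>v\<in>A. \<Sum>j<m. c v * (a A j * p v j))" by (rule sum.swap)
      also have "\<dots> = 0"
        using a(2)[OF A] by (simp add: sum_distrib_left[symmetric])
      finally have "(\<Sum>j<m. a A j * t^j) = 0" using e by simp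
      then show False using t(2) A unfolding R_def m by blast
    qed
  qed
qed

lemma tendsto_coordinatewise:
  fixes f :: "'a \<Rightarrow> 'i \<Rightarrow> 'b::topological_space"
  shows "(f \<longlongrightarrow> l) F \<longleftrightarrow> (\<forall>i. ((\<lambda>a. f a i) \<longlongrightarrow> l i) F)"
proof -
  have "limitin (product_topology (\<lambda>_. euclidean) UNIV) f l F \<longleftrightarrow>
    (\<forall>i. limitin euclidean (\<lambda>a. f a i) (l i) F)"
    unfolding limitin_componentwise by simp
  then show ?thesis unfolding euclidean_product_topology limitin_canonical_iff .
qed

text \<open>The Heine-Cantor theorem with closeness measured in the first \<open>n\<close>
  coordinates, the only ones that vary on \<open>C\<close>. Of two sequences that violate it, a
  convergent subsequence of one drags the other to the same limit.\<close>

lemma uniformly_continuous_coordinates: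
  fixes f :: "(nat \<Rightarrow> real) \<Rightarrow> real"
  assumes C: "compact C" "\<And>x i. x \<in> C \<Longrightarrow> i \<ge> n \<Longrightarrow> x i = 0" and f: "continuous_on C f" and e: "0 < e"
  obtains d where "0 < d" "\<And>x y. x \<in> C \<Longrightarrow> y \<in> C \<Longrightarrow> (\<And>i. i < n \<Longrightarrow> \<bar>x i - y i\<bar> < d) \<Longrightarrow> \<bar>f x - f y\<bar> < e"
proof -
  have "\<exists>d>0. \<forall>x\<in>C. \<forall>y\<in>C. (\<forall>i<n. \<bar>x i - y i\<bar> < d) \<longrightarrow> \<bar>f x - f y\<bar> < e"
  proof (rule ccontr)
    assume neg: "\<not> ?thesis"
    have "\<exists>x y. x \<in> C \<and> y \<in> C \<and> (\<forall>i<n. \<bar>x i - y i\<bar> < 1 / Suc k) \<and> \<not> \<bar>f x - f y\<bar> < e" for k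
    proof -
      have "(0::real) < 1 / Suc k" by simp
      then show ?thesis using neg by blast
    qed
    then obtain x y where xy: "\<And>k. x k \<in> C" "\<And>k. y k \<in> C" "\<And>k i. i < n \<Longrightarrow> \<bar>x k i - y k i\<bar> < 1 / Suc k"
      "\<And>k. \<not> \<bar>f (x k) - f (y k)\<bar> < e" by metis
    have "seq_compact C" using C(1) compact_imp_seq_compact by blast
    then obtain l r where l: "l \<in> C" "strict_mono (r :: nat \<Rightarrow> nat)" "(x \<circ> r) \<longlonglongrightarrow> l"
      using xy(1) unfolding seq_compact_def by metis
    have yl: "(y \<circ> r) \<longlonglongrightarrow> l"
    proof (subst tendsto_coordinatewise, rule allI)
      fix i
      show "(\<lambda>k. (y \<circ> r) k i) \<longlonglongrightarrow> l i"
      proof (cases "i < n")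
        case True
        have "(\<lambda>k. (x \<circ> r) k i) \<longlonglongrightarrow> l i" using l(3) tendsto_coordinatewise by metis
        moreover have "(\<lambda>k. (y \<circ> r) k i - (x \<circ> r) k i) \<longlonglongrightarrow> 0"
        proof (rule Lim_null_comparison)
          have "\<bar>(y \<circ> r) k i - (x \<circ> r) k i\<bar> \<le> 1 / Suc k" for k
          proof -
            have "\<bar>x (r k) i - y (r k) i\<bar> < 1 / Suc (r k)" using xy(3) True by blast
            also have "\<dots> \<le> 1 / Suc k" using l(2) strict_mono_imp_increasing[of r k] by (simp add: frac_le)
            finally show ?thesis by simp
          qed
          then show "\<forall>\<^sub>F k in sequentially. norm ((y \<circ> r) k i - (x \<circ> r) k i) \<le> 1 / Suc k" by simp
          show "(\<lambda>k. 1 / real (Suc k)) \<longlonglongrightarrow> 0" by (rule LIMSEQ_Suc[OF lim_1_over_n])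
        qed
        ultimately have "(\<lambda>k. (x \<circ> r) k i + ((y \<circ> r) k i - (x \<circ> r) k i)) \<longlonglongrightarrow> l i + 0"
          by (rule tendsto_add)
        then show ?thesis by simp
      next
        case False
        then show ?thesis using C(2)[OF xy(2)] C(2)[OF l(1)] by simp
      qed
    qed
    have "(\<lambda>k. f (x (r k))) \<longlonglongrightarrow> f l" "(\<lambda>k. f (y (r k))) \<longlonglongrightarrow> f l"
      using f l(1,3) yl xy(1,2) unfolding continuous_on_sequentially by (auto simp: o_def)
    then have "(\<lambda>k. \<bar>f (x (r k)) - f (y (r k))\<bar>) \<longlonglongrightarrow> \<bar>f l - f l\<bar>"
      by (intro tendsto_rabs tendsto_diff)
    then have "\<forall>\<^sub>F k in sequentially. \<bar>f (x (r k)) - f (y (r k))\<bar> < e"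
      using e by (intro order_tendstoD(2)) auto
    then show False using xy(4) eventually_happens by fastforce
  qed
  then show ?thesis using that by blast
qed

text \<open>Products of hat functions around the points \<open>v / M\<close> of a cubical lattice.
  They interpolate without a triangulation of the domain, at the price that \<open>2 ^ n\<close> of
  them instead of \<open>n + 1\<close> may be nonzero at a point.\<close>

definition tent :: "nat \<Rightarrow> nat \<Rightarrow> (nat \<Rightarrow> int) \<Rightarrow> (nat \<Rightarrow> real) \<Rightarrow> real" where
  "tent n M v x = (\<Prod>j<n. max 0 (1 - \<bar>real M * x j - of_int (v j)\<bar>))"

lemma tent_nonneg: "0 \<le> tent n M v x"
  unfolding tent_def by (intro prod_nonneg) simp

lemma tent_nonzeroD:
  assumes "tent n M v x \<noteq> 0" "j < n" shows "\<bar>real M * x j - of_int (v j)\<bar> < 1"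
proof (rule ccontr)
  assume "\<not> ?thesis"
  then have "max 0 (1 - \<bar>real M * x j - of_int (v j)\<bar>) = 0" by simp
  then have "tent n M v x = 0" unfolding tent_def using assms(2) by (intro prod_zero) auto
  then show False using assms(1) by simp
qed

text \<open>Guarantees that the sum of all tents is positive, so that the tents can be normalised to
  a partition of unity.\<close>

lemma tent_floor_pos: "0 < tent n M (\<lambda>j\<in>{..<n}. \<lfloor>real M * x j\<rfloor>) x"
  unfolding tent_def
proof (intro prod_pos ballI)
  fix j assume "j \<in> {..<n}"
  moreover have "\<bar>real M * x j - of_int \<lfloor>real M * x j\<rfloor>\<bar> < 1" by linarith
  ultimately show "0 < max 0 (1 - \<bar>real M * x j - of_int ((\<lambda>j\<in>{..<n}. \<lfloor>real M * x j\<rfloor>) j)\<bar>)" by simp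
qed

text \<open>In each coordinate only the floor and its successor are within distance less than
  1.\<close>

lemma tent_support_card:
  assumes "V \<subseteq> extensional {..<n}"
  shows "finite {v \<in> V. tent n M v x \<noteq> 0}" "card {v \<in> V. tent n M v x \<noteq> 0} \<le> 2 ^ n"
proof -
  let ?P = "PiE {..<n} (\<lambda>j. {\<lfloor>real M * x j\<rfloor>, \<lfloor>real M * x j\<rfloor> + 1})"
  have sub: "{v \<in> V. tent n M v x \<noteq> 0} \<subseteq> ?P"
  proof
    fix v assume v: "v \<in> {v \<in> V. tent n M v x \<noteq> 0}"
    have "v j \<in> {\<lfloor>real M * x j\<rfloor>, \<lfloor>real M * x j\<rfloor> + 1}" if "j < n" for j
    proof -
      have "\<bar>real M * x j - of_int (v j)\<bar> < 1" using v tent_nonzeroD that by blast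
      then have "v j = \<lfloor>real M * x j\<rfloor> \<or> v j = \<lfloor>real M * x j\<rfloor> + 1" by linarith
      then show ?thesis by simp
    qed
    then show "v \<in> ?P" using v assms by (auto simp: PiE_def)
  qed
  have fin: "finite ?P" by (intro finite_PiE) auto
  then show "finite {v \<in> V. tent n M v x \<noteq> 0}" using sub finite_subset by blast
  have "card ?P = (\<Prod>j<n. card {\<lfloor>real M * x j\<rfloor>, \<lfloor>real M * x j\<rfloor> + 1})" by (simp add: card_PiE)
  also have "\<dots> = (\<Prod>j<n. 2)" by (intro prod.cong) auto
  also have "\<dots> = 2 ^ n" by simp
  finally show "card {v \<in> V. tent n M v x \<noteq> 0} \<le> 2 ^ n" using card_mono[OF fin sub] by simp
qed

lemma continuous_on_tent: "continuous_on S (tent n M v)"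
proof -
  have "continuous_on S (\<lambda>x :: nat \<Rightarrow> real. x j)" for j
    by (rule continuous_on_subset[OF continuous_on_product_coordinates]) simp
  then have "continuous_on S (\<lambda>x. \<Prod>j<n. max 0 (1 - \<bar>real M * x j - of_int (v j)\<bar>))"
    by (intro continuous_on_prod continuous_on_max continuous_on_diff continuous_on_rabs
        continuous_on_mult continuous_on_const)
  then show ?thesis by (simp add: tent_def)
qed

text \<open>At every point at most \<open>2\<^sup>n\<close> tents of the lattice are nonzero, so the interpolation of \<open>g\<close> on
  the lattice takes values in finitely many subspaces of dimension at most \<open>2\<^sup>n < m\<close>, and a small
  translation moves them off the origin.\<close>

lemma avoid_zero_approximation:
  fixes g :: "(nat \<Rightarrow> real) \<Rightarrow> nat \<Rightarrow> real"
  assumes C: "compact C" "\<And>x i. x \<in> C \<Longrightarrow> i \<ge> n \<Longrightarrow> x i = 0" "\<And>x i. x \<in> C \<Longrightarrow> \<bar>x i\<bar> \<le> 1"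
    and g: "\<And>j. j < m \<Longrightarrow> continuous_on C (\<lambda>x. g x j)"
    and m: "2 ^ n < m" and e: "0 < e"
  obtains g' where "\<And>j. j < m \<Longrightarrow> continuous_on C (\<lambda>x. g' x j)"
    "\<And>x j. x \<in> C \<Longrightarrow> j < m \<Longrightarrow> \<bar>g' x j - g x j\<bar> \<le> e"
    "\<And>x. x \<in> C \<Longrightarrow> \<exists>j<m. g' x j \<noteq> 0"
proof -
  have "\<forall>j\<in>{..<m}. \<exists>d>0. \<forall>x\<in>C. \<forall>y\<in>C. (\<forall>i<n. \<bar>x i - y i\<bar> < d) \<longrightarrow> \<bar>g x j - g y j\<bar> < e/2"
  proof
    fix j assume "j \<in> {..<m}"
    then have "continuous_on C (\<lambda>x. g x j)" "0 < e/2" using g e by auto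
    then obtain d where "0 < d" "\<And>x y. x \<in> C \<Longrightarrow> y \<in> C \<Longrightarrow> (\<And>i. i < n \<Longrightarrow> \<bar>x i - y i\<bar> < d) \<Longrightarrow>
      \<bar>g x j - g y j\<bar> < e/2"
      using uniformly_continuous_coordinates[of C n "\<lambda>x. g x j" "e/2"] C(1,2) by blast
    then show "\<exists>d>0. \<forall>x\<in>C. \<forall>y\<in>C. (\<forall>i<n. \<bar>x i - y i\<bar> < d) \<longrightarrow> \<bar>g x j - g y j\<bar> < e/2"
      by (intro exI[of _ d]) blast
  qed
  from bchoice[OF this] obtain D where D0: "\<forall>j\<in>{..<m}. D j > 0 \<and> (\<forall>x\<in>C. \<forall>y\<in>C.
    (\<forall>i<n. \<bar>x i - y i\<bar> < D j) \<longrightarrow> \<bar>g x j - g y j\<bar> < e/2)" by blast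
  have D: "0 < D j" "\<And>x y. x \<in> C \<Longrightarrow> y \<in> C \<Longrightarrow> (\<And>i. i < n \<Longrightarrow> \<bar>x i - y i\<bar> < D j) \<Longrightarrow> \<bar>g x j - g y j\<bar> < e/2"
    if "j < m" for j using D0 that by auto
  define d where "d = Min (D ` {..<m})"
  have d0: "0 < d" unfolding d_def using D(1) m by (subst Min_gr_iff) auto
  have dD: "d \<le> D j" if "j < m" for j unfolding d_def using that by simp
  \<comment> \<open>Two points in the support of the same tent differ by less than
    \<open>2 / M\<close> in each coordinate, and this has to stay below the modulus of continuity
    \<open>d\<close>.\<close>
  obtain M :: nat where M: "2 / d < real M" using reals_Archimedean2 by blast
  have M0: "0 < real M" using M d0 by (meson divide_pos_pos less_trans zero_less_numeral)
  have dM: "2 / real M < d" using M M0 d0 by (simp add: field_simps)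
  define V0 where "V0 = PiE {..<n} (\<lambda>_. {- int M - 1..int M + 1})"
  define V where "V = {v \<in> V0. \<exists>x\<in>C. tent n M v x \<noteq> 0}"
  have "finite V0" unfolding V0_def by (intro finite_PiE) auto
  then have V: "finite V" "V \<subseteq> extensional {..<n}"
    unfolding V_def by (simp, auto simp: V0_def PiE_def)
  \<comment> \<open>The lattice point \<open>v / M\<close> itself may lie outside \<open>C\<close>,
    where nothing is known about \<open>g\<close>, so \<open>g\<close> is sampled at a point of
    \<open>C\<close> in the support of the tent.\<close>
  define pt where "pt v = (SOME x. x \<in> C \<and> tent n M v x \<noteq> 0)" for v
  have pt: "pt v \<in> C \<and> tent n M v (pt v) \<noteq> 0" if "v \<in> V" for v
  proof -
    have "\<exists>x. x \<in> C \<and> tent n M v x \<noteq> 0" using that by (auto simp: V_def)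
    then show ?thesis unfolding pt_def by (rule someI_ex)
  qed
  define W where "W x = (\<Sum>v\<in>V. tent n M v x)" for x
  have W0: "0 < W x" if x: "x \<in> C" for x
  proof -
    let ?v = "\<lambda>j\<in>{..<n}. \<lfloor>real M * x j\<rfloor>"
    have "?v \<in> V0"
      unfolding V0_def
    proof (rule restrict_PiE_iff[THEN iffD2], intro ballI)
      fix j
      have "\<bar>real M * x j\<bar> \<le> real M * 1"
        unfolding abs_mult using C(3)[OF x, of j] by (intro mult_mono) auto
      then show "\<lfloor>real M * x j\<rfloor> \<in> {- int M - 1..int M + 1}" by (simp add: abs_le_iff) linarith
    qed
    then have "?v \<in> V" unfolding V_def using x tent_floor_pos[of n M x] by (auto intro!: bexI[of _ x])
    then show ?thesis unfolding W_def
      using V(1) tent_floor_pos[of n M x] tent_nonneg by (intro sum_pos2) auto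
  qed
  \<comment> \<open>Half of \<open>e\<close> is spent on this translation, the other half on the
    interpolation error.\<close>
  obtain q where q: "\<And>j. \<bar>q j\<bar> \<le> e/2"
    "\<And>A c. A \<subseteq> V \<Longrightarrow> card A \<le> 2 ^ n \<Longrightarrow> \<exists>j<m. q j \<noteq> (\<Sum>v\<in>A. c v * g (pt v) j)"
    using exists_point_off_small_spans[OF V(1) m, of "e/2" "\<lambda>v. g (pt v)"] e by auto
  define a where "a x j = (\<Sum>v\<in>V. tent n M v x * g (pt v) j) / W x" for x j
  show ?thesis
  proof (rule that[of "\<lambda>x j. a x j - q j"])
    fix j assume j: "j < m"
    show "continuous_on C (\<lambda>x. a x j - q j)"
      unfolding a_def W_def using W0 unfolding W_def
      by (intro continuous_intros continuous_on_tent) fastforce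
    fix x assume x: "x \<in> C"
    have "a x j - g x j = (\<Sum>v\<in>V. tent n M v x * (g (pt v) j - g x j)) / W x"
    proof -
      have "g x j = (\<Sum>v\<in>V. tent n M v x * g x j) / W x"
        using W0[OF x] by (simp add: sum_distrib_right[symmetric] W_def)
      then show ?thesis
        unfolding a_def by (simp add: right_diff_distrib sum_subtractf diff_divide_distrib)
    qed
    moreover have "\<bar>\<Sum>v\<in>V. tent n M v x * (g (pt v) j - g x j)\<bar> \<le> (\<Sum>v\<in>V. tent n M v x * (e/2))"
    proof (rule order_trans[OF sum_abs], rule sum_mono)
      fix v assume v: "v \<in> V"
      show "\<bar>tent n M v x * (g (pt v) j - g x j)\<bar> \<le> tent n M v x * (e/2)"
      proof (cases "tent n M v x = 0")
        case False
        have "\<bar>g (pt v) j - g x j\<bar> < e/2"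
        proof (rule D(2)[OF j _ x])
          show "pt v \<in> C" using pt v by blast
          fix i assume i: "i < n"
          have "\<bar>real M * x i - of_int (v i)\<bar> < 1" "\<bar>real M * pt v i - of_int (v i)\<bar> < 1"
            using tent_nonzeroD False pt[OF v] i by blast+
          then have "\<bar>real M * (pt v i - x i)\<bar> < 2" unfolding right_diff_distrib by linarith
          then have "real M * \<bar>pt v i - x i\<bar> < 2" by (simp add: abs_mult)
          then have "\<bar>pt v i - x i\<bar> < 2 / real M" using M0 by (simp add: field_simps)
          then show "\<bar>pt v i - x i\<bar> < D j" using dM dD[OF j] by linarith
        qed
        then have "tent n M v x * \<bar>g (pt v) j - g x j\<bar> \<le> tent n M v x * (e/2)"
          using tent_nonneg by (intro mult_left_mono) auto
        then show ?thesis using tent_nonneg[of n M v x] by (simp only: abs_mult abs_of_nonneg)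
      qed simp
    qed
    ultimately have "\<bar>a x j - g x j\<bar> \<le> (\<Sum>v\<in>V. tent n M v x * (e/2)) / W x"
      using W0[OF x] by (simp only: abs_divide abs_of_pos divide_right_mono less_imp_le)
    also have "\<dots> = e/2"
      unfolding sum_distrib_right[symmetric] W_def[symmetric] using W0[OF x] by simp
    finally show "\<bar>a x j - q j - g x j\<bar> \<le> e" using q(1)[of j] by linarith
  next
    fix x assume x: "x \<in> C"
    \<comment> \<open>At \<open>x\<close> the interpolation is a combination of the samples of
      \<open>?A\<close> alone, which are at most \<open>2 ^ n\<close> vectors; \<open>q\<close> was
      chosen to differ from every such combination.\<close>
    let ?A = "{v \<in> V. tent n M v x \<noteq> 0}"
    obtain j where j: "j < m" "q j \<noteq> (\<Sum>v\<in>?A. (tent n M v x / W x) * g (pt v) j)"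
      using q(2)[of ?A "\<lambda>v. tent n M v x / W x"] tent_support_card[OF V(2), of M x] by auto
    have "(\<Sum>v\<in>?A. (tent n M v x / W x) * g (pt v) j) = (\<Sum>v\<in>V. (tent n M v x / W x) * g (pt v) j)"
      using V(1) by (intro sum.mono_neutral_left) auto
    also have "\<dots> = a x j" by (simp add: a_def sum_divide_distrib)
    finally have "q j \<noteq> a x j" using j(2) by simp
    then show "\<exists>j<m. a x j - q j \<noteq> 0" using j(1) by (intro exI[of _ j]) simp
  qed
qed

section \<open>Continuity in coordinates, norm estimates and radial pushing\<close>

abbreviation unit_interval :: "real topology" where
  "unit_interval \<equiv> top_of_set {0..1}"

lemma continuous_map_real_compose:
  assumes "continuous_map T euclideanreal f" "continuous_on UNIV h"
  shows "continuous_map T euclideanreal (\<lambda>x. h (f x))"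
  using continuous_map_compose[OF assms(1), of euclideanreal h] assms(2) by (simp add: o_def)

lemma continuous_map_L2_set:
  fixes m :: nat
  assumes "\<And>j. j < m \<Longrightarrow> continuous_map T euclideanreal (\<lambda>x. F x j)"
  shows "continuous_map T euclideanreal (\<lambda>x. L2_set (F x) {..<m})"
  unfolding L2_set_def
proof (rule continuous_map_real_compose[where h = sqrt])
  show "continuous_map T euclideanreal (\<lambda>x. \<Sum>j<m. (F x j)\<^sup>2)"
    using assms by (intro continuous_map_sum continuous_map_real_pow) auto
  show "continuous_on UNIV sqrt" by (intro continuous_intros)
qed

lemma continuous_map_closed_disk:
  assumes "\<And>j. j < m \<Longrightarrow> continuous_map T euclideanreal (\<lambda>x. F x j)"
    and "\<And>x. x \<in> topspace T \<Longrightarrow> F x \<in> topspace (closed_disk m)"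
  shows "continuous_map T (closed_disk m) F"
proof -
  have "continuous_map T euclideanreal (\<lambda>x. F x j)" for j
  proof (cases "j < m")
    case False
    have "continuous_map T euclideanreal (\<lambda>x. 0)" by simp
    then show ?thesis
      by (rule continuous_map_eq) (use assms(2) False in \<open>auto simp: topspace_closed_disk\<close>)
  qed (rule assms(1))
  then have "continuous_map T (powertop_real UNIV) F"
    by (simp add: continuous_map_componentwise_UNIV)
  then have "continuous_map T euclidean F" by (simp add: euclidean_product_topology)
  then show ?thesis
    unfolding closed_disk_eq
    using assms(2) by (intro continuous_map_into_subtopology) (auto simp: topspace_closed_disk)
qed

lemma continuous_map_coordinate_top_of_set:
  "continuous_map (top_of_set S) euclideanreal (\<lambda>x :: nat \<Rightarrow> real. x j)"
  by (simp add: continuous_on_subset[OF continuous_on_product_coordinates])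

lemma continuous_map_coordinate_closed_disk:
  "continuous_map (closed_disk m) euclideanreal (\<lambda>x. x j)"
  unfolding closed_disk_eq by (rule continuous_map_coordinate_top_of_set)

lemma continuous_map_coordinate_open_disk:
  "continuous_map (open_disk m) euclideanreal (\<lambda>x. x j)"
  unfolding open_disk_eq by (rule continuous_map_coordinate_top_of_set)

lemma continuous_map_fst_interval:
  "continuous_map (prod_topology unit_interval T) euclideanreal fst"
  using continuous_map_fst continuous_map_in_subtopology by blast

lemma continuous_map_snd_compose:
  "continuous_map T U f \<Longrightarrow> continuous_map (prod_topology A T) U (\<lambda>z. f (snd z))"
  using continuous_map_compose[OF continuous_map_snd, of T U f A] by (simp add: o_def)

lemma L2_set_le_abs_sum_bound:
  assumes "\<And>j. j < m \<Longrightarrow> \<bar>x j\<bar> \<le> e"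
  shows "L2_set x {..<m} \<le> real m * e"
proof -
  have "L2_set x {..<m} \<le> (\<Sum>j<m. \<bar>x j\<bar>)" by (rule L2_set_le_sum_abs)
  also have "\<dots> \<le> (\<Sum>j<m. e)" by (intro sum_mono) (use assms in auto)
  finally show ?thesis by simp
qed

lemma L2_set_scale: "L2_set (\<lambda>j. c * x j) A = \<bar>c\<bar> * L2_set x A"
  using L2_set_right_distrib[of "\<bar>c\<bar>" x A] by (simp add: L2_set_def power_mult_distrib)

lemma L2_set_diff_ge: "L2_set x A - L2_set (\<lambda>j. c * u j) A \<le> L2_set (\<lambda>j. x j + c * u j) A"
proof -
  have "L2_set (\<lambda>j. (x j + c * u j) + (- c) * u j) A
    \<le> L2_set (\<lambda>j. x j + c * u j) A + L2_set (\<lambda>j. (- c) * u j) A"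
    by (rule L2_set_triangle_ineq)
  then show ?thesis unfolding L2_set_scale by simp
qed

lemma top_of_set_nsphere: "nsphere i = top_of_set (topspace (nsphere i))"
  unfolding nsphere_def Euclidean_space_eq by (simp add: subtopology_subtopology)

lemma topspace_nsphere: "topspace (nsphere i) = disk_boundary (Suc i)"
  unfolding disk_boundary_eq nsphere_def topspace_subtopology topspace_Euclidean_space
  by (auto simp: L2_set_def lessThan_Suc_atMost)

lemma closedin_closed_disk_level:
  "closedin (closed_disk m) {x \<in> topspace (closed_disk m). L2_set x {..<m} \<le> r}"
  "closedin (closed_disk m) {x \<in> topspace (closed_disk m). r \<le> L2_set x {..<m}}"
proof -
  have c: "continuous_map (closed_disk m) euclideanreal (\<lambda>x. L2_set x {..<m})"
    by (intro continuous_map_L2_set continuous_map_coordinate_closed_disk)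
  show "closedin (closed_disk m) {x \<in> topspace (closed_disk m). L2_set x {..<m} \<le> r}"
    using closedin_continuous_map_preimage[OF c, of "{..r}"] by simp
  show "closedin (closed_disk m) {x \<in> topspace (closed_disk m). r \<le> L2_set x {..<m}}"
    using closedin_continuous_map_preimage[OF c, of "{r..}"] by simp
qed

lemma compact_space_nsphere: "compact_space (nsphere i)"
proof -
  have "closedin (closed_disk (Suc i)) {x \<in> topspace (closed_disk (Suc i)). 1 \<le> L2_set x {..<Suc i}}"
    by (rule closedin_closed_disk_level)
  also have "{x \<in> topspace (closed_disk (Suc i)). 1 \<le> L2_set x {..<Suc i}} = topspace (nsphere i)"
    by (auto simp: topspace_nsphere disk_boundary_eq topspace_closed_disk)
  finally have "compactin (closed_disk (Suc i)) (topspace (nsphere i))"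
    using closedin_compact_space compact_space_closed_disk by blast
  then have "compactin euclidean (topspace (nsphere i))"
    unfolding closed_disk_eq by (simp add: compactin_subtopology)
  then show ?thesis by (subst top_of_set_nsphere) (simp add: compact_space_subtopology)
qed

lemma blend_continuous_map:
  assumes g: "\<And>j. j < m \<Longrightarrow> continuous_map T euclideanreal (\<lambda>x. g x j)"
    and u: "\<And>j. j < m \<Longrightarrow> continuous_map T euclideanreal (\<lambda>x. u x j)"
    and le: "\<And>t x. t \<in> {0..1} \<Longrightarrow> x \<in> topspace T \<Longrightarrow> L2_set (\<lambda>j. g x j + t * u x j) {..<m} \<le> 1"
  shows "continuous_map (prod_topology unit_interval T) (closed_disk m)
    (\<lambda>z j. if j < m then g (snd z) j + fst z * u (snd z) j else 0)"
proof (rule continuous_map_closed_disk)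
  fix j assume j: "j < m"
  have "continuous_map (prod_topology unit_interval T) euclideanreal (\<lambda>z. g (snd z) j + fst z * u (snd z) j)"
    by (intro continuous_map_add continuous_map_real_mult continuous_map_fst_interval
        continuous_map_snd_compose[OF g[OF j]] continuous_map_snd_compose[OF u[OF j]])
  then show "continuous_map (prod_topology unit_interval T) euclideanreal
    (\<lambda>z. if j < m then g (snd z) j + fst z * u (snd z) j else 0)" using j by simp
next
  fix z assume "z \<in> topspace (prod_topology unit_interval T)"
  then have "L2_set (\<lambda>j. g (snd z) j + fst z * u (snd z) j) {..<m} \<le> 1" by (intro le) auto
  moreover have "L2_set (\<lambda>j. g (snd z) j + fst z * u (snd z) j) {..<m} =
    L2_set (\<lambda>j. if j < m then g (snd z) j + fst z * u (snd z) j else 0) {..<m}"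
    by (rule L2_set_cong) auto
  ultimately show "(\<lambda>j. if j < m then g (snd z) j + fst z * u (snd z) j else 0) \<in> topspace (closed_disk m)"
    by (simp add: topspace_closed_disk)
qed

text \<open>Dilation by the factor \<open>1 + t / d\<close>, followed by radial truncation to the
  unit ball. At time 1 a point of norm at least \<open>d\<close> is dilated to norm at least
  \<open>d + 1\<close>, so it ends on the unit sphere.\<close>

definition radial_push :: "nat \<Rightarrow> real \<Rightarrow> real \<Rightarrow> (nat \<Rightarrow> real) \<Rightarrow> nat \<Rightarrow> real" where
  "radial_push m d t y = (\<lambda>j. (1 + t / d) / max 1 ((1 + t / d) * L2_set y {..<m}) * y j)"

lemma L2_set_radial_push:
  assumes "0 < d" "0 \<le> t"
  shows "L2_set (radial_push m d t y) {..<m} =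
    (1 + t / d) * L2_set y {..<m} / max 1 ((1 + t / d) * L2_set y {..<m})"
proof -
  have "0 \<le> t / d" using assms by simp
  then show ?thesis unfolding radial_push_def L2_set_scale by simp
qed

lemma radial_push_in_disk:
  assumes "0 < d" "0 \<le> t" "y \<in> topspace (closed_disk m)"
  shows "radial_push m d t y \<in> topspace (closed_disk m)"
proof -
  have "L2_set (radial_push m d t y) {..<m} \<le> 1"
    unfolding L2_set_radial_push[OF assms(1,2)] by (simp add: divide_le_eq)
  then show ?thesis using assms(3) by (simp add: topspace_closed_disk radial_push_def)
qed

lemma radial_push_boundary:
  assumes "0 < d" "0 \<le> t" "L2_set y {..<m} = 1"
  shows "radial_push m d t y = y"
proof -
  have "0 \<le> t / d" using assms by simp
  then show ?thesis using assms(3) by (simp add: radial_push_def max_def)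
qed

lemma radial_push_0: "L2_set y {..<m} \<le> 1 \<Longrightarrow> radial_push m d 0 y = y"
  by (simp add: radial_push_def max_def)

lemma radial_push_1:
  assumes "0 < d" "d \<le> L2_set y {..<m}"
  shows "L2_set (radial_push m d 1 y) {..<m} = 1"
proof -
  have "(1 + 1 / d) * L2_set y {..<m} \<ge> (1 + 1 / d) * d" using assms by (intro mult_left_mono) auto
  moreover have "(1 + 1 / d) * d = d + 1" using assms by (simp add: field_simps)
  ultimately have "1 < (1 + 1 / d) * L2_set y {..<m}" using assms by linarith
  moreover have "a / max 1 a = 1" if "1 < a" for a :: real using that by (simp add: max_def)
  ultimately show ?thesis unfolding L2_set_radial_push[OF assms(1) zero_le_one] by blast
qed

lemma continuous_map_radial_push:
  assumes d: "0 < d"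
  shows "continuous_map (prod_topology unit_interval (closed_disk m)) (closed_disk m)
    (\<lambda>(t, y). radial_push m d t y)"
proof (rule continuous_map_closed_disk)
  let ?P = "prod_topology unit_interval (closed_disk m)"
  fix j
  have y: "continuous_map ?P euclideanreal (\<lambda>z. snd z j)" for j
    by (rule continuous_map_snd_compose[OF continuous_map_coordinate_closed_disk])
  have r: "continuous_map ?P euclideanreal (\<lambda>z. L2_set (snd z) {..<m})"
    by (intro continuous_map_L2_set y)
  have s: "continuous_map ?P euclideanreal (\<lambda>z. 1 + fst z / d)"
    using d by (intro continuous_map_add continuous_map_real_divide continuous_map_fst_interval) auto
  have "continuous_map ?P euclideanreal
    (\<lambda>z. (1 + fst z / d) / max 1 ((1 + fst z / d) * L2_set (snd z) {..<m}) * snd z j)"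
    by (intro continuous_map_real_mult continuous_map_real_divide continuous_map_real_max s r y)
      (auto simp: max_def)
  then show "continuous_map ?P euclideanreal (\<lambda>z. (case z of (t, y) \<Rightarrow> radial_push m d t y) j)"
    by (simp add: radial_push_def case_prod_unfold)
next
  fix z assume "z \<in> topspace (prod_topology unit_interval (closed_disk m))"
  then show "(case z of (t, y) \<Rightarrow> radial_push m d t y) \<in> topspace (closed_disk m)"
    using radial_push_in_disk[OF d] by auto
qed

section \<open>Pushing spheres off high-dimensional cells\<close>

context CW_complex
begin

lemma boundary_subset_lower:
  assumes "closed_family J" "c \<in> J"
  shows "\<Phi> c ` disk_boundary (cdim c) \<subseteq> cells {j \<in> J. cdim j < cdim c}"
proof -
  have c: "c \<in> I" "ccell c \<subseteq> cells J" "J \<subseteq> I" using assms by (auto simp: closed_family_def)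
  obtain K where K: "K \<subseteq> I" "cells K \<subseteq> cells J"
    "\<And>j. j \<in> K \<Longrightarrow> j \<noteq> c \<Longrightarrow> cdim j < cdim c" "\<Phi> c ` disk_boundary (cdim c) \<subseteq> cells (K - {c})"
    using subcomplex_closure_finite[OF subcomplex_cells[OF assms(1)] c(1,2)] by metis
  have "K - {c} \<subseteq> {j \<in> J. cdim j < cdim c}"
  proof
    fix j assume j: "j \<in> K - {c}"
    obtain x where x: "x \<in> ocell j" using ocell_nonempty by auto
    then have "x \<in> cells J" using j K(2) by (auto simp: cells_def)
    then have "j \<in> J" using ocell_in_cells_iff[OF c(3), of j x] j K(1) x by auto
    then show "j \<in> {j \<in> J. cdim j < cdim c}" using j K(3) by auto
  qed
  then have "cells (K - {c}) \<subseteq> cells {j \<in> J. cdim j < cdim c}" unfolding cells_def by blast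
  then show ?thesis using K(4) by simp
qed

text \<open>The boundary of a cell lies in cells of strictly smaller dimension, so no other cell of
  the family uses a cell of top dimension.\<close>

lemma closed_family_remove_top:
  assumes "closed_family J" "\<And>j. j \<in> J \<Longrightarrow> cdim j \<le> cdim e"
  shows "closed_family (J - {e})"
  unfolding closed_family_def
proof (intro conjI ballI)
  show "J - {e} \<subseteq> I" using assms(1) by (auto simp: closed_family_def)
  fix c assume c: "c \<in> J - {e}"
  then have "{j \<in> J. cdim j < cdim c} \<subseteq> J - {e}" using assms(2)[of c] by auto
  then have "\<Phi> c ` disk_boundary (cdim c) \<subseteq> cells (J - {e})"
    using boundary_subset_lower[OF assms(1), of c] c unfolding cells_def by blast
  moreover have "ocell c \<subseteq> cells (J - {e})" using c by (auto simp: cells_def)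
  ultimately show "ccell c \<subseteq> cells (J - {e})" unfolding ccell_eq by blast
qed

lemma cell_inverse:
  assumes e: "e \<in> I"
  obtains \<psi> where "continuous_map (subtopology X (ocell e)) (open_disk (cdim e)) \<psi>"
    "\<And>y. y \<in> topspace (open_disk (cdim e)) \<Longrightarrow> \<psi> (\<Phi> e y) = y"
    "\<And>x. x \<in> ocell e \<Longrightarrow> \<psi> x \<in> topspace (open_disk (cdim e)) \<and> \<Phi> e (\<psi> x) = x"
proof -
  have "homeomorphic_map (open_disk (cdim e)) (subtopology X (ocell e)) (\<Phi> e)"
    using embedding_char[OF e] by (simp add: embedding_map_def ocell_def)
  then obtain \<psi> where \<psi>: "homeomorphic_maps (open_disk (cdim e)) (subtopology X (ocell e)) (\<Phi> e) \<psi>"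
    unfolding homeomorphic_map_maps by blast
  have top: "topspace (subtopology X (ocell e)) = ocell e"
    using ocell_subset_ccell ccell_subset_topspace[OF e] by fastforce
  have "continuous_map (subtopology X (ocell e)) (open_disk (cdim e)) \<psi>"
    "\<forall>y\<in>topspace (open_disk (cdim e)). \<psi> (\<Phi> e y) = y"
    "\<forall>x\<in>ocell e. \<Phi> e (\<psi> x) = x"
    using \<psi> top unfolding homeomorphic_maps_def by auto
  moreover have "\<forall>x\<in>ocell e. \<psi> x \<in> topspace (open_disk (cdim e))"
    using \<open>continuous_map (subtopology X (ocell e)) (open_disk (cdim e)) \<psi>\<close> top
    by (auto simp: continuous_map_def)
  ultimately show ?thesis using that by blast
qed

text \<open>Once the image avoids the ball of radius \<open>d\<close> in the top cell,
  \<open>radial_push\<close> carries it to the boundary of the cell. The push fixes that boundary,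
  so it extends by the identity to the rest of the complex.\<close>

lemma push_from_ring:
  assumes J: "finite J" "closed_family J" and e: "e \<in> J" "\<And>j. j \<in> J \<Longrightarrow> cdim j \<le> cdim e"
    and d: "0 < d" and f: "continuous_map Z (subtopology X (cells J)) f"
    and fim: "\<And>x. x \<in> topspace Z \<Longrightarrow> f x \<in> cells (J - {e}) \<or>
      (\<exists>y \<in> topspace (closed_disk (cdim e)). d \<le> L2_set y {..<cdim e} \<and> f x = \<Phi> e y)"
  obtains f' where "homotopic_with (\<lambda>_. True) Z (subtopology X (cells J)) f f'"
    "f' ` topspace Z \<subseteq> cells (J - {e})"
proof -
  let ?m = "cdim e" and ?D = "topspace (closed_disk (cdim e))" and ?B = "cells (J - {e})"
  have eI: "e \<in> I" and JI: "J \<subseteq> I" using J(2) e(1) by (auto simp: closed_family_def)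
  obtain \<psi> where \<psi>: "\<And>y. y \<in> topspace (open_disk ?m) \<Longrightarrow> \<psi> (\<Phi> e y) = y"
    using cell_inverse[OF eI] by metis
  have eB: "x \<notin> ?B" if "x \<in> ocell e" for x
    using ocell_in_cells_iff[of "J - {e}" e x] JI eI that by auto
  have bd: "\<Phi> e y \<in> ?B" if "y \<in> disk_boundary ?m" for y
  proof -
    have "{j \<in> J. cdim j < cdim e} \<subseteq> J - {e}" by auto
    then show ?thesis using boundary_subset_lower[OF J(2) e(1)] that unfolding cells_def by blast
  qed
  have D: "y \<in> topspace (open_disk ?m) \<or> y \<in> disk_boundary ?m" if "y \<in> ?D" for y
    using that by (auto simp: topspace_closed_disk topspace_open_disk disk_boundary_eq)
  define P where "P = (\<lambda>(t, x). if x \<in> ?B then x else \<Phi> e (radial_push ?m d t (\<psi> x)))"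
  \<comment> \<open>The two clauses of \<open>P\<close> agree on the boundary of the cell. A single
    formula on the closed disk is what \<open>continuous_map_cellwise\<close> asks for.\<close>
  have Pe: "P (t, \<Phi> e y) = \<Phi> e (radial_push ?m d t y)" if "t \<in> {0..1}" "y \<in> ?D" for t y
    using D[OF that(2)]
  proof
    assume y: "y \<in> topspace (open_disk ?m)"
    then have "\<Phi> e y \<in> ocell e" by (auto simp: ocell_def)
    then show ?thesis using eB \<psi>[OF y] by (simp add: P_def)
  next
    assume y: "y \<in> disk_boundary ?m"
    then show ?thesis using bd[OF y] radial_push_boundary[OF d, of t y ?m] that(1)
      by (simp add: P_def disk_boundary_eq)
  qed
  have cont: "continuous_map (prod_topology unit_interval (subtopology X (cells J))) X P"
  proof (rule continuous_map_cellwise[OF J(1) JI])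
    show "cells J \<subseteq> (\<Union>c\<in>J. ccell c)" using ocell_subset_ccell unfolding cells_def by blast
    fix c assume c: "c \<in> J"
    let ?P = "prod_topology unit_interval (closed_disk (cdim c))"
    show "continuous_map ?P X (\<lambda>(t, y). P (t, \<Phi> c y))"
    proof (cases "c = e")
      case True
      have "continuous_map ?P X (\<Phi> e \<circ> (\<lambda>(t, y). radial_push ?m d t y))"
        using continuous_map_compose[OF continuous_map_radial_push[OF d] continuous_char[OF eI]] True
        by simp
      then show ?thesis
        by (rule continuous_map_eq) (use Pe True in \<open>auto simp: o_def\<close>)
    next
      case False
      then have "ccell c \<subseteq> ?B"
        using closed_family_remove_top[OF J(2) e(2)] c by (auto simp: closed_family_def)
      then have *: "P (t, \<Phi> c y) = \<Phi> c y" if "y \<in> topspace (closed_disk (cdim c))" for t y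
        using that by (auto simp: P_def ccell_def)
      have "continuous_map ?P X (\<lambda>z. \<Phi> c (snd z))"
        using continuous_map_snd_compose continuous_char c JI by blast
      then show ?thesis
        by (rule continuous_map_eq) (use * in auto)
    qed
  qed
  have ce: "ccell e \<subseteq> cells J" using J(2) e(1) by (simp add: closed_family_def)
  have cellsJ: "x \<in> ?B \<or> (\<exists>y\<in>?D. x = \<Phi> e y)" if "x \<in> cells J" for x
  proof -
    from that obtain c where c: "c \<in> J" "x \<in> ocell c" by (rule in_cellsE)
    show ?thesis
    proof (cases "c = e")
      case True
      then have "x \<in> ccell e" using c(2) ocell_subset_ccell[of e] by blast
      then show ?thesis by (elim in_ccellE) blast
    next
      case False
      then have "x \<in> ?B" using c by (intro in_cellsI[of c]) auto
      then show ?thesis by blast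
    qed
  qed
  have Pin: "P (t, x) \<in> cells J" if "t \<in> {0..1}" "x \<in> cells J" for t x
    using cellsJ[OF that(2)]
  proof
    assume "x \<in> ?B" then show ?thesis using that(2) by (simp add: P_def)
  next
    assume "\<exists>y\<in>?D. x = \<Phi> e y"
    then obtain y where y: "y \<in> ?D" "x = \<Phi> e y" by blast
    have "radial_push ?m d t y \<in> ?D" using radial_push_in_disk[OF d] that(1) y(1) by auto
    then have "\<Phi> e (radial_push ?m d t y) \<in> ccell e" by (auto simp: ccell_def)
    then show ?thesis using Pe[OF that(1) y(1)] y(2) ce by auto
  qed
  have P0: "P (0, x) = x" if "x \<in> cells J" for x
    using cellsJ[OF that]
  proof
    assume "x \<in> ?B" then show ?thesis by (simp add: P_def)
  next
    assume "\<exists>y\<in>?D. x = \<Phi> e y"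
    then obtain y where y: "y \<in> ?D" "x = \<Phi> e y" by blast
    then show ?thesis using Pe[of 0 y] radial_push_0[of y ?m d] by (simp add: topspace_closed_disk)
  qed
  have fJ: "f x \<in> cells J" if "x \<in> topspace Z" for x
    using f that by (auto simp: continuous_map_def)
  have P: "continuous_map (prod_topology unit_interval (subtopology X (cells J))) (subtopology X (cells J)) P"
    using cont Pin by (intro continuous_map_into_subtopology) auto
  show ?thesis
  proof (rule that[of "\<lambda>x. P (1, f x)"])
    have "homotopic_with (\<lambda>_. True) (subtopology X (cells J)) (subtopology X (cells J)) (\<lambda>x. P (0, x)) (\<lambda>x. P (1, x))"
      unfolding homotopic_with_def using P by (intro exI[of _ P]) auto
    then have "homotopic_with (\<lambda>_. True) Z (subtopology X (cells J)) ((\<lambda>x. P (0, x)) \<circ> f) ((\<lambda>x. P (1, x)) \<circ> f)"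
      by (rule homotopic_with_compose_continuous_map_right[OF _ f]) simp
    then show "homotopic_with (\<lambda>_. True) Z (subtopology X (cells J)) f (\<lambda>x. P (1, f x))"
      by (rule homotopic_with_eq) (use P0 fJ in auto)
    show "(\<lambda>x. P (1, f x)) ` topspace Z \<subseteq> ?B"
    proof clarify
      fix x assume x: "x \<in> topspace Z"
      show "P (1, f x) \<in> ?B"
        using fim[OF x]
      proof
        assume "f x \<in> ?B" then show ?thesis by (simp add: P_def)
      next
        assume "\<exists>y \<in> ?D. d \<le> L2_set y {..<?m} \<and> f x = \<Phi> e y"
        then obtain y where y: "y \<in> ?D" "d \<le> L2_set y {..<?m}" "f x = \<Phi> e y" by blast
        have "radial_push ?m d 1 y \<in> disk_boundary ?m"
          using radial_push_1[OF d y(2)] radial_push_in_disk[OF d, of 1 y] y(1)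
          by (auto simp: disk_boundary_eq topspace_closed_disk)
        then show ?thesis using bd Pe[of 1 y] y by auto
      qed
    qed
  qed
qed

lemma closedin_char_image:
  assumes "e \<in> I" "closedin (closed_disk (cdim e)) K" shows "closedin X (\<Phi> e ` K)"
  using closedin_compact_space[OF compact_space_closed_disk assms(2)] continuous_char[OF assms(1)]
    image_compactin compactin_imp_closedin[OF Hausdorff] by metis

text \<open>A continuous image of a sphere may fill the cell, so \<open>f\<close> is first perturbed
  until it misses a ball around the centre. The sphere lies in the first \<open>Suc i\<close>
  coordinates, and approximation by maps avoiding the origin therefore works in dimensions above
  \<open>2 ^ Suc i\<close>. The perturbation is damped so that it can be glued to the unchanged
  \<open>f\<close> outside an inner ball.\<close>

lemma push_off_cell:
  assumes J: "finite J" "closed_family J" and e: "e \<in> J" "\<And>j. j \<in> J \<Longrightarrow> cdim j \<le> cdim e"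
    and m: "2 ^ Suc i < cdim e" and f: "continuous_map (nsphere i) (subtopology X (cells J)) f"
  obtains f' where "homotopic_with (\<lambda>_. True) (nsphere i) (subtopology X (cells J)) f f'"
    "f' ` topspace (nsphere i) \<subseteq> cells (J - {e})"
proof -
  let ?m = "cdim e" and ?D = "topspace (closed_disk (cdim e))" and ?B = "cells (J - {e})"
  let ?S = "topspace (nsphere i)" and ?r = "\<lambda>y. L2_set y {..<cdim e}"
  have eI: "e \<in> I" and JI: "J \<subseteq> I" using J(2) e(1) by (auto simp: closed_family_def)
  obtain \<psi> where \<psi>: "continuous_map (subtopology X (ocell e)) (open_disk ?m) \<psi>"
    "\<And>y. y \<in> topspace (open_disk ?m) \<Longrightarrow> \<psi> (\<Phi> e y) = y"
    "\<And>x. x \<in> ocell e \<Longrightarrow> \<psi> x \<in> topspace (open_disk ?m) \<and> \<Phi> e (\<psi> x) = x"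
    using cell_inverse[OF eI] by metis
  have eB: "x \<notin> ?B" if "x \<in> ocell e" for x
    using ocell_in_cells_iff[of "J - {e}" e x] JI eI that by auto
  have bd: "\<Phi> e y \<in> ?B" if "y \<in> disk_boundary ?m" for y
  proof -
    have "{j \<in> J. cdim j < cdim e} \<subseteq> J - {e}" by auto
    then show ?thesis using boundary_subset_lower[OF J(2) e(1)] that unfolding cells_def by blast
  qed
  have D: "y \<in> topspace (open_disk ?m) \<or> y \<in> disk_boundary ?m" if "y \<in> ?D" for y
    using that by (auto simp: topspace_closed_disk topspace_open_disk disk_boundary_eq)
  \<comment> \<open>A closed inner ball of the cell and everything outside of it. The two closed
    sets meet only at radius \<open>3/4\<close>, where the perturbation has to vanish.\<close>
  define A where "A = \<Phi> e ` {y \<in> ?D. ?r y \<le> 3/4}"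
  define A' where "A' = ?B \<union> \<Phi> e ` {y \<in> ?D. 3/4 \<le> ?r y}"
  have A: "closedin X A" "closedin X A'"
    unfolding A_def A'_def
    by (intro closedin_Un closedin_char_image[OF eI] closedin_closed_disk_level closedin_cells
        closed_family_remove_top[OF J(2) e(2)])+
  have A_ocell: "A \<subseteq> ocell e"
    by (auto simp: A_def ocell_def topspace_open_disk topspace_closed_disk)
  have \<psi>A: "?r (\<psi> x) \<le> 3/4" if "x \<in> A" for x
  proof -
    from that[unfolded A_def] obtain y where y: "y \<in> ?D" "?r y \<le> 3/4" "x = \<Phi> e y"
      by (rule imageE) blast
    then have "y \<in> topspace (open_disk ?m)" by (auto simp: topspace_open_disk topspace_closed_disk)
    then show ?thesis using \<psi>(2) y by simp
  qed
  have \<psi>A': "3/4 \<le> ?r (\<psi> x)" if "x \<in> A'" "x \<in> ocell e" for x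
  proof -
    have "x \<in> \<Phi> e ` {y \<in> ?D. 3/4 \<le> ?r y}" using that eB[of x] by (simp add: A'_def)
    then obtain y where y: "y \<in> ?D" "3/4 \<le> ?r y" "x = \<Phi> e y"
      by (rule imageE) blast
    then have "y \<in> topspace (open_disk ?m)" using D[OF y(1)] bd[of y] eB[of x] that by auto
    then show ?thesis using \<psi>(2) y by simp
  qed
  have cover: "x \<in> A \<or> x \<in> A'" if "x \<in> cells J" for x
  proof -
    from that obtain c where c: "c \<in> J" "x \<in> ocell c" by (rule in_cellsE)
    show ?thesis
    proof (cases "c = e")
      case True
      then have "x \<in> ccell e" using c(2) ocell_subset_ccell[of e] by blast
      then obtain y where "y \<in> ?D" "x = \<Phi> e y" by (rule in_ccellE)
      then show ?thesis unfolding A_def A'_def by (cases "?r y \<le> 3/4") auto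
    next
      case False
      then have "x \<in> ?B" using c by (intro in_cellsI[of c]) auto
      then show ?thesis unfolding A'_def by blast
    qed
  qed
  have fX: "continuous_map (nsphere i) X f" using f by (simp add: continuous_map_in_subtopology)
  have fJ: "f x \<in> cells J" if "x \<in> ?S" for x
    using f that by (auto simp: continuous_map_def)
  define C where "C = {x \<in> ?S. f x \<in> A}"
  define C' where "C' = {x \<in> ?S. f x \<in> A'}"
  have C: "closedin (nsphere i) C" "closedin (nsphere i) C'"
    unfolding C_def C'_def using closedin_continuous_map_preimage[OF fX] A by blast+
  have subC: "subtopology (nsphere i) C = top_of_set C"
    using C_def by (subst top_of_set_nsphere) (auto simp: subtopology_subtopology Int_absorb1)
  have compC: "compact C"
  proof -
    have "compactin (nsphere i) C" using C(1) compact_space_nsphere closedin_compact_space by blast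
    then have "compact_space (subtopology (nsphere i) C)" by (rule compactin_subspace[THEN iffD1, THEN conjunct2])
    then show ?thesis unfolding subC by (simp add: compactin_subspace flip: compactin_euclidean_iff)
  qed
  define g where "g x = \<psi> (f x)" for x
  have gA: "?r (g x) \<le> 3/4" if "x \<in> C" for x using that \<psi>A by (simp add: C_def g_def)
  have \<Phi>g: "\<Phi> e (g x) = f x" "g x \<in> topspace (open_disk ?m)" if "x \<in> C" for x
    using that \<psi>(3) A_ocell by (auto simp: C_def g_def)
  have "continuous_map (top_of_set C) (subtopology X (ocell e)) f"
    unfolding subC[symmetric]
    using fX A_ocell by (intro continuous_map_into_subtopology continuous_map_from_subtopology) (auto simp: C_def)
  then have "continuous_map (top_of_set C) (open_disk ?m) g"
    using continuous_map_compose[OF _ \<psi>(1), of "top_of_set C" f] by (simp add: g_def[abs_def] o_def)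
  then have cg: "continuous_map (top_of_set C) euclideanreal (\<lambda>x. g x j)" for j
    by (rule continuous_map_compose[OF _ continuous_map_coordinate_open_disk, unfolded o_def])
  \<comment> \<open>An error of at most \<open>\<epsilon>\<close> in each of the \<open>?m\<close>
    coordinates gives an error of norm at most \<open>1/8\<close>.\<close>
  define \<epsilon> where "\<epsilon> = 1 / (8 * real ?m)"
  have m0: "0 < ?m" using m by simp
  obtain g' where g': "\<And>j. j < ?m \<Longrightarrow> continuous_on C (\<lambda>x. g' x j)"
    "\<And>x j. x \<in> C \<Longrightarrow> j < ?m \<Longrightarrow> \<bar>g' x j - g x j\<bar> \<le> \<epsilon>"
    "\<And>x. x \<in> C \<Longrightarrow> \<exists>j<?m. g' x j \<noteq> 0"
  proof (rule avoid_zero_approximation[OF compC _ _ _ m, of g \<epsilon>])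
    have xC: "x \<in> disk_boundary (Suc i)" if "x \<in> C" for x using that by (simp add: C_def topspace_nsphere)
    show "x j = 0" if "x \<in> C" "Suc i \<le> j" for x j
      using xC[OF that(1)] that(2) by (simp add: disk_boundary_eq)
    show "\<bar>x j\<bar> \<le> 1" if "x \<in> C" for x j
    proof (cases "j < Suc i")
      case True
      then have "\<bar>x j\<bar> \<le> L2_set (\<lambda>j. \<bar>x j\<bar>) {..<Suc i}" by (intro member_le_L2_set) auto
      also have "\<dots> = 1" using xC[OF that] by (simp add: disk_boundary_eq L2_set_def)
      finally show ?thesis .
    qed (use xC[OF that] in \<open>simp add: disk_boundary_eq\<close>)
    show "continuous_on C (\<lambda>x. g x j)" for j using cg[of j] by simp
    show "0 < \<epsilon>" using m0 by (simp add: \<epsilon>_def)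
  qed blast
  \<comment> \<open>Damping factor: 1 up to radius \<open>1/2\<close>, 0 from radius
    \<open>3/4\<close> on, linear in between.\<close>
  define \<mu> where "\<mu> x = max 0 (min 1 (3 - 4 * ?r (g x)))" for x
  define u where "u x j = \<mu> x * (g' x j - g x j)" for x j
  have cu: "continuous_map (top_of_set C) euclideanreal (\<lambda>x. u x j)" if "j < ?m" for j
  proof -
    have "continuous_map (top_of_set C) euclideanreal \<mu>"
      unfolding \<mu>_def[abs_def]
      by (intro continuous_map_real_max continuous_map_real_min continuous_map_diff
          continuous_map_real_mult continuous_map_L2_set cg) simp_all
    then show ?thesis
      unfolding u_def using g'(1)[OF that] cg
      by (intro continuous_map_real_mult continuous_map_diff) auto
  qed
  have \<mu>: "0 \<le> \<mu> x" "\<mu> x \<le> 1" for x by (auto simp: \<mu>_def)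
  have ru: "?r (u x) \<le> 1/8" if "x \<in> C" for x
  proof -
    have "?r (\<lambda>j. g' x j - g x j) \<le> real ?m * \<epsilon>"
      using g'(2)[OF that] by (intro L2_set_le_abs_sum_bound)
    also have "\<dots> = 1/8" using m0 by (simp add: \<epsilon>_def)
    finally have "?r (\<lambda>j. g' x j - g x j) \<le> 1/8" .
    moreover have "?r (u x) = \<mu> x * ?r (\<lambda>j. g' x j - g x j)"
      unfolding u_def L2_set_scale using \<mu>[of x] by simp
    moreover have "\<mu> x * ?r (\<lambda>j. g' x j - g x j) \<le> 1 * ?r (\<lambda>j. g' x j - g x j)"
      using \<mu>[of x] by (intro mult_right_mono) auto
    ultimately show ?thesis by simp
  qed
  define q where "q = (\<lambda>z j. if j < ?m then g (snd z) j + fst z * u (snd z) j else 0)"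
  have cq: "continuous_map (prod_topology unit_interval (top_of_set C)) (closed_disk ?m) q"
    unfolding q_def
  proof (rule blend_continuous_map[OF cg cu])
    fix t :: real and x assume tx: "t \<in> {0..1}" "x \<in> topspace (top_of_set C)"
    have "?r (\<lambda>j. g x j + t * u x j) \<le> ?r (g x) + ?r (\<lambda>j. t * u x j)" by (rule L2_set_triangle_ineq)
    also have "?r (\<lambda>j. t * u x j) \<le> 1 * (1/8)"
      unfolding L2_set_scale using tx ru by (intro mult_mono) auto
    finally show "?r (\<lambda>j. g x j + t * u x j) \<le> 1" using gA[of x] tx by simp
  qed
  have q0: "q (0, x) = g x" if "x \<in> C" for x
    using \<Phi>g(2)[OF that] by (auto simp: q_def topspace_open_disk fun_eq_iff)
  have qD: "q (t, x) \<in> ?D" if "t \<in> {0..1}" "x \<in> C" for t x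
    using cq that by (auto simp: continuous_map_def)
  have overlap: "q (t, x) = g x" if "x \<in> C" "x \<in> C'" for t x
  proof -
    have "?r (g x) = 3/4"
      using that \<psi>A[of "f x"] \<psi>A'[of "f x"] A_ocell by (force simp: C_def C'_def g_def)
    then have "u x j = 0" for j by (simp add: u_def \<mu>_def)
    then have "q (t, x) j = g x j" for j
      using fun_cong[OF q0[OF that(1)], of j] by (cases "j < ?m") (simp_all add: q_def)
    then show ?thesis by blast
  qed
  \<comment> \<open>Up to radius \<open>1/2\<close> the perturbed map is the full approximation
    \<open>g'\<close>, which avoids the origin; beyond that radius a perturbation of norm at most
    \<open>1/8\<close> cannot reach the origin.\<close>
  have q1: "0 < ?r (q (1, x))" if x: "x \<in> C" for x
  proof -
    have eq: "?r (q (1, x)) = ?r (\<lambda>j. g x j + 1 * u x j)"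
      unfolding q_def by (rule L2_set_cong) auto
    show ?thesis
    proof (cases "?r (g x) \<le> 1/2")
      case True
      then have "\<mu> x = 1" by (simp add: \<mu>_def)
      then have "?r (q (1, x)) = ?r (g' x)" unfolding eq by (simp add: u_def)
      moreover have "?r (g' x) \<noteq> 0" using g'(3)[OF x] by (auto simp: L2_set_eq_0_iff)
      moreover have "0 \<le> ?r (g' x)" by (rule L2_set_nonneg)
      ultimately show ?thesis by linarith
    next
      case False
      have "?r (g x) - ?r (\<lambda>j. 1 * u x j) \<le> ?r (q (1, x))"
        unfolding eq by (rule L2_set_diff_ge)
      then show ?thesis using False ru[OF x] by simp
    qed
  qed
  \<comment> \<open>A positive minimum by compactness, cut down to \<open>3/4\<close> so that the
    unperturbed part of the image in the cell also stays outside the ball of radius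
    \<open>d\<close>.\<close>
  obtain d where d: "0 < d" "d \<le> 3/4" "\<And>x. x \<in> C \<Longrightarrow> d \<le> ?r (q (1, x))"
  proof (cases "C = {}")
    case True then show ?thesis using that[of "3/4"] by simp
  next
    case False
    have "continuous_on C (\<lambda>x. ?r (q (1, x)))"
    proof -
      have "continuous_map (top_of_set C) (prod_topology unit_interval (top_of_set C)) (\<lambda>x. (1, x))"
        by (intro continuous_map_pairedI) auto
      then have "continuous_map (top_of_set C) (closed_disk ?m) (\<lambda>x. q (1, x))"
        by (rule continuous_map_compose[OF _ cq, unfolded o_def])
      then have "continuous_map (top_of_set C) euclideanreal (\<lambda>x. q (1, x) j)" for j
        by (rule continuous_map_compose[OF _ continuous_map_coordinate_closed_disk, unfolded o_def])
      then have "continuous_map (top_of_set C) euclideanreal (\<lambda>x. ?r (q (1, x)))"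
        by (intro continuous_map_L2_set)
      then show ?thesis by simp
    qed
    then obtain x0 where x0: "x0 \<in> C" "\<And>x. x \<in> C \<Longrightarrow> ?r (q (1, x0)) \<le> ?r (q (1, x))"
      using continuous_attains_inf[OF compC False] by blast
    show ?thesis
      by (rule that[of "min (3/4) (?r (q (1, x0)))"]) (use x0 q1 in \<open>auto simp: min_le_iff_disj\<close>)
  qed
  define k where "k = (\<lambda>(t::real, x). if x \<in> C then \<Phi> e (q (t, x)) else f x)"
  have kC': "k (t, x) = f x" if "x \<in> C'" for t x
    using overlap[of x t] \<Phi>g(1)[of x] that by (simp add: k_def)
  have SC: "x \<in> C \<or> x \<in> C'" if "x \<in> ?S" for x
    using cover[OF fJ[OF that]] that by (auto simp: C_def C'_def)
  have kX: "continuous_map (prod_topology unit_interval (nsphere i)) X k"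
  proof (rule continuous_map_finite_closed_cover[of "{C, C'}" _ "\<lambda>A. {0..1} \<times> A"])
    let ?P = "prod_topology unit_interval (nsphere i)"
    show "finite {C, C'}" by simp
    show "closedin ?P ({0..1} \<times> j)" if "j \<in> {C, C'}" for j
      using that C by (auto simp: closedin_prod_Times_iff)
    show "topspace ?P \<subseteq> (\<Union>j\<in>{C, C'}. {0..1} \<times> j)"
      using SC by auto
    fix j assume j: "j \<in> {C, C'}"
    have sub: "subtopology ?P ({0..1} \<times> j) = prod_topology unit_interval (subtopology (nsphere i) j)"
      by (simp add: subtopology_Times subtopology_subtopology)
    consider "j = C" | "j = C'" using j by blast
    then show "continuous_map (subtopology ?P ({0..1} \<times> j)) X k"
    proof cases
      case 1
      have "continuous_map (prod_topology unit_interval (top_of_set C)) X (\<Phi> e \<circ> q)"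
        using continuous_map_compose[OF cq continuous_char[OF eI]] .
      then show ?thesis
        unfolding sub unfolding 1 subC by (rule continuous_map_eq) (auto simp: k_def)
    next
      case 2
      have "continuous_map (prod_topology unit_interval (subtopology (nsphere i) C')) X (\<lambda>z. f (snd z))"
        by (intro continuous_map_snd_compose continuous_map_from_subtopology fX)
      then show ?thesis
        unfolding sub unfolding 2 by (rule continuous_map_eq) (use kC' in auto)
    qed
  qed
  have ce: "ccell e \<subseteq> cells J" using J(2) e(1) by (simp add: closed_family_def)
  have kJ: "k (t, x) \<in> cells J" if "t \<in> {0..1}" "x \<in> ?S" for t x
    using qD[OF that(1), of x] ce fJ[OF that(2)] by (auto simp: k_def ccell_def)
  have k: "continuous_map (prod_topology unit_interval (nsphere i)) (subtopology X (cells J)) k"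
    using kX kJ by (intro continuous_map_into_subtopology) auto
  have hom1: "homotopic_with (\<lambda>_. True) (nsphere i) (subtopology X (cells J)) (\<lambda>x. k (0, x)) (\<lambda>x. k (1, x))"
    unfolding homotopic_with_def using k by (intro exI[of _ k]) auto
  have "homotopic_with (\<lambda>_. True) (nsphere i) (subtopology X (cells J)) f (\<lambda>x. k (1, x))"
    by (rule homotopic_with_eq[OF hom1]) (use q0 \<Phi>g(1) in \<open>auto simp: k_def\<close>)
  moreover obtain f' where "homotopic_with (\<lambda>_. True) (nsphere i) (subtopology X (cells J)) (\<lambda>x. k (1, x)) f'"
    "f' ` ?S \<subseteq> ?B"
  proof (rule push_from_ring[OF J e d(1)])
    show "continuous_map (nsphere i) (subtopology X (cells J)) (\<lambda>x. k (1, x))"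
      using hom1 homotopic_with_imp_continuous_maps by blast
    fix x assume x: "x \<in> ?S"
    show "k (1, x) \<in> ?B \<or> (\<exists>y\<in>?D. d \<le> ?r y \<and> k (1, x) = \<Phi> e y)"
    proof (cases "x \<in> C")
      case True
      then show ?thesis using qD[of 1 x] d(3)[OF True] by (auto simp: k_def)
    next
      case False
      then have "f x \<in> A'" using SC[OF x] by (simp add: C'_def)
      then show ?thesis using False d(2) by (force simp: k_def A'_def)
    qed
  qed blast
  ultimately show ?thesis using that homotopic_with_trans by blast
qed

text \<open>Top-dimensional cells are removed one at a time as long as their dimension exceeds
  \<open>2 ^ Suc i\<close>. This is weaker than the cellular approximation theorem, whose bound is
  \<open>i\<close>. The homotopy stays in \<open>cells J\<close>, so it respects any superlevel set
  that contains this finite subcomplex.\<close>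

lemma cellular_approximation:
  assumes "finite J" "closed_family J" "continuous_map (nsphere i) (subtopology X (cells J)) f"
  shows "\<exists>f'. homotopic_with (\<lambda>_. True) (nsphere i) (subtopology X (cells J)) f f' \<and>
    f' ` topspace (nsphere i) \<subseteq> cells {c \<in> J. cdim c \<le> 2 ^ Suc i}"
  using assms
proof (induction "card J" arbitrary: J f rule: less_induct)
  case less
  show ?case
  proof (cases "\<forall>c\<in>J. cdim c \<le> 2 ^ Suc i")
    case True
    then have "{c \<in> J. cdim c \<le> 2 ^ Suc i} = J" by auto
    moreover have "f ` topspace (nsphere i) \<subseteq> cells J"
      using less.prems(3) by (auto simp: continuous_map_def)
    ultimately show ?thesis using less.prems(3) by (intro exI[of _ f]) simp
  next
    case False
    have "J \<noteq> {}" using False by auto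
    then have "Max (cdim ` J) \<in> cdim ` J" using less.prems(1) by (intro Max_in) auto
    then obtain e where e: "e \<in> J" "cdim e = Max (cdim ` J)" by auto
    have emax: "cdim j \<le> cdim e" if "j \<in> J" for j using e(2) less.prems(1) that by simp
    have em: "2 ^ Suc i < cdim e" using False emax by (meson less_le_trans not_le)
    obtain f1 where f1: "homotopic_with (\<lambda>_. True) (nsphere i) (subtopology X (cells J)) f f1"
      "f1 ` topspace (nsphere i) \<subseteq> cells (J - {e})"
      using push_off_cell[OF less.prems(1,2) e(1) emax em less.prems(3)] by blast
    have "continuous_map (nsphere i) X f1"
      using homotopic_with_imp_continuous_maps[OF f1(1)] by (simp add: continuous_map_in_subtopology)
    then have "continuous_map (nsphere i) (subtopology X (cells (J - {e}))) f1"
      using f1(2) by (intro continuous_map_into_subtopology) auto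
    moreover have "card (J - {e}) < card J" using e(1) less.prems(1) by (intro card_Diff1_less)
    ultimately obtain f2 where f2: "homotopic_with (\<lambda>_. True) (nsphere i) (subtopology X (cells (J - {e}))) f1 f2"
      "f2 ` topspace (nsphere i) \<subseteq> cells {c \<in> J - {e}. cdim c \<le> 2 ^ Suc i}"
      using less.hyps[of "J - {e}" f1] closed_family_remove_top[OF less.prems(2) emax] less.prems(1) by auto
    have sub: "cells (J - {e}) \<subseteq> cells J" unfolding cells_def by blast
    have idc: "continuous_map (subtopology X (cells (J - {e}))) (subtopology X (cells J)) id"
      using sub by (intro continuous_map_into_subtopology continuous_map_from_subtopology) auto
    have "homotopic_with (\<lambda>_. True) (nsphere i) (subtopology X (cells J)) (id \<circ> f1) (id \<circ> f2)"
      by (rule homotopic_with_compose_continuous_map_left[OF f2(1) idc]) simp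
    then have "homotopic_with (\<lambda>_. True) (nsphere i) (subtopology X (cells J)) f f2"
      using homotopic_with_trans[OF f1(1)] by simp
    moreover have "cells {c \<in> J - {e}. cdim c \<le> 2 ^ Suc i} \<subseteq> cells {c \<in> J. cdim c \<le> 2 ^ Suc i}"
      unfolding cells_def by blast
    ultimately show ?thesis using f2(2) by blast
  qed
qed

end

section \<open>Extension over cylinders\<close>

text \<open>The cylinder is the cone over its boundary, from which the contraction of \<open>X\<close> extends any map.\<close>

lemma cylinder_extension:
  assumes X: "contractible_space X"
    and b0: "continuous_map (closed_disk m) X b0" and b1: "continuous_map (closed_disk m) X b1"
    and \<beta>: "continuous_map (prod_topology unit_interval (subtopology (closed_disk m) (disk_boundary m))) X \<beta>"
    and \<beta>0: "\<And>y. y \<in> disk_boundary m \<Longrightarrow> \<beta> (0, y) = b0 y"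
    and \<beta>1: "\<And>y. y \<in> disk_boundary m \<Longrightarrow> \<beta> (1, y) = b1 y"
  obtains E where "continuous_map (prod_topology unit_interval (closed_disk m)) X E"
    "\<And>y. y \<in> topspace (closed_disk m) \<Longrightarrow> E (0, y) = b0 y"
    "\<And>y. y \<in> topspace (closed_disk m) \<Longrightarrow> E (1, y) = b1 y"
    "\<And>t y. t \<in> {0..1} \<Longrightarrow> y \<in> disk_boundary m \<Longrightarrow> E (t, y) = \<beta> (t, y)"
proof -
  let ?D = "topspace (closed_disk m)" and ?r = "\<lambda>y. L2_set y {..<m}"
  let ?Q = "prod_topology unit_interval (closed_disk m)"
  \<comment> \<open>A gauge of the cylinder about its centre \<open>(1/2, 0)\<close>: it grows
    linearly along rays from the centre and equals 1 exactly on the boundary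
    \<open>B\<close>.\<close>
  define \<rho> where "\<rho> = (\<lambda>(t::real, y). max \<bar>2 * t - 1\<bar> (?r y))"
  define B where "B = {p \<in> {0..1} \<times> ?D. \<rho> p = 1}"
  define C0 where "C0 = {0::real} \<times> ?D"
  define C1 where "C1 = {1::real} \<times> ?D"
  define C2 where "C2 = {0..1::real} \<times> disk_boundary m"
  have bdD: "disk_boundary m \<subseteq> ?D" by (auto simp: disk_boundary_eq topspace_closed_disk)
  have B: "B = C0 \<union> C1 \<union> C2"
    by (auto simp: B_def C0_def C1_def C2_def \<rho>_def disk_boundary_eq topspace_closed_disk max_def abs_if
        split: if_splits)
  define b where "b = (\<lambda>(t::real, y). if t = 0 then b0 y else if t = 1 then b1 y else \<beta> (t, y))"
  have closed_bd: "closedin (closed_disk m) (disk_boundary m)"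
  proof -
    have "disk_boundary m = {x \<in> ?D. 1 \<le> ?r x}" by (auto simp: disk_boundary_eq topspace_closed_disk)
    then show ?thesis using closedin_closed_disk_level(2)[of m 1] by simp
  qed
  have closed: "closedin ?Q C0" "closedin ?Q C1" "closedin ?Q C2"
    unfolding C0_def C1_def C2_def using closed_bd
    by (auto simp: closedin_prod_Times_iff intro: closedin_closed_subtopology[THEN iffD2])
  have closedB: "closedin ?Q B" unfolding B using closed by (intro closedin_Un)
  have compQ: "compact_space ?Q"
    by (simp add: compact_space_prod_topology compact_space_closed_disk compact_space_subtopology)
  have subQ: "subtopology ?Q (A \<times> A') = prod_topology (subtopology unit_interval A) (subtopology (closed_disk m) A')" for A A'
    by (rule subtopology_Times)
  have cb: "continuous_map (subtopology ?Q B) X b"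
  proof (rule continuous_map_finite_closed_cover[of "{C0, C1, C2}" _ "\<lambda>A. A"])
    show "topspace (subtopology ?Q B) \<subseteq> (\<Union>j\<in>{C0, C1, C2}. j)" using B by auto
    fix j assume j: "j \<in> {C0, C1, C2}"
    then have jB: "j \<subseteq> B" using B by auto
    show "closedin (subtopology ?Q B) j"
      using closed j jB by (intro closedin_subset_topspace) auto
    have sub: "subtopology (subtopology ?Q B) j = subtopology ?Q j"
      using jB by (simp add: subtopology_subtopology Int_absorb1)
    consider "j = C0" | "j = C1" | "j = C2" using j by blast
    then show "continuous_map (subtopology (subtopology ?Q B) j) X b"
    proof cases
      case 1
      have "continuous_map (subtopology ?Q C0) X (\<lambda>z. b0 (snd z))"
        by (intro continuous_map_from_subtopology continuous_map_snd_compose b0)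
      then show ?thesis unfolding sub unfolding 1
        by (rule continuous_map_eq) (auto simp: b_def C0_def)
    next
      case 2
      have "continuous_map (subtopology ?Q C1) X (\<lambda>z. b1 (snd z))"
        by (intro continuous_map_from_subtopology continuous_map_snd_compose b1)
      then show ?thesis unfolding sub unfolding 2
        by (rule continuous_map_eq) (auto simp: b_def C1_def)
    next
      case 3
      have "subtopology ?Q C2 = prod_topology unit_interval (subtopology (closed_disk m) (disk_boundary m))"
        unfolding C2_def subQ by (simp add: subtopology_subtopology)
      then have "continuous_map (subtopology ?Q C2) X \<beta>" using \<beta> by simp
      then show ?thesis unfolding sub unfolding 3
        by (rule continuous_map_eq) (auto simp: b_def C2_def \<beta>0 \<beta>1)
    qed
  qed simp
  obtain a \<kappa> where \<kappa>: "continuous_map (prod_topology unit_interval X) X \<kappa>"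
    "\<And>x. \<kappa> (0, x) = x" "\<And>x. \<kappa> (1, x) = a"
    using X unfolding contractible_space_def homotopic_with_def by auto
  let ?Z = "prod_topology unit_interval (subtopology ?Q B)"
  \<comment> \<open>Cone coordinates: \<open>q (s, z)\<close> moves straight from the boundary point
    \<open>z\<close> at \<open>s = 0\<close> to the centre at \<open>s = 1\<close>. The map
    \<open>E\<close> below sends \<open>q (s, z)\<close> to \<open>\<kappa> (s, b z)\<close>; at the
    centre all rays agree because the contraction ends in the single point \<open>a\<close>.\<close>
  define q where "q = (\<lambda>(s::real, (t::real, y :: nat \<Rightarrow> real)). (1/2 + (1 - s) * (t - 1/2), \<lambda>j. (1 - s) * y j))"
  define E where "E = (\<lambda>(t::real, y). if \<rho> (t, y) = 0 then a else
    \<kappa> (1 - \<rho> (t, y), b (1/2 + (t - 1/2) / \<rho> (t, y), \<lambda>j. y j / \<rho> (t, y))))"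
  have half: "(1 + a) / 2 \<in> {0..1}" if "\<bar>a\<bar> \<le> 1" for a :: real
    using that by auto
  have \<rho>q': "\<rho> (q (s, (t, y))) = max \<bar>(1 - s) * (2 * t - 1)\<bar> (?r (\<lambda>j. (1 - s) * y j))" for s t y
  proof -
    have "2 * (1/2 + (1 - s) * (t - 1/2)) - 1 = (1 - s) * (2 * t - 1)"
      by (simp add: field_simps)
    then show ?thesis by (simp only: \<rho>_def q_def prod.case)
  qed
  have \<rho>q: "\<rho> (q (s, z)) = 1 - s" if "s \<in> {0..1}" "z \<in> B" for s z
  proof -
    obtain t y where z: "z = (t, y)" by (cases z)
    have "\<rho> (q (s, z)) = max \<bar>(1 - s) * (2 * t - 1)\<bar> (?r (\<lambda>j. (1 - s) * y j))"
      unfolding z by (rule \<rho>q')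
    also have "\<dots> = max \<bar>(1 - s) * (2 * t - 1)\<bar> ((1 - s) * ?r y)"
      unfolding L2_set_scale using that(1) by simp
    also have "\<dots> = (1 - s) * max \<bar>2 * t - 1\<bar> (?r y)"
      using that(1) by (simp add: abs_mult max_mult_distrib_left)
    also have "\<dots> = 1 - s" using that(2) by (simp add: B_def \<rho>_def z)
    finally show ?thesis .
  qed
  have Eq: "E (q (s, z)) = \<kappa> (s, b z)" if sz: "s \<in> {0..1}" "z \<in> B" for s z
  proof (cases "s = 1")
    case True
    then have "\<rho> (q (s, z)) = 0" using \<rho>q[OF sz] by simp
    then show ?thesis using True \<kappa>(3) by (simp add: E_def case_prod_unfold)
  next
    case False
    obtain t y where z: "z = (t, y)" by (cases z)
    have "E (q (s, z)) = \<kappa> (s, b (1/2 + (1 - s) * (t - 1/2) / (1 - s), \<lambda>j. (1 - s) * y j / (1 - s)))"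
      using \<rho>q[OF sz] False by (simp add: E_def z q_def)
    then show ?thesis using False z by simp
  qed
  have qQ: "q (s, z) \<in> {0..1} \<times> ?D" if sz: "s \<in> {0..1}" "z \<in> B" for s z
  proof -
    obtain t y where z: "z = (t, y)" by (cases z)
    have "\<rho> (q (s, z)) \<le> 1" using \<rho>q[OF sz] sz by simp
    then have "\<bar>(1 - s) * (2 * t - 1)\<bar> \<le> 1" "?r (\<lambda>j. (1 - s) * y j) \<le> 1"
      unfolding z \<rho>q' by simp_all
    moreover have "1/2 + (1 - s) * (t - 1/2) = (1 + (1 - s) * (2 * t - 1)) / 2" by (simp add: field_simps)
    ultimately have "1/2 + (1 - s) * (t - 1/2) \<in> {0..1}" "?r (\<lambda>j. (1 - s) * y j) \<le> 1"
      by (simp_all only: half)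
    then show ?thesis using sz by (auto simp: q_def z topspace_closed_disk B_def)
  qed
  have cq: "continuous_map ?Z ?Q q"
  proof -
    have f: "continuous_map ?Z euclideanreal fst" by (rule continuous_map_fst_interval)
    have t: "continuous_map ?Z euclideanreal (\<lambda>z. fst (snd z))"
      by (intro continuous_map_snd_compose continuous_map_from_subtopology continuous_map_fst_interval)
    have y: "continuous_map ?Z euclideanreal (\<lambda>z. snd (snd z) j)" for j
      by (intro continuous_map_snd_compose continuous_map_from_subtopology
          continuous_map_snd_compose[where f = "\<lambda>y. y j"] continuous_map_coordinate_closed_disk)
    have 1: "continuous_map ?Z unit_interval (\<lambda>z. 1/2 + (1 - fst z) * (fst (snd z) - 1/2))"
    proof (rule continuous_map_into_subtopology)
      show "continuous_map ?Z euclideanreal (\<lambda>z. 1/2 + (1 - fst z) * (fst (snd z) - 1/2))"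
        by (intro continuous_map_add continuous_map_real_mult continuous_map_diff f t) simp_all
      show "(\<lambda>z. 1/2 + (1 - fst z) * (fst (snd z) - 1/2)) \<in> topspace ?Z \<rightarrow> {0..1}"
        using qQ by (force simp: q_def case_prod_unfold)
    qed
    have 2: "continuous_map ?Z (closed_disk m) (\<lambda>z j. (1 - fst z) * snd (snd z) j)"
    proof (rule continuous_map_closed_disk)
      show "continuous_map ?Z euclideanreal (\<lambda>z. (1 - fst z) * snd (snd z) j)" for j
        by (intro continuous_map_real_mult continuous_map_diff f y) simp_all
      show "(\<lambda>j. (1 - fst z) * snd (snd z) j) \<in> ?D" if "z \<in> topspace ?Z" for z
        using qQ[of "fst z" "snd z"] that by (auto simp: q_def case_prod_unfold)
    qed
    show ?thesis
      using continuous_map_pairedI[OF 1 2] by (simp add: q_def case_prod_unfold)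
  qed
  have B0: "(0, \<lambda>_. 0) \<in> B" by (auto simp: B C0_def topspace_closed_disk L2_set_def)
  have topB: "topspace (subtopology ?Q B) = B" using closedin_subset[OF closedB] by auto
  have surj: "q ` topspace ?Z = topspace ?Q"
  proof (intro equalityI subsetI)
    fix p assume "p \<in> q ` topspace ?Z" then show "p \<in> topspace ?Q" using qQ topB by auto
  next
    fix p assume p: "p \<in> topspace ?Q"
    obtain t y where ty: "p = (t, y)" by (cases p)
    have tyD: "t \<in> {0..1}" "y \<in> ?D" using p ty by auto
    show "p \<in> q ` topspace ?Z"
    proof (cases "\<rho> p = 0")
      case True
      then have "\<bar>2 * t - 1\<bar> \<le> 0" "?r y \<le> 0" by (auto simp: \<rho>_def ty max_def split: if_splits)
      then have "t = 1/2" "?r y = 0" using L2_set_nonneg[of y "{..<m}"] by auto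
      moreover have "y j = 0" for j
        using calculation(2) tyD(2) by (cases "j < m") (auto simp: L2_set_eq_0_iff topspace_closed_disk)
      ultimately have "p = q (1, (0, \<lambda>_. 0))" by (auto simp: q_def ty)
      then show ?thesis using B0 topB by auto
    next
      case False
      have r0: "0 \<le> ?r y" by (rule L2_set_nonneg)
      have \<rho>: "0 < \<rho> p" "\<rho> p \<le> 1" using False tyD r0 by (auto simp: \<rho>_def ty topspace_closed_disk abs_if)
      define c where "c = \<rho> p"
      have c: "0 < c" "c \<le> 1" "c = max \<bar>2 * t - 1\<bar> (?r y)"
        using \<rho> by (simp_all add: c_def \<rho>_def ty)
      define z where "z = (1/2 + (t - 1/2) / c, \<lambda>j. y j / c)"
      have e1: "1/2 + (t - 1/2) / c = (1 + (2 * t - 1) / c) / 2" using c(1) by (simp add: field_simps)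
      have e2: "?r (\<lambda>j. y j / c) = ?r y / c"
        using c(1) L2_set_scale[of "1 / c" y "{..<m}"] by (simp add: mult.commute)
      have "\<rho> z = max \<bar>(2 * t - 1) / c\<bar> (?r y / c)"
      proof -
        have "2 * ((1 + a) / 2) - 1 = a" for a :: real by (simp add: field_simps)
        then show ?thesis unfolding z_def e1 \<rho>_def prod.case e2 by (simp only:)
      qed
      also have "\<dots> = max \<bar>2 * t - 1\<bar> (?r y) / c"
        using c(1) by (simp add: max_divide_distrib_right)
      also have "\<dots> = 1" using c(1) by (simp add: c(3)[symmetric])
      finally have \<rho>z: "\<rho> z = 1" .
      have "\<bar>(2 * t - 1) / c\<bar> \<le> 1" "?r (\<lambda>j. y j / c) \<le> 1"
        using c(1) c(3) unfolding e2 by (auto simp: divide_le_eq)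
      then have "z \<in> {0..1} \<times> ?D"
        using tyD(2) half unfolding z_def e1 by (simp add: topspace_closed_disk)
      then have zB: "z \<in> B" using \<rho>z by (simp add: B_def)
      have "q (1 - c, z) = p" using c(1) by (simp add: q_def z_def ty)
      then show ?thesis using zB topB c(1,2) by (intro image_eqI[of _ _ "(1 - c, z)"]) auto
    qed
  qed
  have cE: "continuous_map ?Q X E"
  proof (rule continuous_map_compact_quotient[OF _ _ cq surj])
    have "compactin ?Q B" using closedB compQ closedin_compact_space by blast
    then show "compact_space ?Z"
      by (simp add: compact_space_prod_topology compact_space_subtopology)
    show "Hausdorff_space ?Q"
      by (simp add: Hausdorff_space_prod_topology Hausdorff_space_subtopology Hausdorff_space_closed_disk)
    have "continuous_map ?Z (prod_topology unit_interval X) (\<lambda>(s, z). (s, b z))"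
      using cb by (simp add: continuous_map_prod_top)
    then have "continuous_map ?Z X (\<kappa> \<circ> (\<lambda>(s, z). (s, b z)))"
      using \<kappa>(1) continuous_map_compose by blast
    then show "continuous_map ?Z X (E \<circ> q)"
      by (rule continuous_map_eq) (use Eq topB in auto)
  qed
  have EB: "E z = b z" if "z \<in> B" for z
  proof -
    have "q (0, z) = z" by (simp add: q_def case_prod_unfold)
    then show ?thesis using Eq[of 0 z] that \<kappa>(2) by simp
  qed
  show ?thesis
  proof (rule that[OF cE])
    show "E (0, y) = b0 y" "E (1, y) = b1 y" if "y \<in> ?D" for y
      using EB[of "(0, y)"] EB[of "(1, y)"] that by (auto simp: B C0_def C1_def b_def)
    show "E (t, y) = \<beta> (t, y)" if "t \<in> {0..1}" "y \<in> disk_boundary m" for t y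
      using EB[of "(t, y)"] that by (auto simp: B C2_def b_def \<beta>0 \<beta>1)
  qed
qed

section \<open>Superlevel sets and translates\<close>

text \<open>In polar coordinates the free null homotopy is an extension \<open>F\<close> of
  \<open>f\<close> to the disk. Inside the disk the sphere is drawn to \<open>sphere_base\<close>
  along line segments, which keep \<open>sphere_base\<close> fixed; composing with \<open>F\<close>
  gives a homotopy relative to the base point. Hence all homotopies of spheres may be constructed
  without regard to base points.\<close>

lemma nullhomotopic_sphere_based:
  assumes hom: "homotopic_with (\<lambda>_. True) (nsphere i) Y f (\<lambda>_. c)" and a: "f sphere_base = a"
  shows "homotopic_with (\<lambda>f'. f' sphere_base = a) (nsphere i) Y f (\<lambda>_. a)"
proof -
  let ?m = "Suc i" and ?D = "topspace (closed_disk (Suc i))" and ?S = "topspace (nsphere i)"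
  let ?r = "\<lambda>y. L2_set y {..<Suc i}"
  let ?Z = "prod_topology unit_interval (nsphere i)"
  obtain K where K: "continuous_map ?Z Y K" "\<And>x. K (0, x) = f x" "\<And>x. K (1, x) = c"
    using hom unfolding homotopic_with_def by auto
  define q where "q = (\<lambda>(t::real, x :: nat \<Rightarrow> real) j. (1 - t) * x j)"
  define F where "F y = (if ?r y = 0 then c else K (1 - ?r y, \<lambda>j. y j / ?r y))" for y
  have S: "?S = {x. (\<forall>j\<ge>?m. x j = 0) \<and> ?r x = 1}" by (simp only: topspace_nsphere disk_boundary_eq)
  have D: "?D = {x. (\<forall>j\<ge>?m. x j = 0) \<and> ?r x \<le> 1}" by (rule topspace_closed_disk)
  have rq: "?r (q (t, x)) = 1 - t" if "t \<in> {0..1}" "x \<in> ?S" for t x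
    using that unfolding S q_def prod.case L2_set_scale by simp
  have Fq: "F (q (t, x)) = K (t, x)" if "t \<in> {0..1}" "x \<in> ?S" for t x
  proof (cases "t = 1")
    case True then show ?thesis using rq[OF that] K(3) by (simp add: F_def)
  next
    case False
    then show ?thesis using rq[OF that] by (simp add: F_def) (simp add: q_def)
  qed
  have coord: "continuous_map (nsphere i) euclideanreal (\<lambda>x. x j)" for j
    by (rule continuous_map_nsphere_projection)
  have cq: "continuous_map ?Z (closed_disk ?m) q"
  proof (rule continuous_map_closed_disk)
    fix j
    have "continuous_map ?Z euclideanreal (\<lambda>z. (1 - fst z) * snd z j)"
      by (intro continuous_map_real_mult continuous_map_diff continuous_map_fst_interval
          continuous_map_snd_compose[OF coord]) simp
    then show "continuous_map ?Z euclideanreal (\<lambda>z. q z j)" by (simp add: q_def case_prod_unfold)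
  next
    fix z assume "z \<in> topspace ?Z"
    then obtain t x where z: "z = (t, x)" "t \<in> {0..1}" "x \<in> ?S" by auto
    then have "\<forall>j\<ge>?m. q z j = 0" using S by (simp add: q_def)
    then show "q z \<in> ?D" using rq[OF z(2,3)] z D by auto
  qed
  have base: "sphere_base \<in> ?S"
    using in_topspace_nsphere[of i] by (simp add: sphere_base_def)
  have surj: "q ` topspace ?Z = ?D"
  proof (intro equalityI subsetI)
    fix y assume "y \<in> q ` topspace ?Z" then show "y \<in> ?D" using cq by (auto simp: continuous_map_def)
  next
    fix y assume y: "y \<in> ?D"
    show "y \<in> q ` topspace ?Z"
    proof (cases "?r y = 0")
      case True
      have "y j = 0" for j
        using True y unfolding D by (cases "j < ?m") (auto simp: L2_set_eq_0_iff)
      then have "y = q (1, sphere_base)" by (auto simp: q_def)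
      then show ?thesis using base by auto
    next
      case False
      then have "0 < ?r y" using L2_set_nonneg[of y "{..<?m}"] by linarith
      moreover have "?r y \<le> 1" using y unfolding D by blast
      ultimately have r: "0 < ?r y" "?r y \<le> 1" by simp_all
      have "?r (\<lambda>j. y j / ?r y) = 1"
        using L2_set_scale[of "1 / ?r y" y "{..<?m}"] r by simp
      then have "(\<lambda>j. y j / ?r y) \<in> ?S" using y unfolding S D by auto
      moreover have "q (1 - ?r y, \<lambda>j. y j / ?r y) = y" using r by (simp add: q_def)
      ultimately show ?thesis
        using r by (intro image_eqI[of _ _ "(1 - ?r y, \<lambda>j. y j / ?r y)"]) auto
    qed
  qed
  have cF: "continuous_map (closed_disk ?m) Y F"
  proof (rule continuous_map_compact_quotient[OF _ Hausdorff_space_closed_disk cq surj])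
    show "compact_space ?Z"
      by (simp add: compact_space_prod_topology compact_space_nsphere compact_space_subtopology)
    show "continuous_map ?Z Y (F \<circ> q)"
      by (rule continuous_map_eq[OF K(1)]) (use Fq in auto)
  qed
  define b where "b = (\<lambda>(t::real, x) j. (1 - t) * x j + t * sphere_base j)"
  have cb: "continuous_map ?Z (closed_disk ?m) b"
  proof (rule continuous_map_closed_disk)
    fix j
    have "continuous_map ?Z euclideanreal (\<lambda>z. (1 - fst z) * snd z j + fst z * sphere_base j)"
      by (intro continuous_map_add continuous_map_real_mult continuous_map_diff continuous_map_fst_interval
          continuous_map_snd_compose[OF coord]) simp_all
    then show "continuous_map ?Z euclideanreal (\<lambda>z. b z j)" by (simp add: b_def case_prod_unfold)
  next
    fix z assume "z \<in> topspace ?Z"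
    then obtain t x where z: "z = (t, x)" "t \<in> {0..1}" "x \<in> ?S" by auto
    have "?r (b z) \<le> ?r (\<lambda>j. (1 - t) * x j) + ?r (\<lambda>j. t * sphere_base j)"
      unfolding z b_def prod.case by (rule L2_set_triangle_ineq)
    also have "\<dots> = 1" unfolding L2_set_scale using z base S by auto
    finally show "b z \<in> ?D" using z base unfolding D S by (auto simp: b_def)
  qed
  have Fx: "F x = f x" if "x \<in> ?S" for x
    using Fq[of 0 x] that K(2) by (simp add: q_def)
  have iff: "homotopic_with (\<lambda>f'. f' sphere_base = a) (nsphere i) Y f (\<lambda>_. a) \<longleftrightarrow>
    (\<exists>h. continuous_map ?Z Y h \<and> (\<forall>x\<in>?S. h (0, x) = f x) \<and> (\<forall>x\<in>?S. h (1, x) = a) \<and>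
      (\<forall>t\<in>{0..1}. h (t, sphere_base) = a))"
    by (rule homotopic_with) (use base in simp)
  show ?thesis
    unfolding iff
  proof (intro exI[of _ "F \<circ> b"] conjI ballI)
    show "continuous_map ?Z Y (F \<circ> b)" by (rule continuous_map_compose[OF cb cF])
    show "(F \<circ> b) (0, x) = f x" if "x \<in> ?S" for x using Fx[OF that] by (simp add: b_def)
    show "(F \<circ> b) (1, x) = a" if "x \<in> ?S" for x using Fx[OF base] a by (simp add: b_def)
    show "(F \<circ> b) (t, sphere_base) = a" if "t \<in> {0..1}" for t
    proof -
      have "b (t, sphere_base) = sphere_base" by (auto simp: b_def algebra_simps)
      then show ?thesis using Fx[OF base] a by simp
    qed
  qed
qed

lemma homotopic_with_subtopology_mono:
  assumes "homotopic_with (\<lambda>_. True) Z (subtopology X A) f g" "A \<subseteq> B"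
  shows "homotopic_with (\<lambda>_. True) Z (subtopology X B) f g"
proof -
  have "continuous_map (subtopology X A) (subtopology X B) id"
    using assms(2) by (intro continuous_map_into_subtopology continuous_map_from_subtopology) auto
  then have "homotopic_with (\<lambda>_. True) Z (subtopology X B) (id \<circ> f) (id \<circ> g)"
    by (rule homotopic_with_compose_continuous_map_left[OF assms(1)]) simp
  then show ?thesis by simp
qed

lemma (in CW_complex) closed_family_all: "closed_family I" "cells I = topspace X"
proof -
  show top: "cells I = topspace X" using covering_cells by (simp add: cells_def ocell_def)
  show "closed_family I" unfolding closed_family_def top using ccell_subset_topspace by blast
qed

lemma (in CW_complex) closed_family_below: "closed_family {c \<in> I. cdim c < n}"
proof (cases n)
  case 0
  then show ?thesis by (simp add: closed_family_def)
next
  case (Suc n')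
  then show ?thesis using subcomplex_skeleton_part[OF closed_family_all(1), of n'] by (simp add: less_Suc_eq_le)
qed

section \<open>The deck group acting on the cells of the cover\<close>

context finite_type_K_G_1
begin

lemma group_G: "group G"
  using group_hom by (simp add: group_hom_def)

lemma act_in: "g \<in> carrier G \<Longrightarrow> x \<in> topspace X \<Longrightarrow> act g x \<in> topspace X"
  using element_image by blast

lemma act_one: "x \<in> topspace X \<Longrightarrow> act \<one>\<^bsub>G\<^esub> x = x"
  using id_eq_one by (metis restrict_apply')

lemma act_continuous: "g \<in> carrier G \<Longrightarrow> continuous_map X X (act g)"
  using act_homeomorphism homeomorphic_imp_continuous_map by blast

lemma lift_in: "c \<in> I \<Longrightarrow> y \<in> topspace (closed_disk (cdim c)) \<Longrightarrow> \<Psi> c y \<in> topspace X"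
  using lift_continuous by (auto simp: continuous_map_def)

lemma cover_ccell: "cover.ccell (g, c) = (\<lambda>y. act g (\<Psi> c y)) ` topspace (closed_disk (cdim c))"
  unfolding cover.ccell_def by (simp add: cover_dim_def cover_char_def)

lemma cover_ocell: "cover.ocell (g, c) = (\<lambda>y. act g (\<Psi> c y)) ` topspace (open_disk (cdim c))"
  unfolding cover.ocell_def by (simp add: cover_dim_def cover_char_def)

lemma ccell_translate:
  assumes "g \<in> carrier G" "h \<in> carrier G" "c \<in> I"
  shows "cover.ccell (g \<otimes>\<^bsub>G\<^esub> h, c) = act g ` cover.ccell (h, c)"
  unfolding cover_ccell image_image
  using composition_rule[OF lift_in] assms by (intro image_cong) auto

lemma ocell_translate:
  assumes "g \<in> carrier G" "h \<in> carrier G" "c \<in> I"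
  shows "cover.ocell (g \<otimes>\<^bsub>G\<^esub> h, c) = act g ` cover.ocell (h, c)"
  unfolding cover_ocell image_image
  using composition_rule[OF lift_in] assms open_disk_subset[of "cdim c"] by (intro image_cong) auto

definition translate :: "'g \<Rightarrow> ('g \<times> 'c) set \<Rightarrow> ('g \<times> 'c) set" where
  "translate g J = (\<lambda>(h, c). (g \<otimes>\<^bsub>G\<^esub> h, c)) ` J"

lemma cells_translate:
  assumes "g \<in> carrier G" "J \<subseteq> carrier G \<times> I"
  shows "cover.cells (translate g J) = act g ` cover.cells J"
proof -
  have "cover.ocell (case j of (h, c) \<Rightarrow> (g \<otimes>\<^bsub>G\<^esub> h, c)) = act g ` cover.ocell j" if "j \<in> J" for j
    using ocell_translate[OF assms(1)] assms(2) that by (cases j) auto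
  then show ?thesis
    unfolding cover.cells_def translate_def image_UN by auto
qed

lemma closed_family_translate:
  assumes g: "g \<in> carrier G" and J: "cover.closed_family J"
  shows "cover.closed_family (translate g J)"
  unfolding cover.closed_family_def
proof (intro conjI ballI)
  interpret group G by (rule group_G)
  have JI: "J \<subseteq> carrier G \<times> I" using J by (simp add: cover.closed_family_def)
  then show "translate g J \<subseteq> carrier G \<times> I" using g by (auto simp: translate_def)
  fix j assume "j \<in> translate g J"
  then obtain h c where hc: "(h, c) \<in> J" "j = (g \<otimes>\<^bsub>G\<^esub> h, c)" by (auto simp: translate_def)
  then have "cover.ccell (h, c) \<subseteq> cover.cells J" using J by (simp add: cover.closed_family_def)
  moreover have "cover.ccell j = act g ` cover.ccell (h, c)"
    using ccell_translate g hc JI by auto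
  ultimately show "cover.ccell j \<subseteq> cover.cells (translate g J)"
    unfolding cells_translate[OF g JI] by blast
qed

text \<open>The \<open>(n - 1)\<close>-skeleton of the cover. With the strict bound
  \<open>below 0\<close> is empty, which starts the induction over skeleta.\<close>

definition below :: "nat \<Rightarrow> ('g \<times> 'c) set" where
  "below n = carrier G \<times> {c \<in> I. cdim c < n}"

lemma closed_family_cells_below: "cover.closed_family (below n)"
proof -
  have "below n = {j \<in> carrier G \<times> I. cover_dim cdim j < n}"
    by (auto simp: below_def cover_dim_def)
  then show ?thesis using cover.closed_family_below by simp
qed

lemma below_subset: "below n \<subseteq> carrier G \<times> I" by (auto simp: below_def)

lemma in_cells_below:
  assumes "x \<in> cover.cells (below n)"
  obtains g c y where "g \<in> carrier G" "c \<in> I" "cdim c < n" "y \<in> topspace (open_disk (cdim c))"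
    "x = act g (\<Psi> c y)"
proof -
  obtain g c where gc: "g \<in> carrier G" "c \<in> I" "cdim c < n" "x \<in> cover.ocell (g, c)"
    using assms by (elim cover.in_cellsE) (auto simp: below_def)
  then obtain y where "y \<in> topspace (open_disk (cdim c))" "x = act g (\<Psi> c y)"
    unfolding cover_ocell by (elim imageE) blast
  then show ?thesis using that gc by blast
qed

lemma below_closed_disk:
  assumes "g \<in> carrier G" "c \<in> I" "cdim c < n" "y \<in> topspace (closed_disk (cdim c))"
  shows "act g (\<Psi> c y) \<in> cover.cells (below n)"
proof -
  have "act g (\<Psi> c y) \<in> cover.ccell (g, c)" using assms unfolding cover_ccell by blast
  moreover have "(g, c) \<in> below n" using assms by (simp add: below_def)
  ultimately show ?thesis using closed_family_cells_below[of n] unfolding cover.closed_family_def by blast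
qed

lemma below_translate:
  assumes g: "g \<in> carrier G" and x: "x \<in> cover.cells (below n)"
  shows "act g x \<in> cover.cells (below n)"
proof -
  interpret group G by (rule group_G)
  obtain h c y where *: "h \<in> carrier G" "c \<in> I" "cdim c < n" "y \<in> topspace (open_disk (cdim c))"
    "x = act h (\<Psi> c y)" using x by (rule in_cells_below)
  then have "y \<in> topspace (closed_disk (cdim c))" using open_disk_subset by blast
  then show ?thesis
    using below_closed_disk[of "g \<otimes>\<^bsub>G\<^esub> h" c n y] * g composition_rule[OF lift_in, of c y g h] by simp
qed

lemma lift_boundary_below:
  assumes "g \<in> carrier G" "c \<in> I" "y \<in> disk_boundary (cdim c)"
  shows "act g (\<Psi> c y) \<in> cover.cells (below (cdim c))"
proof -
  have "cover_char act \<Psi> (g, c) ` disk_boundary (cover_dim cdim (g, c)) \<subseteq>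
    cover.cells {j \<in> carrier G \<times> I. cover_dim cdim j < cover_dim cdim (g, c)}"
    using assms by (intro cover.boundary_subset_lower cover.closed_family_all) auto
  moreover have "{j \<in> carrier G \<times> I. cover_dim cdim j < cover_dim cdim (g, c)} = below (cdim c)"
    by (auto simp: below_def cover_dim_def)
  ultimately show ?thesis using assms(3) by (auto simp: cover_dim_def cover_char_def)
qed

end

section \<open>An equivariant homotopy from the identity to a central translation\<close>

context finite_type_K_G_1
begin

text \<open>Control of \<open>H\<close> on the chosen lifts spreads to all their translates by
  equivariance. Finiteness of \<open>J\<close> brings \<open>continuous_map_cellwise\<close> into
  play and is available over every compact set.\<close>

lemma lower_cells_cellwise:
  assumes H: "\<And>c. c \<in> I \<Longrightarrow> cdim c < n \<Longrightarrow>
      continuous_map (prod_topology unit_interval (closed_disk (cdim c))) X (\<lambda>(t, y). H (t, \<Psi> c y))"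
    and equiv: "\<And>g x t. g \<in> carrier G \<Longrightarrow> x \<in> cover.cells (below n) \<Longrightarrow> t \<in> {0..1} \<Longrightarrow>
      H (t, act g x) = act g (H (t, x))"
    and J: "finite J" "J \<subseteq> below n" "S \<subseteq> cover.cells J"
  shows "continuous_map (prod_topology unit_interval (subtopology X S)) X H"
proof (rule cover.continuous_map_cellwise[OF J(1)])
  interpret group G by (rule group_G)
  show "J \<subseteq> carrier G \<times> I" using J(2) below_subset by blast
  show "S \<subseteq> (\<Union>c\<in>J. cover.ccell c)"
  proof
    fix x assume "x \<in> S"
    then obtain j where "j \<in> J" "x \<in> cover.ocell j" using J(3) cover.in_cellsE by blast
    then show "x \<in> (\<Union>c\<in>J. cover.ccell c)" using cover.ocell_subset_ccell[of j] by blast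
  qed
  fix j assume "j \<in> J"
  then obtain g c where gc: "j = (g, c)" "g \<in> carrier G" "c \<in> I" "cdim c < n"
    using J(2) by (auto simp: below_def)
  have "continuous_map (prod_topology unit_interval (closed_disk (cdim c))) X
      (act g \<circ> (\<lambda>(t, y). H (t, \<Psi> c y)))"
    using continuous_map_compose[OF H[OF gc(3,4)] act_continuous[OF gc(2)]] .
  moreover have "(act g \<circ> (\<lambda>(t, y). H (t, \<Psi> c y))) z = (case z of (t, y) \<Rightarrow> H (t, cover_char act \<Psi> j y))"
    if "z \<in> topspace (prod_topology unit_interval (closed_disk (cdim c)))" for z
  proof -
    obtain t y where z: "z = (t, y)" "t \<in> {0..1}" "y \<in> topspace (closed_disk (cdim c))"
      using \<open>z \<in> _\<close> by auto
    have "\<Psi> c y \<in> cover.cells (below n)"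
      using below_closed_disk[OF one_closed gc(3,4) z(3)] act_one[OF lift_in[OF gc(3) z(3)]] by simp
    then show ?thesis using equiv[OF gc(2) _ z(2)] by (simp add: z(1) gc(1) cover_char_def)
  qed
  ultimately show "continuous_map (prod_topology unit_interval (closed_disk (cover_dim cdim j))) X
      (\<lambda>(t, y). H (t, cover_char act \<Psi> j y))"
    unfolding gc(1) cover_dim_def prod.case by (rule continuous_map_eq)
qed

text \<open>Over each lift of an \<open>n\<close>-cell the homotopy has to fill a cylinder with
  bottom \<open>\<Psi> c\<close>, top \<open>act z (\<Psi> c)\<close> and sides given by the
  previous stage, which is possible as \<open>X\<close> is contractible. Filling one cylinder per
  orbit and translating makes the result equivariant. Continuity is recorded on the lifts only, the
  form that \<open>lower_cells_cellwise\<close> takes.\<close>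

lemma central_homotopy:
  assumes z: "z \<in> carrier G" and central: "\<forall>g\<in>carrier G. z \<otimes>\<^bsub>G\<^esub> g = g \<otimes>\<^bsub>G\<^esub> z"
  shows "\<exists>H. (\<forall>c\<in>I. cdim c < n \<longrightarrow>
      continuous_map (prod_topology unit_interval (closed_disk (cdim c))) X (\<lambda>(t, y). H (t, \<Psi> c y))) \<and>
    (\<forall>x\<in>cover.cells (below n). H (0, x) = x \<and> H (1, x) = act z x) \<and>
    (\<forall>g\<in>carrier G. \<forall>x\<in>cover.cells (below n). \<forall>t\<in>{0..1}. H (t, act g x) = act g (H (t, x)))"
proof (induction n)
  case 0
  then show ?case by (simp add: below_def cover.cells_def)
next
  case (Suc n)
  interpret group G by (rule group_G)
  obtain H where H: "\<And>c. c \<in> I \<Longrightarrow> cdim c < n \<Longrightarrow>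
      continuous_map (prod_topology unit_interval (closed_disk (cdim c))) X (\<lambda>(t, y). H (t, \<Psi> c y))"
    "\<And>x. x \<in> cover.cells (below n) \<Longrightarrow> H (0, x) = x"
    "\<And>x. x \<in> cover.cells (below n) \<Longrightarrow> H (1, x) = act z x"
    "\<And>g x t. g \<in> carrier G \<Longrightarrow> x \<in> cover.cells (below n) \<Longrightarrow> t \<in> {0..1} \<Longrightarrow> H (t, act g x) = act g (H (t, x))"
    using Suc by blast
  let ?D = "topspace (closed_disk n)" and ?O = "topspace (open_disk n)"
  define N where "N = {c \<in> I. cdim c = n}"
  have \<Psi>bd: "\<Psi> c y \<in> cover.cells (below n)" if "c \<in> N" "y \<in> disk_boundary n" for c y
  proof -
    have "y \<in> topspace (closed_disk n)" using that(2) by (auto simp: disk_boundary_eq topspace_closed_disk)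
    then show ?thesis
      using lift_boundary_below[OF one_closed, of c y] act_one[OF lift_in, of c y] that by (simp add: N_def)
  qed
  have "\<forall>c\<in>N. \<exists>E. continuous_map (prod_topology unit_interval (closed_disk n)) X E \<and>
    (\<forall>y\<in>?D. E (0, y) = \<Psi> c y \<and> E (1, y) = act z (\<Psi> c y)) \<and>
    (\<forall>t\<in>{0..1}. \<forall>y\<in>disk_boundary n. E (t, y) = H (t, \<Psi> c y))"
  proof
    fix c assume c: "c \<in> N"
    then have cI: "c \<in> I" "cdim c = n" by (auto simp: N_def)
    have b0: "continuous_map (closed_disk n) X (\<Psi> c)" using lift_continuous[OF cI(1)] cI(2) by simp
    have b1: "continuous_map (closed_disk n) X (\<lambda>y. act z (\<Psi> c y))"
      using continuous_map_compose[OF b0 act_continuous[OF z]] by (simp add: o_def)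
    have sub: "\<Psi> c ` disk_boundary n \<subseteq> cover.cells (below n)" using \<Psi>bd[OF c] by blast
    have bdD: "disk_boundary n \<subseteq> ?D" by (auto simp: disk_boundary_eq topspace_closed_disk)
    \<comment> \<open>The attaching sphere is compact and meets finitely many cells, so the previous
      stage is jointly continuous over it and can serve as the side of the cylinder.\<close>
    obtain J where J: "finite J" "J \<subseteq> below n" "\<Psi> c ` disk_boundary n \<subseteq> cover.cells J"
    proof -
      have "closedin (closed_disk n) (disk_boundary n)"
      proof -
        have "disk_boundary n = {x \<in> ?D. 1 \<le> L2_set x {..<n}}"
          by (auto simp: disk_boundary_eq topspace_closed_disk)
        then show ?thesis using closedin_closed_disk_level(2)[of n 1] by simp
      qed
      then have "compactin X (\<Psi> c ` disk_boundary n)"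
        using closedin_compact_space[OF compact_space_closed_disk] image_compactin b0 by blast
      then have fin: "finite {j \<in> carrier G \<times> I. cover.ocell j \<inter> \<Psi> c ` disk_boundary n \<noteq> {}}"
        by (rule cover.compactin_finite_cells)
      let ?J = "{j \<in> below n. cover.ocell j \<inter> \<Psi> c ` disk_boundary n \<noteq> {}}"
      show ?thesis
      proof (rule that[of ?J])
        have "?J \<subseteq> {j \<in> carrier G \<times> I. cover.ocell j \<inter> \<Psi> c ` disk_boundary n \<noteq> {}}"
          using below_subset by auto
        then show "finite ?J" using fin finite_subset by blast
        show "\<Psi> c ` disk_boundary n \<subseteq> cover.cells ?J"
        proof
          fix x assume x: "x \<in> \<Psi> c ` disk_boundary n"
          then have "x \<in> cover.cells (below n)" using sub by blast
          then obtain j where "j \<in> below n" "x \<in> cover.ocell j" by (rule cover.in_cellsE)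
          then show "x \<in> cover.cells ?J" using x by (intro cover.in_cellsI[of j]) auto
        qed
      qed auto
    qed
    have "continuous_map (subtopology (closed_disk n) (disk_boundary n)) (subtopology X (\<Psi> c ` disk_boundary n)) (\<Psi> c)"
      using b0 by (intro continuous_map_into_subtopology continuous_map_from_subtopology) auto
    then have "continuous_map (prod_topology unit_interval (subtopology (closed_disk n) (disk_boundary n)))
        (prod_topology unit_interval (subtopology X (\<Psi> c ` disk_boundary n))) (\<lambda>(t, y). (t, \<Psi> c y))"
      by (simp add: continuous_map_prod_top)
    from continuous_map_compose[OF this lower_cells_cellwise[OF H(1,4) J]]
    have \<beta>: "continuous_map (prod_topology unit_interval (subtopology (closed_disk n) (disk_boundary n))) X
        (\<lambda>z. H (fst z, \<Psi> c (snd z)))"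
      by (simp add: o_def case_prod_unfold)
    obtain E where "continuous_map (prod_topology unit_interval (closed_disk n)) X E"
      "\<And>y. y \<in> ?D \<Longrightarrow> E (0, y) = \<Psi> c y" "\<And>y. y \<in> ?D \<Longrightarrow> E (1, y) = act z (\<Psi> c y)"
      "\<And>t y. t \<in> {0..1} \<Longrightarrow> y \<in> disk_boundary n \<Longrightarrow> E (t, y) = H (fst (t, y), \<Psi> c (snd (t, y)))"
      using cylinder_extension[OF contractible b0 b1 \<beta>] H(2,3) \<Psi>bd[OF c] by auto
    then show "\<exists>E. continuous_map (prod_topology unit_interval (closed_disk n)) X E \<and>
      (\<forall>y\<in>?D. E (0, y) = \<Psi> c y \<and> E (1, y) = act z (\<Psi> c y)) \<and>
      (\<forall>t\<in>{0..1}. \<forall>y\<in>disk_boundary n. E (t, y) = H (t, \<Psi> c y))"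
      by (intro exI[of _ E]) simp
  qed
  from bchoice[OF this] obtain E where E0: "\<forall>c\<in>N. continuous_map (prod_topology unit_interval (closed_disk n)) X (E c) \<and>
    (\<forall>y\<in>?D. E c (0, y) = \<Psi> c y \<and> E c (1, y) = act z (\<Psi> c y)) \<and>
    (\<forall>t\<in>{0..1}. \<forall>y\<in>disk_boundary n. E c (t, y) = H (t, \<Psi> c y))" by blast
  \<comment> \<open>Coordinates of a point in an open \<open>n\<close>-cell of the cover. They are
    unique, because the cells indexed by distinct pairs are disjoint and characteristic maps are
    injective on open disks; so the choice in \<open>H'\<close> is forced.\<close>
  define Q where "Q x = (\<lambda>(g, c, y). g \<in> carrier G \<and> c \<in> N \<and> y \<in> ?O \<and> x = act g (\<Psi> c y))" for x
  define H' where "H' = (\<lambda>(t, x). if x \<in> cover.cells (below n) then H (t, x)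
    else (case SOME p. Q x p of (g, c, y) \<Rightarrow> act g (E c (t, y))))"
  have OD: "?O \<subseteq> ?D" by (rule open_disk_subset)
  have uniq: "(SOME p. Q x p) = p" if "Q x p" for x p
  proof (rule some_equality[of "Q x", OF that])
    fix p' assume p': "Q x p'"
    obtain g c y where p: "p = (g, c, y)" by (cases p)
    obtain g' c' y' where p'eq: "p' = (g', c', y')" by (cases p')
    have *: "g \<in> carrier G" "c \<in> N" "y \<in> ?O" "x = act g (\<Psi> c y)"
      "g' \<in> carrier G" "c' \<in> N" "y' \<in> ?O" "x = act g' (\<Psi> c' y')"
      using that p' by (auto simp: Q_def p p'eq)
    have "x \<in> cover.ocell (g, c)" "x \<in> cover.ocell (g', c')"
      unfolding cover_ocell using * unfolding N_def by (metis (mono_tags, lifting) image_eqI mem_Collect_eq)+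
    then have eq: "(g, c) = (g', c')" using cover.ocell_disjoint[of "(g, c)" "(g', c')" x] * by (auto simp: N_def)
    have gc: "(g, c) \<in> carrier G \<times> I" "cover_dim cdim (g, c) = n"
      using * by (simp_all add: N_def cover_dim_def)
    obtain \<psi> where \<psi>: "\<And>y. y \<in> topspace (open_disk (cover_dim cdim (g, c))) \<Longrightarrow>
        \<psi> (cover_char act \<Psi> (g, c) y) = y"
      using cover.cell_inverse[OF gc(1)] by metis
    have "y = \<psi> (cover_char act \<Psi> (g, c) y)" by (rule \<psi>[symmetric]) (simp only: gc(2) *(3))
    also have "cover_char act \<Psi> (g, c) y = cover_char act \<Psi> (g, c) y'"
      using *(4,8) eq by (simp add: cover_char_def)
    also have "\<psi> \<dots> = y'" by (rule \<psi>) (simp only: gc(2) *(7))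
    finally have "y = y'" .
    then show "p' = p" using eq p p'eq by simp
  qed
  have H'_low: "H' (t, x) = H (t, x)" if "x \<in> cover.cells (below n)" for t x
    using that by (simp add: H'_def)
  \<comment> \<open>The formula for open cells persists on the boundary, where \<open>E c\<close>
    was prescribed to agree with the equivariant \<open>H\<close>.\<close>
  have H'_N: "H' (t, act g (\<Psi> c y)) = act g (E c (t, y))"
    if "g \<in> carrier G" "c \<in> N" "y \<in> ?D" "t \<in> {0..1}" for g c y t
  proof (cases "y \<in> ?O")
    case True
    have "act g (\<Psi> c y) \<in> cover.ocell (g, c)" using True that(2) unfolding cover_ocell N_def by auto
    then have "act g (\<Psi> c y) \<notin> cover.cells (below n)"
      using cover.ocell_in_cells_iff[OF below_subset[of n], of "(g, c)"] that by (auto simp: below_def N_def)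
    moreover have "Q (act g (\<Psi> c y)) (g, c, y)" using that True by (simp add: Q_def)
    ultimately show ?thesis using uniq by (simp add: H'_def)
  next
    case False
    then have y: "y \<in> disk_boundary n" using that(3) by (simp add: disk_boundary_def)
    have "H' (t, act g (\<Psi> c y)) = H (t, act g (\<Psi> c y))"
      using H'_low below_translate[OF that(1) \<Psi>bd[OF that(2) y]] by blast
    also have "\<dots> = act g (H (t, \<Psi> c y))" using H(4) that(1,4) \<Psi>bd[OF that(2) y] by blast
    also have "H (t, \<Psi> c y) = E c (t, y)" using E0 that(2,4) y by simp
    finally show ?thesis .
  qed
  have split: thesis if x: "x \<in> cover.cells (below (Suc n))"
    and 1: "x \<in> cover.cells (below n) \<Longrightarrow> thesis"
    and 2: "\<And>g c y. g \<in> carrier G \<Longrightarrow> c \<in> N \<Longrightarrow> y \<in> ?D \<Longrightarrow> x = act g (\<Psi> c y) \<Longrightarrow> thesis" for x thesis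
  proof -
    obtain g c y where gcy: "g \<in> carrier G" "c \<in> I" "cdim c < Suc n" "y \<in> topspace (open_disk (cdim c))"
      "x = act g (\<Psi> c y)" using x by (rule in_cells_below)
    then have y: "y \<in> topspace (closed_disk (cdim c))" using open_disk_subset by blast
    show ?thesis
    proof (cases "cdim c < n")
      case True
      then show ?thesis using below_closed_disk[OF gcy(1,2) True y] gcy(5) 1 by simp
    next
      case False
      then have n: "cdim c = n" using gcy(3) by simp
      then have "c \<in> N" using gcy(2) by (simp add: N_def)
      then show ?thesis using 2[OF gcy(1) _ _ gcy(5)] y unfolding n by simp
    qed
  qed
  have E_ends: "E c (0, y) = \<Psi> c y" "E c (1, y) = act z (\<Psi> c y)" if "c \<in> N" "y \<in> ?D" for c y
    using E0 that by blast+
  have Ein: "E c (t, y) \<in> topspace X" if "c \<in> N" "t \<in> {0..1}" "y \<in> ?D" for c t y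
  proof -
    have "continuous_map (prod_topology unit_interval (closed_disk n)) X (E c)" using E0 that(1) by blast
    moreover have "(t, y) \<in> topspace (prod_topology unit_interval (closed_disk n))" using that by simp
    ultimately show ?thesis unfolding continuous_map_def by blast
  qed
  have res1: "continuous_map (prod_topology unit_interval (closed_disk (cdim c))) X (\<lambda>(t, y). H' (t, \<Psi> c y))"
    if c: "c \<in> I" "cdim c < Suc n" for c
    proof (cases "cdim c < n")
      case True
      have "\<Psi> c y \<in> cover.cells (below n)" if "y \<in> topspace (closed_disk (cdim c))" for y
        using below_closed_disk[OF one_closed c(1) True that] act_one[OF lift_in[OF c(1) that]] by simp
      then show ?thesis
        by (intro continuous_map_eq[OF H(1)[OF c(1) True]]) (auto simp: H'_low)
    next
      case False
      then have cN: "c \<in> N" "cdim c = n" using c by (auto simp: N_def)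
      have "continuous_map (prod_topology unit_interval (closed_disk n)) X (E c)" using E0 cN by blast
      moreover have EH: "E c (t, y) = H' (t, \<Psi> c y)" if "t \<in> {0..1}" "y \<in> ?D" for t y
      proof -
        have "\<Psi> c y \<in> topspace X" using lift_in[OF c(1)] that(2) cN(2) by simp
        then show ?thesis
          using H'_N[OF one_closed cN(1) that(2,1)] act_one Ein[OF cN(1) that] by simp
      qed
      ultimately show ?thesis
        unfolding cN(2) by (elim continuous_map_eq) (auto simp: EH)
    qed
  have res2: "H' (0, x) = x" if x: "x \<in> cover.cells (below (Suc n))" for x
  proof -
    consider "x \<in> cover.cells (below n)" |
      g c y where "g \<in> carrier G" "c \<in> N" "y \<in> ?D" "x = act g (\<Psi> c y)"
      by (rule split[OF x])
    then show ?thesis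
    proof cases
      case 1
      then show ?thesis by (simp only: H'_low H(2))
    next
      case *: 2
      have "H' (0, x) = act g (E c (0, y))" unfolding *(4) by (rule H'_N[OF *(1-3)]) simp
      then show ?thesis unfolding E_ends(1)[OF *(2,3)] *(4) .
    qed
  qed
  have res3: "H' (1, x) = act z x" if x: "x \<in> cover.cells (below (Suc n))" for x
  proof -
    consider "x \<in> cover.cells (below n)" |
      g c y where "g \<in> carrier G" "c \<in> N" "y \<in> ?D" "x = act g (\<Psi> c y)"
      by (rule split[OF x])
    then show ?thesis
    proof cases
      case 1
      then show ?thesis by (simp only: H'_low H(3))
    next
      case *: 2
      have X: "\<Psi> c y \<in> topspace X" using lift_in[of c y] *(2,3) by (simp add: N_def)
      have "H' (1, x) = act g (E c (1, y))" unfolding *(4) by (rule H'_N[OF *(1-3)]) simp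
      also have "\<dots> = act g (act z (\<Psi> c y))" unfolding E_ends(2)[OF *(2,3)] ..
      also have "\<dots> = act (g \<otimes>\<^bsub>G\<^esub> z) (\<Psi> c y)" by (rule composition_rule[OF X *(1) z, symmetric])
      \<comment> \<open>Centrality enters here: the translation by \<open>z\<close> has to commute
        with the deck group to be the end of an equivariant homotopy.\<close>
      also have "\<dots> = act (z \<otimes>\<^bsub>G\<^esub> g) (\<Psi> c y)" unfolding central[rule_format, OF *(1)] ..
      also have "\<dots> = act z (act g (\<Psi> c y))" by (rule composition_rule[OF X z *(1)])
      finally show ?thesis unfolding *(4) .
    qed
  qed
  have res4: "H' (t, act g' x) = act g' (H' (t, x))"
    if g': "g' \<in> carrier G" and x: "x \<in> cover.cells (below (Suc n))" and t: "t \<in> {0..1::real}" for g' x t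
  proof -
    consider "x \<in> cover.cells (below n)" |
      g c y where "g \<in> carrier G" "c \<in> N" "y \<in> ?D" "x = act g (\<Psi> c y)"
      by (rule split[OF x])
    then show ?thesis
    proof cases
      case 1
      then show ?thesis using H'_low H(4)[OF g' _ t] below_translate[OF g'] by (simp only:)
    next
      case *: 2
      have X: "\<Psi> c y \<in> topspace X" using lift_in[of c y] *(2,3) by (simp add: N_def)
      have "act g' x = act (g' \<otimes>\<^bsub>G\<^esub> g) (\<Psi> c y)"
        unfolding *(4) by (rule composition_rule[OF X g' *(1), symmetric])
      then have "H' (t, act g' x) = act (g' \<otimes>\<^bsub>G\<^esub> g) (E c (t, y))"
        using H'_N[OF m_closed[OF g' *(1)] *(2,3) t] by (simp only:)
      also have "\<dots> = act g' (act g (E c (t, y)))"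
        using composition_rule[OF Ein[OF *(2) t *(3)] g' *(1)] .
      also have "act g (E c (t, y)) = H' (t, x)" unfolding *(4) by (rule H'_N[OF *(1-3) t, symmetric])
      finally show ?thesis .
    qed
  qed
  show ?case
    by (intro exI[of _ H'] conjI ballI impI res1 res2 res3 res4)
qed

end

section \<open>Height control and contraction of spheres by central translations\<close>

context finite_type_K_G_1
begin

lemma superlevelI:
  assumes "cover.closed_family J" "x \<in> cover.cells J" "\<And>y. y \<in> cover.cells J \<Longrightarrow> s \<le> h y"
  shows "x \<in> superlevel G I cdim X act \<Psi> h s"
proof -
  have "subcomplex X (carrier G \<times> I) (cover_dim cdim) (cover_char act \<Psi>) (cover.cells J)"
    using assms(1) by (rule cover.subcomplex_cells)
  moreover have "cover.cells J \<subseteq> {x \<in> topspace X. s \<le> h x}"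
    using assms(1,3) cover.cells_subset_topspace[of J] by (auto simp: cover.closed_family_def)
  ultimately show ?thesis unfolding superlevel_def maximal_subcomplex_def using assms(2) by blast
qed

lemma superlevel_height: "x \<in> superlevel G I cdim X act \<Psi> h s \<Longrightarrow> x \<in> topspace X \<and> s \<le> h x"
  unfolding superlevel_def maximal_subcomplex_def by blast

lemma subcomplex_superlevel:
  "subcomplex X (carrier G \<times> I) (cover_dim cdim) (cover_char act \<Psi>) (superlevel G I cdim X act \<Psi> h s)"
proof -
  let ?A = "{x \<in> topspace X. s \<le> h x}"
  let ?sub = "subcomplex X (carrier G \<times> I) (cover_dim cdim) (cover_char act \<Psi>)"
  have "subcomplex X (carrier G \<times> I) (cover_dim cdim) (cover_char act \<Psi>) (\<Union>{S. ?sub S \<and> S \<subseteq> ?A})"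
    unfolding subcomplex_def[of _ _ _ _ "\<Union>{S. ?sub S \<and> S \<subseteq> ?A}"]
  proof (intro conjI ballI impI)
    show "\<Union>{S. ?sub S \<and> S \<subseteq> ?A} \<subseteq> topspace X" by auto
    fix c assume c: "c \<in> carrier G \<times> I"
      "cover_char act \<Psi> c ` topspace (open_disk (cover_dim cdim c)) \<inter> \<Union>{S. ?sub S \<and> S \<subseteq> ?A} \<noteq> {}"
    then obtain S where S: "?sub S" "S \<subseteq> ?A"
      "cover_char act \<Psi> c ` topspace (open_disk (cover_dim cdim c)) \<inter> S \<noteq> {}" by auto
    then have "cover_char act \<Psi> c ` topspace (closed_disk (cover_dim cdim c)) \<subseteq> S"
      using c(1) unfolding subcomplex_def by (elim conjE) (drule bspec, assumption, blast)
    then show "cover_char act \<Psi> c ` topspace (closed_disk (cover_dim cdim c)) \<subseteq> \<Union>{S. ?sub S \<and> S \<subseteq> ?A}"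
      using S(1,2) by auto
  qed
  then show ?thesis by (simp add: superlevel_def maximal_subcomplex_def)
qed

lemma superlevel_mono: "s' \<le> s \<Longrightarrow> superlevel G I cdim X act \<Psi> h s \<subseteq> superlevel G I cdim X act \<Psi> h s'"
  unfolding superlevel_def maximal_subcomplex_def by fastforce

lemma compact_height_bounded:
  assumes "continuous_map X euclideanreal h" "compactin X C"
  obtains B where "0 \<le> B" "\<And>x. x \<in> C \<Longrightarrow> \<bar>h x\<bar> \<le> B"
proof -
  have "compactin euclideanreal (h ` C)" using assms image_compactin by blast
  then have "bounded (h ` C)" by (simp add: compact_imp_bounded)
  then obtain B where "\<forall>y\<in>h ` C. norm y \<le> B" unfolding bounded_iff by blast
  then have "\<bar>h x\<bar> \<le> \<bar>B\<bar>" if "x \<in> C" for x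
    using that by (auto intro: order_trans)
  then show ?thesis using that[of "\<bar>B\<bar>"] by simp
qed

lemma act_pow:
  assumes z: "z \<in> carrier G" and x: "x \<in> topspace X"
    and h: "\<And>x. x \<in> topspace X \<Longrightarrow> h (act z x) = r + h x"
  shows "h (act (z [^]\<^bsub>G\<^esub> (j::nat)) x) = real j * r + h x"
proof (induction j)
  case 0
  interpret group G by (rule group_G)
  show ?case using act_one[OF x] by simp
next
  case (Suc j)
  interpret group G by (rule group_G)
  have "act (z [^]\<^bsub>G\<^esub> Suc j) x = act z (act (z [^]\<^bsub>G\<^esub> j) x)"
    using composition_rule[OF x z nat_pow_closed[OF z]] nat_pow_Suc2[OF z] by simp
  then show ?case using h[OF act_in[OF nat_pow_closed[OF z] x]] Suc by (simp add: algebra_simps)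
qed

lemma finite_below: "finite {c \<in> I. cdim c < n}"
proof -
  have "{c \<in> I. cdim c < n} = (\<Union>m<n. {c \<in> I. cdim c = m})" by auto
  then show ?thesis using finitely_many_cells by simp
qed

text \<open>Translation by \<open>g\<close> shifts all heights by \<open>chi g\<close>, so the drop
  over a cell depends only on its orbit. The skeleton has finitely many orbits, and over each of
  them the track of the homotopy is compact.\<close>

lemma homotopy_height_drop:
  assumes H: "\<And>c. c \<in> I \<Longrightarrow> cdim c < n \<Longrightarrow>
      continuous_map (prod_topology unit_interval (closed_disk (cdim c))) X (\<lambda>(t, y). H (t, \<Psi> c y))"
    and equiv: "\<And>g x t. g \<in> carrier G \<Longrightarrow> x \<in> cover.cells (below n) \<Longrightarrow> t \<in> {0..1} \<Longrightarrow>
      H (t, act g x) = act g (H (t, x))"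
    and h: "continuous_map X euclideanreal h"
      "\<And>g x. g \<in> carrier G \<Longrightarrow> x \<in> topspace X \<Longrightarrow> h (act g x) = chi g + h x"
  shows "\<exists>d\<ge>0. \<forall>x\<in>cover.cells (below n). \<forall>t\<in>{0..1}. 0 \<le> h x \<longrightarrow>
    H (t, x) \<in> superlevel G I cdim X act \<Psi> h (- d)"
proof -
  interpret group G by (rule group_G)
  let ?N = "{c \<in> I. cdim c < n}"
  have "\<forall>c\<in>?N. \<exists>b\<ge>0. \<forall>x\<in>cover.cells (below n). \<forall>g\<in>carrier G. \<forall>y\<in>topspace (closed_disk (cdim c)). \<forall>t\<in>{0..1}.
    x = act g (\<Psi> c y) \<longrightarrow> 0 \<le> h x \<longrightarrow> H (t, x) \<in> superlevel G I cdim X act \<Psi> h (- b)"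
  proof
    fix c assume "c \<in> ?N"
    then have c: "c \<in> I" "cdim c < n" by auto
    let ?P = "prod_topology unit_interval (closed_disk (cdim c))"
    have compP: "compactin ?P (topspace ?P)"
      by (simp add: compact_space_def[symmetric] compact_space_prod_topology compact_space_closed_disk compact_space_subtopology del: topspace_prod_topology)
    have "compactin X ((\<lambda>(t, y). H (t, \<Psi> c y)) ` topspace ?P)"
      by (rule image_compactin[OF compP H[OF c]])
    \<comment> \<open>The track is enclosed in a subcomplex, since belonging to a superlevel set is
      a condition on whole closed cells and not just on the height of a point.\<close>
    then obtain M where M: "finite M" "cover.closed_family M" "(\<lambda>(t, y). H (t, \<Psi> c y)) ` topspace ?P \<subseteq> cover.cells M"
      using cover.compactin_finite_subcomplex by metis
    obtain B where B: "0 \<le> B" "\<And>x. x \<in> cover.cells M \<Longrightarrow> \<bar>h x\<bar> \<le> B"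
      using compact_height_bounded[OF h(1) cover.compactin_cells[OF M(1,2)]] by blast
    have "compactin X (\<Psi> c ` topspace (closed_disk (cdim c)))"
      using image_compactin[OF _ lift_continuous[OF c(1)]] compact_space_closed_disk
      unfolding compact_space_def by blast
    then obtain B' where B': "0 \<le> B'" "\<And>x. x \<in> \<Psi> c ` topspace (closed_disk (cdim c)) \<Longrightarrow> \<bar>h x\<bar> \<le> B'"
      using compact_height_bounded[OF h(1)] by blast
    show "\<exists>b\<ge>0. \<forall>x\<in>cover.cells (below n). \<forall>g\<in>carrier G. \<forall>y\<in>topspace (closed_disk (cdim c)). \<forall>t\<in>{0..1}.
      x = act g (\<Psi> c y) \<longrightarrow> 0 \<le> h x \<longrightarrow> H (t, x) \<in> superlevel G I cdim X act \<Psi> h (- b)"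
    \<comment> \<open>\<open>B'\<close> bounds the heights of the lift itself, so a point of
      nonnegative height in its translate by \<open>g\<close> forces
      \<open>chi g \<ge> - B'\<close>. \<open>B\<close> bounds the heights on \<open>M\<close>, and
      the two losses add up.\<close>
    proof (intro exI[of _ "B + B'"] conjI ballI impI)
      show "0 \<le> B + B'" using B B' by simp
      fix x g y t assume *: "g \<in> carrier G" "y \<in> topspace (closed_disk (cdim c))" "t \<in> {0..1::real}"
        "x = act g (\<Psi> c y)" "0 \<le> h x"
      have yX: "\<Psi> c y \<in> topspace X" using lift_in[OF c(1) *(2)] .
      have yb: "\<Psi> c y \<in> cover.cells (below n)"
        using below_closed_disk[OF one_closed c *(2)] act_one[OF yX] by simp
      have "0 \<le> chi g + h (\<Psi> c y)" using *(4,5) h(2)[OF *(1) yX] by simp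
      moreover have "\<bar>h (\<Psi> c y)\<bar> \<le> B'" using B'(2) *(2) by blast
      ultimately have chi: "- B' \<le> chi g" by linarith
      have MI: "M \<subseteq> carrier G \<times> I" using M(2) by (simp add: cover.closed_family_def)
      have "(t, y) \<in> topspace ?P" using *(2,3) by simp
      then have "(case (t, y) of (t, y) \<Rightarrow> H (t, \<Psi> c y)) \<in> cover.cells M" using M(3) by blast
      then have "act g (H (t, \<Psi> c y)) \<in> cover.cells (translate g M)"
        unfolding cells_translate[OF *(1) MI] by simp
      then have "H (t, x) \<in> cover.cells (translate g M)"
        unfolding *(4) equiv[OF *(1) yb *(3)] .
      then show "H (t, x) \<in> superlevel G I cdim X act \<Psi> h (- (B + B'))"
      proof (rule superlevelI[OF closed_family_translate[OF *(1) M(2)]])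
        fix w assume "w \<in> cover.cells (translate g M)"
        then obtain v where v: "v \<in> cover.cells M" "w = act g v" unfolding cells_translate[OF *(1) MI] by blast
        have "v \<in> topspace X" using v(1) cover.cells_subset_topspace[OF MI] by blast
        then have "h w = chi g + h v" using h(2)[OF *(1)] v(2) by simp
        then show "- (B + B') \<le> h w" using chi B(2)[OF v(1)] by linarith
      qed
    qed
  qed
  from bchoice[OF this] obtain b where b: "\<forall>c\<in>?N. 0 \<le> b c \<and> (\<forall>x\<in>cover.cells (below n). \<forall>g\<in>carrier G.
    \<forall>y\<in>topspace (closed_disk (cdim c)). \<forall>t\<in>{0..1}.
    x = act g (\<Psi> c y) \<longrightarrow> 0 \<le> h x \<longrightarrow> H (t, x) \<in> superlevel G I cdim X act \<Psi> h (- b c))" by blast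
  define d where "d = (\<Sum>c\<in>?N. b c)"
  show ?thesis
  proof (intro exI[of _ d] conjI ballI impI)
    show "0 \<le> d" unfolding d_def using b by (intro sum_nonneg) blast
    fix x t assume x: "x \<in> cover.cells (below n)" "t \<in> {0..1::real}" "0 \<le> h x"
    obtain g c y where gcy: "g \<in> carrier G" "c \<in> I" "cdim c < n" "y \<in> topspace (open_disk (cdim c))"
      "x = act g (\<Psi> c y)" using x(1) by (rule in_cells_below)
    have c: "c \<in> ?N" using gcy by simp
    have y: "y \<in> topspace (closed_disk (cdim c))" using gcy(4) open_disk_subset by blast
    have "b c \<le> d" unfolding d_def using c finite_below[of n] b by (intro member_le_sum) auto
    moreover have "H (t, x) \<in> superlevel G I cdim X act \<Psi> h (- b c)"
      using b[rule_format, OF c] x gcy(1,5) y by blast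
    ultimately show "H (t, x) \<in> superlevel G I cdim X act \<Psi> h (- d)"
      using superlevel_mono[of "- d" "- b c" h] by auto
  qed
qed

text \<open>Here \<open>d\<close> is fixed in advance, while the number of translations is chosen
  for the given sphere. The sphere is deformed into the skeleton without leaving the superlevel set
  at 0, then moved by powers of \<open>z\<close> with a loss of at most \<open>d\<close> on the way,
  and its last translate bounds a translate of a null homotopy in \<open>X\<close>.\<close>

lemma trivial_on_pi_of_central:
  assumes z: "z \<in> carrier G" and H: "\<And>c. c \<in> I \<Longrightarrow> cdim c < n \<Longrightarrow>
      continuous_map (prod_topology unit_interval (closed_disk (cdim c))) X (\<lambda>(t, y). H (t, \<Psi> c y))"
    and ends: "\<And>x. x \<in> cover.cells (below n) \<Longrightarrow> H (0, x) = x \<and> H (1, x) = act z x"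
    and equiv: "\<And>g x t. g \<in> carrier G \<Longrightarrow> x \<in> cover.cells (below n) \<Longrightarrow> t \<in> {0..1} \<Longrightarrow>
      H (t, act g x) = act g (H (t, x))"
    and h: "continuous_map X euclideanreal h"
      "\<And>g x. g \<in> carrier G \<Longrightarrow> x \<in> topspace X \<Longrightarrow> h (act g x) = chi g + h x"
    and pos: "0 < chi z" and d: "0 \<le> d"
    and drop: "\<forall>x\<in>cover.cells (below n). \<forall>t\<in>{0..1}. 0 \<le> h x \<longrightarrow>
      H (t, x) \<in> superlevel G I cdim X act \<Psi> h (- d)"
    and i: "2 ^ Suc i < n"
  shows "trivial_on_pi i X (superlevel G I cdim X act \<Psi> h 0) (superlevel G I cdim X act \<Psi> h (- d))"
  unfolding trivial_on_pi_def
proof (intro allI impI, elim conjE)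
  interpret group G by (rule group_G)
  fix a f
  let ?A = "superlevel G I cdim X act \<Psi> h 0" and ?B = "superlevel G I cdim X act \<Psi> h (- d)"
  let ?S = "topspace (nsphere i)"
  assume "a \<in> ?A" and f: "continuous_map (nsphere i) (subtopology X ?A) f" and fa: "f sphere_base = a"
  have Y0Y: "?A \<subseteq> ?B" using superlevel_mono[of "- d" 0 h] d by simp
  have fX: "continuous_map (nsphere i) X f" and fY0: "f ` ?S \<subseteq> ?A"
    using f by (auto simp: continuous_map_in_subtopology)
  have "compactin X (f ` ?S)"
    using image_compactin[OF _ fX] compact_space_nsphere[of i] by (simp add: compact_space_def)
  then obtain J where J: "finite J" "cover.closed_family J" "f ` ?S \<subseteq> cover.cells J"
    "\<And>S. subcomplex X (carrier G \<times> I) (cover_dim cdim) (cover_char act \<Psi>) S \<Longrightarrow> f ` ?S \<subseteq> S \<Longrightarrow> cover.cells J \<subseteq> S"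
    using cover.compactin_finite_subcomplex by metis
  have JY0: "cover.cells J \<subseteq> ?A" using J(4)[OF subcomplex_superlevel fY0] .
  have fJ: "continuous_map (nsphere i) (subtopology X (cover.cells J)) f"
    using fX J(3) by (intro continuous_map_into_subtopology) auto
  obtain f' where f': "homotopic_with (\<lambda>_. True) (nsphere i) (subtopology X (cover.cells J)) f f'"
    "f' ` ?S \<subseteq> cover.cells {c \<in> J. cover_dim cdim c \<le> 2 ^ Suc i}"
    using cover.cellular_approximation[OF J(1,2) fJ] by blast
  have "{c \<in> J. cover_dim cdim c \<le> 2 ^ Suc i} \<subseteq> below n"
  proof
    fix j assume j: "j \<in> {c \<in> J. cover_dim cdim c \<le> 2 ^ Suc i}"
    obtain g c where gc: "j = (g, c)" by (cases j)
    have "j \<in> carrier G \<times> I" using j J(2) by (auto simp: cover.closed_family_def)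
    moreover have "cdim c < n" using j i by (simp add: gc cover_dim_def)
    ultimately show "j \<in> below n" by (simp add: below_def gc)
  qed
  then have f'n: "f' ` ?S \<subseteq> cover.cells (below n)"
    using f'(2) unfolding cover.cells_def by blast
  have f'J: "continuous_map (nsphere i) (subtopology X (cover.cells J)) f'"
    using homotopic_with_imp_continuous_maps[OF f'(1)] by simp
  then have f'X: "continuous_map (nsphere i) X f'" and f'Y0: "f' ` ?S \<subseteq> ?A"
    using JY0 by (auto simp: continuous_map_in_subtopology)
  have f'in: "f' x \<in> ?A" if "x \<in> ?S" for x
    using f'Y0 that by (simp only: image_subset_iff)
  have f'top: "f' x \<in> topspace X" if "x \<in> ?S" for x
    using superlevel_height[OF f'in[OF that]] by simp
  \<comment> \<open>All these translates lie in the skeleton and, as \<open>chi z\<close> is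
    positive, at nonnegative height. Each passage from \<open>F j\<close> to
    \<open>F (Suc j)\<close> thus meets the hypotheses of \<open>drop\<close> afresh.\<close>
  define F where "F j x = act (z [^]\<^bsub>G\<^esub> (j::nat)) (f' x)" for j x
  have zj: "z [^]\<^bsub>G\<^esub> (j::nat) \<in> carrier G" for j using z by simp
  have hpow: "h (act (z [^]\<^bsub>G\<^esub> (j::nat)) x) = real j * chi z + h x" if "x \<in> topspace X" for j x
    using act_pow[OF z that, of h "chi z"] h(2)[OF z] by simp
  have Fn: "F j x \<in> cover.cells (below n)" if "x \<in> ?S" for j x
    using below_translate[OF zj] f'n that unfolding F_def by blast
  have Fh: "0 \<le> h (F j x)" if "x \<in> ?S" for j x
  proof -
    have "0 \<le> h (f' x)" using superlevel_height[OF f'in[OF that]] by simp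
    then show ?thesis unfolding F_def hpow[OF f'top[OF that]] using pos by simp
  qed
  have FX: "continuous_map (nsphere i) X (F j)" for j
    unfolding F_def[abs_def] using continuous_map_compose[OF f'X act_continuous[OF zj]] by (simp add: o_def)
  have step: "homotopic_with (\<lambda>_. True) (nsphere i) (subtopology X ?B) (F j) (F (Suc j))" for j
  proof -
    have "compactin X (F j ` ?S)"
      using image_compactin[OF _ FX] compact_space_nsphere[of i] by (simp add: compact_space_def)
    then have fin: "finite {c \<in> carrier G \<times> I. cover.ocell c \<inter> F j ` ?S \<noteq> {}}"
      by (rule cover.compactin_finite_cells)
    let ?J = "{c \<in> below n. cover.ocell c \<inter> F j ` ?S \<noteq> {}}"
    have "?J \<subseteq> {c \<in> carrier G \<times> I. cover.ocell c \<inter> F j ` ?S \<noteq> {}}" using below_subset by auto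
    then have "finite ?J" using fin by (rule finite_subset)
    moreover have "F j ` ?S \<subseteq> cover.cells ?J"
    proof
      fix x assume x: "x \<in> F j ` ?S"
      then have "x \<in> cover.cells (below n)" using Fn by blast
      then obtain c where "c \<in> below n" "x \<in> cover.ocell c" by (rule cover.in_cellsE)
      then show "x \<in> cover.cells ?J" using x by (intro cover.in_cellsI[of c]) auto
    qed
    ultimately have cH: "continuous_map (prod_topology unit_interval (subtopology X (F j ` ?S))) X H"
      by (intro lower_cells_cellwise[OF H equiv]) auto
    have "continuous_map (nsphere i) (subtopology X (F j ` ?S)) (F j)"
      using FX by (intro continuous_map_into_subtopology) auto
    then have "continuous_map (prod_topology unit_interval (nsphere i))
        (prod_topology unit_interval (subtopology X (F j ` ?S))) (\<lambda>(t, x). (t, F j x))"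
      by (simp add: continuous_map_prod_top)
    from continuous_map_compose[OF this cH]
    have "continuous_map (prod_topology unit_interval (nsphere i)) X (\<lambda>z. H (fst z, F j (snd z)))"
      by (simp add: o_def case_prod_unfold)
    then have "continuous_map (prod_topology unit_interval (nsphere i)) (subtopology X ?B) (\<lambda>z. H (fst z, F j (snd z)))"
      using drop Fn Fh by (intro continuous_map_into_subtopology) auto
    then have "homotopic_with (\<lambda>_. True) (nsphere i) (subtopology X ?B) (\<lambda>x. H (0, F j x)) (\<lambda>x. H (1, F j x))"
      unfolding homotopic_with_def by (intro exI[of _ "\<lambda>z. H (fst z, F j (snd z))"]) auto
    then show ?thesis
    proof (rule homotopic_with_eq)
      fix x assume x: "x \<in> ?S"
      show "F j x = H (0, F j x)" using ends[OF Fn[OF x]] by simp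
      have "F (Suc j) x = act z (F j x)"
        unfolding F_def nat_pow_Suc2[OF z] by (rule composition_rule[OF f'top[OF x] z zj])
      then show "F (Suc j) x = H (1, F j x)" using ends[OF Fn[OF x]] by simp
    qed simp
  qed
  have f'F: "homotopic_with (\<lambda>_. True) (nsphere i) (subtopology X ?B) f' (F j)" for j
  proof (induction j)
    case 0
    have "continuous_map (nsphere i) (subtopology X ?B) f'"
      using f'X f'Y0 Y0Y by (intro continuous_map_into_subtopology) auto
    moreover have "f' x = F 0 x" if "x \<in> ?S" for x
      using act_one[OF f'top[OF that]] by (simp add: F_def)
    ultimately show ?case by (intro homotopic_with_equal) auto
  next
    case (Suc j)
    then show ?case using step homotopic_with_trans by blast
  qed
  \<comment> \<open>Contractibility of \<open>X\<close> gives a null homotopy of the sphere, with no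
    control on how deep it goes.\<close>
  obtain c K where K: "continuous_map (prod_topology unit_interval (nsphere i)) X K"
    "\<And>x. K (0, x) = f' x" "\<And>x. K (1, x) = c"
    using nullhomotopic_into_contractible_space[OF f'X contractible] unfolding homotopic_with_def by metis
  let ?P = "prod_topology unit_interval (nsphere i)"
  have "compact_space ?P"
    by (simp add: compact_space_prod_topology compact_space_nsphere compact_space_subtopology)
  then have "compactin X (K ` topspace ?P)"
    using image_compactin[OF _ K(1)] unfolding compact_space_def by blast
  then obtain L where L: "finite L" "cover.closed_family L" "K ` topspace ?P \<subseteq> cover.cells L"
    using cover.compactin_finite_subcomplex by metis
  obtain B where B: "0 \<le> B" "\<And>x. x \<in> cover.cells L \<Longrightarrow> \<bar>h x\<bar> \<le> B"
    using compact_height_bounded[OF h(1) cover.compactin_cells[OF L(1,2)]] by blast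
  \<comment> \<open>Heights on the hull \<open>L\<close> of the null homotopy are at least
    \<open>- B\<close>, so this power of \<open>z\<close> lifts all of \<open>L\<close> to
    nonnegative height.\<close>
  obtain j :: nat where j: "B / chi z < real j" using reals_Archimedean2 by blast
  then have jB: "B \<le> real j * chi z" using pos by (simp add: divide_less_eq)
  have LI: "L \<subseteq> carrier G \<times> I" using L(2) by (simp add: cover.closed_family_def)
  have KY0: "act (z [^]\<^bsub>G\<^esub> j) x \<in> ?A" if "x \<in> cover.cells L" for x
  proof (rule superlevelI[OF closed_family_translate[OF zj L(2), of j]])
    show "act (z [^]\<^bsub>G\<^esub> j) x \<in> cover.cells (translate (z [^]\<^bsub>G\<^esub> j) L)"
      unfolding cells_translate[OF zj LI] using that by blast
    fix w assume "w \<in> cover.cells (translate (z [^]\<^bsub>G\<^esub> j) L)"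
    then obtain v where v: "v \<in> cover.cells L" "w = act (z [^]\<^bsub>G\<^esub> j) v"
      unfolding cells_translate[OF zj LI] by blast
    have "v \<in> topspace X" using v(1) cover.cells_subset_topspace[OF LI] by blast
    then have "h w = real j * chi z + h v" using hpow v(2) by simp
    then show "0 \<le> h w" using jB B(2)[OF v(1)] by linarith
  qed
  have "continuous_map ?P X (\<lambda>p. act (z [^]\<^bsub>G\<^esub> j) (K p))"
    using continuous_map_compose[OF K(1) act_continuous[OF zj]] by (simp add: o_def)
  then have "continuous_map ?P (subtopology X ?B) (\<lambda>p. act (z [^]\<^bsub>G\<^esub> j) (K p))"
    using KY0 L(3) Y0Y by (intro continuous_map_into_subtopology) blast+
  then have Fc: "homotopic_with (\<lambda>_. True) (nsphere i) (subtopology X ?B) (F j) (\<lambda>_. act (z [^]\<^bsub>G\<^esub> j) c)"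
    unfolding homotopic_with_def
    by (intro exI[of _ "\<lambda>p. act (z [^]\<^bsub>G\<^esub> j) (K p)"]) (simp add: K F_def)
  have "cover.cells J \<subseteq> ?B" using JY0 Y0Y by blast
  from homotopic_with_subtopology_mono[OF f'(1) this]
  have "homotopic_with (\<lambda>_. True) (nsphere i) (subtopology X ?B) f (\<lambda>_. act (z [^]\<^bsub>G\<^esub> j) c)"
    using f'F[of j] Fc homotopic_with_trans by metis
  from nullhomotopic_sphere_based[OF this fa]
  show "homotopic_with (\<lambda>f'. f' sphere_base = a) (nsphere i) (subtopology X ?B) f (\<lambda>_. a)" .
qed

theorem essentially_connected_of_central:
  assumes z: "z \<in> carrier G" and central: "\<forall>g\<in>carrier G. z \<otimes>\<^bsub>G\<^esub> g = g \<otimes>\<^bsub>G\<^esub> z"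
    and height: "height_function G I cdim X act \<Psi> chi h" and pos: "0 < chi z"
  shows "essentially_connected k G I cdim X act \<Psi> h"
proof -
  have h: "continuous_map X euclideanreal h"
      "\<And>g x. g \<in> carrier G \<Longrightarrow> x \<in> topspace X \<Longrightarrow> h (act g x) = chi g + h x"
    using height by (auto simp: height_function_def)
  \<comment> \<open>Exceeds \<open>2 ^ Suc i\<close> for all \<open>i < k\<close>, so one skeleton,
    one homotopy and one \<open>d\<close> serve all degrees at once.\<close>
  let ?n = "Suc (2 ^ k)"
  from central_homotopy[OF z central, of ?n] obtain H where HH:
    "\<forall>c\<in>I. cdim c < ?n \<longrightarrow>
      continuous_map (prod_topology unit_interval (closed_disk (cdim c))) X (\<lambda>(t, y). H (t, \<Psi> c y))"
    "\<forall>x\<in>cover.cells (below ?n). H (0, x) = x \<and> H (1, x) = act z x"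
    "\<forall>g\<in>carrier G. \<forall>x\<in>cover.cells (below ?n). \<forall>t\<in>{0..1}. H (t, act g x) = act g (H (t, x))"
    by (elim exE conjE)
  have H: "\<And>c. c \<in> I \<Longrightarrow> cdim c < ?n \<Longrightarrow>
      continuous_map (prod_topology unit_interval (closed_disk (cdim c))) X (\<lambda>(t, y). H (t, \<Psi> c y))"
    "\<And>x. x \<in> cover.cells (below ?n) \<Longrightarrow> H (0, x) = x \<and> H (1, x) = act z x"
    "\<And>g x t. g \<in> carrier G \<Longrightarrow> x \<in> cover.cells (below ?n) \<Longrightarrow> t \<in> {0..1} \<Longrightarrow> H (t, act g x) = act g (H (t, x))"
    using HH by blast+
  have "\<exists>d\<ge>0. \<forall>x\<in>cover.cells (below ?n). \<forall>t\<in>{0..1}. 0 \<le> h x \<longrightarrow>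
      H (t, x) \<in> superlevel G I cdim X act \<Psi> h (- d)"
    by (rule homotopy_height_drop[where chi = chi]; fact H h)
  then obtain d where d: "0 \<le> d" "\<forall>x\<in>cover.cells (below ?n). \<forall>t\<in>{0..1}. 0 \<le> h x \<longrightarrow>
    H (t, x) \<in> superlevel G I cdim X act \<Psi> h (- d)"
    by (elim exE conjE)
  have "trivial_on_pi i X (superlevel G I cdim X act \<Psi> h 0) (superlevel G I cdim X act \<Psi> h (- d))"
    if "i < k" for i
  proof -
    have "(2::nat) ^ Suc i \<le> 2 ^ k" using that by (intro power_increasing) auto
    then have n: "2 ^ Suc i < ?n" by simp
    show ?thesis
      by (rule trivial_on_pi_of_central[where n = ?n and H = H and chi = chi and z = z]; fact z H h pos d n)
  qed
  then show ?thesis unfolding essentially_connected_def using d(1) by blast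
qed

end

section \<open>Locally constant labels of a complex\<close>

text \<open>Two contractible hemispheres with a common point on the equator, which is nonempty from
  dimension 1 on.\<close>

lemma connected_space_nsphere:
  assumes "1 \<le> n" shows "connected_space (nsphere n)"
proof -
  let ?U = "{x \<in> topspace (nsphere n). 0 \<le> x 0}" and ?L = "{x \<in> topspace (nsphere n). x 0 \<le> 0}"
  have "connected_space (subtopology (nsphere n) {x. x 0 \<ge> 0})"
    using contractible_space_upper_hemisphere[of 0 n] by (simp add: contractible_imp_connected_space)
  moreover have "?U = topspace (nsphere n) \<inter> {x. x 0 \<ge> 0}" by auto
  then have "subtopology (nsphere n) {x. x 0 \<ge> 0} = subtopology (nsphere n) ?U"
    by (simp only: subtopology_restrict)
  ultimately have U: "connectedin (nsphere n) ?U" by (auto simp: connectedin_def)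
  have "connected_space (subtopology (nsphere n) {x. x 0 \<le> 0})"
    using contractible_space_lower_hemisphere[of 0 n] by (simp add: contractible_imp_connected_space)
  moreover have "?L = topspace (nsphere n) \<inter> {x. x 0 \<le> 0}" by auto
  then have "subtopology (nsphere n) {x. x 0 \<le> 0} = subtopology (nsphere n) ?L"
    by (simp only: subtopology_restrict)
  ultimately have L: "connectedin (nsphere n) ?L" by (auto simp: connectedin_def)
  have "(\<lambda>i. if i = 1 then 1 else 0) \<in> topspace (nsphere n)"
    using assms by (simp add: topspace_nsphere disk_boundary_eq L2_set_def if_distrib[of "\<lambda>x. x\<^sup>2"] cong: if_cong)
  then have "?U \<inter> ?L \<noteq> {}" by auto
  with U L have "connectedin (nsphere n) (?U \<union> ?L)" by (rule connectedin_Un)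
  moreover have "?U \<union> ?L = topspace (nsphere n)" by auto
  ultimately show ?thesis by (simp add: connectedin_topspace)
qed

lemma nsphere_eq_disk_boundary:
  assumes "0 < n" shows "nsphere (n - 1) = subtopology (closed_disk n) (disk_boundary n)"
proof -
  have "disk_boundary n \<subseteq> {x. (\<forall>i\<ge>n. x i = 0) \<and> L2_set x {..<n} \<le> 1}"
    by (auto simp: disk_boundary_eq)
  moreover have "topspace (nsphere (n - 1)) = disk_boundary n"
    using topspace_nsphere[of "n - 1"] assms by simp
  ultimately show ?thesis
    unfolding closed_disk_eq by (subst top_of_set_nsphere) (simp add: subtopology_subtopology Int_absorb1)
qed

context CW_complex
begin

text \<open>The points of \<open>Z\<close> whose label has a given property form a finite union of
  preimages of closed cells. So a label class and its complement are both closed. This is applied to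
  boundary spheres and to paths.\<close>

lemma label_constant:
  assumes Z: "connected_space Z" and q: "continuous_map Z X q" and K: "finite K" "K \<subseteq> I"
    and qK: "\<And>z. z \<in> topspace Z \<Longrightarrow> \<exists>k\<in>K. q z \<in> ccell k"
    and F: "\<And>k x y. k \<in> K \<Longrightarrow> x \<in> ccell k \<Longrightarrow> y \<in> ccell k \<Longrightarrow> F x = F y"
    and xy: "x \<in> topspace Z" "y \<in> topspace Z"
  shows "F (q x) = F (q y)"
proof (rule ccontr)
  assume neq: "F (q x) \<noteq> F (q y)"
  have closed: "closedin Z {z \<in> topspace Z. P (F (q z))}" for P
  proof -
    let ?K = "{k \<in> K. \<exists>w\<in>ccell k. P (F w)}"
    have "{z \<in> topspace Z. P (F (q z))} = (\<Union>k\<in>?K. {z \<in> topspace Z. q z \<in> ccell k})"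
    proof (intro equalityI subsetI)
      fix z assume z: "z \<in> {z \<in> topspace Z. P (F (q z))}"
      then obtain k where "k \<in> K" "q z \<in> ccell k" using qK by blast
      then show "z \<in> (\<Union>k\<in>?K. {z \<in> topspace Z. q z \<in> ccell k})" using z by auto
    next
      fix z assume "z \<in> (\<Union>k\<in>?K. {z \<in> topspace Z. q z \<in> ccell k})"
      then obtain k w where k: "k \<in> K" "w \<in> ccell k" "P (F w)" "z \<in> topspace Z" "q z \<in> ccell k" by auto
      then have "F (q z) = F w" using F by blast
      then show "z \<in> {z \<in> topspace Z. P (F (q z))}" using k by simp
    qed
    moreover have "closedin Z (\<Union>k\<in>?K. {z \<in> topspace Z. q z \<in> ccell k})"
      using K closedin_continuous_map_preimage[OF q closedin_ccell] by (intro closedin_Union) auto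
    ultimately show ?thesis by simp
  qed
  let ?A = "{z \<in> topspace Z. F (q z) = F (q x)}" and ?B = "{z \<in> topspace Z. F (q z) \<noteq> F (q x)}"
  have "closedin Z ?A" "closedin Z ?B" by (rule closed)+
  moreover have "topspace Z \<subseteq> ?A \<union> ?B" "?A \<inter> ?B = {}" "?A \<noteq> {}" "?B \<noteq> {}"
    using xy neq by auto
  ultimately show False using Z unfolding connected_space_closedin by blast
qed

text \<open>The label of a cell of dimension at least \<open>2\<close> is forced, because its boundary sphere is
  connected.\<close>

lemma label_extension:
  assumes J: "closed_family J"
    and vertex: "\<And>j x y. j \<in> J \<Longrightarrow> cdim j = 0 \<Longrightarrow> x \<in> ccell j \<Longrightarrow> y \<in> ccell j \<Longrightarrow> F0 x = F0 y"
    and edge: "\<And>j x y. j \<in> J \<Longrightarrow> cdim j = 1 \<Longrightarrow> x \<in> \<Phi> j ` disk_boundary 1 \<Longrightarrow>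
      y \<in> \<Phi> j ` disk_boundary 1 \<Longrightarrow> F0 x = F0 y"
  shows "\<exists>F. (\<forall>x\<in>cells {j \<in> J. cdim j < 1}. F x = F0 x) \<and>
    (\<forall>j\<in>J. cdim j < Suc n \<longrightarrow> (\<forall>x\<in>ccell j. \<forall>y\<in>ccell j. F x = F y))"
proof (induction n)
  case 0
  show ?case
  proof (intro exI[of _ F0] conjI ballI impI)
    fix j x y assume "j \<in> J" "cdim j < Suc 0" "x \<in> ccell j" "y \<in> ccell j"
    then show "F0 x = F0 y" using vertex[of j x y] by simp
  qed simp
next
  case (Suc n)
  let ?n = "Suc n"
  from Suc obtain F where HF: "\<forall>x\<in>cells {j \<in> J. cdim j < 1}. F x = F0 x"
    "\<forall>j\<in>J. cdim j < ?n \<longrightarrow> (\<forall>x\<in>ccell j. \<forall>y\<in>ccell j. F x = F y)"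
    by (elim exE conjE)
  have F: "\<And>x. x \<in> cells {j \<in> J. cdim j < 1} \<Longrightarrow> F x = F0 x"
    "\<And>j x y. j \<in> J \<Longrightarrow> cdim j < ?n \<Longrightarrow> x \<in> ccell j \<Longrightarrow> y \<in> ccell j \<Longrightarrow> F x = F y"
    using HF by blast+
  have JI: "J \<subseteq> I" using J by (simp add: closed_family_def)
  let ?low = "cells {j \<in> J. cdim j < ?n}"
  \<comment> \<open>A fixed point of the boundary sphere; the label of a new cell is read off at its
    image.\<close>
  define b where "b = (\<lambda>i::nat. if i = 0 then 1 else 0 :: real)"
  have bb: "b \<in> disk_boundary ?n" using in_topspace_nsphere[of n] unfolding b_def topspace_nsphere .
  have bd: "F x = F y" if j: "j \<in> J" "cdim j = ?n" and x: "x \<in> \<Phi> j ` disk_boundary ?n"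
    and y: "y \<in> \<Phi> j ` disk_boundary ?n" for j x y
  \<comment> \<open>The boundary of an edge consists of two points and is disconnected, so here the
    hypothesis \<open>edge\<close> takes the place of connectedness.\<close>
  proof (cases "n = 0")
    case True
    have "\<Phi> j ` disk_boundary ?n \<subseteq> cells {j \<in> J. cdim j < 1}"
      using boundary_subset_lower[OF J j(1)] j(2) True by simp
    then have "x \<in> cells {j \<in> J. cdim j < 1}" "y \<in> cells {j \<in> J. cdim j < 1}" using x y by blast+
    then show ?thesis using F(1) edge[OF j(1), of x y] j(2) x y True by simp
  next
    case False
    let ?Z = "subtopology (closed_disk ?n) (disk_boundary ?n)"
    have jI: "j \<in> I" using j JI by blast
    have Z: "connected_space ?Z"
      using connected_space_nsphere[of n] nsphere_eq_disk_boundary[of ?n] False by simp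
    have topZ: "topspace ?Z = disk_boundary ?n"
      by (auto simp: disk_boundary_eq topspace_closed_disk)
    have q: "continuous_map ?Z X (\<Phi> j)"
      using continuous_char[OF jI] j(2) by (intro continuous_map_from_subtopology) simp
    obtain K0 where K0: "K0 \<subseteq> I" "finite K0" "ccell j \<subseteq> cells K0"
      "\<And>k. k \<in> K0 \<Longrightarrow> k \<noteq> j \<Longrightarrow> cdim k < cdim j" "\<Phi> j ` disk_boundary (cdim j) \<subseteq> cells (K0 - {j})"
      "cells K0 \<subseteq> cells J"
      using subcomplex_closure_finite[OF subcomplex_cells[OF J] jI] J j(1) unfolding closed_family_def by metis
    have K0J: "K0 \<subseteq> J"
    proof
      fix k assume k: "k \<in> K0"
      obtain w where w: "w \<in> ocell k" using ocell_nonempty by auto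
      then have "w \<in> cells J" using k K0(6) in_cellsI by blast
      then show "k \<in> J" using ocell_in_cells_iff[OF JI, of k w] k K0(1) w by auto
    qed
    obtain x' y' where xy': "x' \<in> disk_boundary ?n" "x = \<Phi> j x'" "y' \<in> disk_boundary ?n" "y = \<Phi> j y'"
      using x y by auto
    have "F (\<Phi> j x') = F (\<Phi> j y')"
    proof (rule label_constant[OF Z q, where K = "K0 - {j}"])
      show "finite (K0 - {j})" "K0 - {j} \<subseteq> I" using K0 by auto
      show "\<exists>k\<in>K0 - {j}. \<Phi> j z \<in> ccell k" if "z \<in> topspace ?Z" for z
      proof -
        have "\<Phi> j z \<in> cells (K0 - {j})" using K0(5) that j(2) topZ by auto
        then obtain k where "k \<in> K0 - {j}" "\<Phi> j z \<in> ocell k" by (rule in_cellsE)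
        then show ?thesis using ocell_subset_ccell[of k] by blast
      qed
      show "F u = F w" if k: "k \<in> K0 - {j}" and "u \<in> ccell k" "w \<in> ccell k" for k u w
      proof (rule F(2)[OF _ _ that(2,3)])
        show "k \<in> J" using k K0J by blast
        show "cdim k < ?n" using K0(4)[of k] k j(2) by simp
      qed
      show "x' \<in> topspace ?Z" "y' \<in> topspace ?Z" using xy' topZ by auto
    qed
    then show ?thesis using xy' by simp
  qed
  define F' where "F' x = (if x \<in> ?low then F x else F (\<Phi> (SOME j. j \<in> J \<and> x \<in> ocell j) b))" for x
  have low_cell: "x \<in> ?low" if "j \<in> J" "cdim j < ?n" "x \<in> ccell j" for j x
  proof -
    have "{j \<in> J. cdim j < ?n} = {j \<in> J. cdim j \<le> n}" by auto
    then have "closed_family {j \<in> J. cdim j < ?n}" using subcomplex_skeleton_part[OF J, of n] by simp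
    moreover have "j \<in> {j \<in> J. cdim j < ?n}" using that by simp
    ultimately show ?thesis using that(3) unfolding closed_family_def by blast
  qed
  have top: "F' x = F (\<Phi> j b)" if j: "j \<in> J" "cdim j = ?n" and x: "x \<in> ccell j" for j x
  proof (cases "x \<in> ocell j")
    case True
    then have "x \<notin> ?low" using ocell_in_cells_iff[of "{j \<in> J. cdim j < ?n}" j x] j JI by auto
    moreover have "(SOME j. j \<in> J \<and> x \<in> ocell j) = j"
    proof (rule some_equality)
      show "j \<in> J \<and> x \<in> ocell j" using j True by simp
      fix i assume "i \<in> J \<and> x \<in> ocell i"
      then show "i = j" using ocell_disjoint[of i j x] True j JI by blast
    qed
    ultimately show ?thesis by (simp add: F'_def)
  next
    case False
    then have xb: "x \<in> \<Phi> j ` disk_boundary ?n" using x j(2) unfolding ccell_eq by simp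
    have "x \<in> ?low" using xb boundary_subset_lower[OF J j(1)] j(2) by auto
    then have "F' x = F x" by (simp add: F'_def)
    also have "F x = F (\<Phi> j b)" using bd[OF j xb] bb by blast
    finally show ?thesis .
  qed
  show ?case
  proof (intro exI[of _ F'] conjI ballI impI)
    fix x assume x: "x \<in> cells {j \<in> J. cdim j < 1}"
    then obtain j where "j \<in> {j \<in> J. cdim j < 1}" "x \<in> ocell j" by (rule in_cellsE)
    then have "x \<in> ?low" by (intro in_cellsI[of j]) auto
    then show "F' x = F0 x" using F(1)[OF x] by (simp add: F'_def)
  next
    fix j x y assume *: "j \<in> J" "cdim j < Suc ?n" "x \<in> ccell j" "y \<in> ccell j"
    show "F' x = F' y"
    proof (cases "cdim j < ?n")
      case True
      then show ?thesis using F(2)[OF *(1) True *(3,4)] low_cell[OF *(1) True] *(3,4) by (simp add: F'_def)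
    next
      case False
      then have "cdim j = ?n" using *(2) by simp
      then show ?thesis using top[OF *(1)] *(3,4) by simp
    qed
  qed
qed

end

lemma finite_disk_boundary_1: "finite (disk_boundary 1)"
proof -
  have "disk_boundary 1 \<subseteq> {\<lambda>i. if i = 0 then 1 else 0, \<lambda>i. if i = 0 then - 1 else 0}"
  proof
    fix x assume "x \<in> disk_boundary 1"
    then have x: "\<And>i. i \<ge> 1 \<Longrightarrow> x i = 0" "\<bar>x 0\<bar> = 1" by (auto simp: disk_boundary_eq L2_set_def)
    then have "x 0 = 1 \<or> x 0 = - 1" by linarith
    moreover have "x i = (if i = 0 then x 0 else 0)" for i using x(1)[of i] by (cases "i = 0") auto
    ultimately have "x = (\<lambda>i. if i = 0 then 1 else 0) \<or> x = (\<lambda>i. if i = 0 then - 1 else 0)"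
      unfolding fun_eq_iff by metis
    then show "x \<in> {\<lambda>i. if i = 0 then 1 else 0, \<lambda>i. if i = 0 then - 1 else 0}" by blast
  qed
  then show ?thesis by (rule finite_subset) simp
qed

lemma closed_disk_0: "topspace (closed_disk 0) = {\<lambda>_. 0}" "topspace (open_disk 0) = {\<lambda>_. 0}"
  by (auto simp: topspace_closed_disk topspace_open_disk)

lemma continuous_map_nsphere_0:
  assumes "a \<in> topspace T" "b \<in> topspace T"
  shows "continuous_map (nsphere 0) T (\<lambda>x. if 0 < x 0 then a else b)"
proof (rule continuous_map_finite_closed_cover[where J = "{True, False}"
      and C = "\<lambda>i. if i then {x \<in> topspace (nsphere 0). x 0 \<in> {0..}} else {x \<in> topspace (nsphere 0). x 0 \<in> {..0}}"])
  have c: "continuous_map (nsphere 0) euclideanreal (\<lambda>x. x 0)" by (rule continuous_map_nsphere_projection)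
  show "closedin (nsphere 0) (if i then {x \<in> topspace (nsphere 0). x 0 \<in> {0..}} else {x \<in> topspace (nsphere 0). x 0 \<in> {..0}})"
    for i using closedin_continuous_map_preimage[OF c, of "{0..}"] closedin_continuous_map_preimage[OF c, of "{..0}"]
    by (cases i) auto
  show "topspace (nsphere 0) \<subseteq> (\<Union>i\<in>{True, False}. if i then {x \<in> topspace (nsphere 0). x 0 \<in> {0..}}
    else {x \<in> topspace (nsphere 0). x 0 \<in> {..0}})" by auto
  have nz: "x 0 \<noteq> 0" if "x \<in> topspace (nsphere 0)" for x
    using that by (auto simp: topspace_nsphere disk_boundary_eq L2_set_def)
  fix i :: bool
  let ?S = "subtopology (nsphere 0) (if i then {x \<in> topspace (nsphere 0). x 0 \<in> {0..}} else {x \<in> topspace (nsphere 0). x 0 \<in> {..0}})"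
  have "continuous_map ?S T (\<lambda>x. if i then a else b)" using assms by simp
  then show "continuous_map ?S T (\<lambda>x. if 0 < x 0 then a else b)"
    by (rule continuous_map_eq) (use nz in \<open>auto split: if_splits simp: order_less_le\<close>)
qed simp

section \<open>From path components of superlevel sets to labels on the group\<close>

context finite_type_K_G_1
begin

text \<open>The pairs in \<open>T\<close> span a Cayley-type graph on \<open>G\<close>, with edges
  from \<open>g \<otimes> a\<close> to \<open>g \<otimes> b\<close>. The conclusion says that
  elements of nonnegative height are connected in its part above \<open>- d\<close>; quantifying
  over two-valued labels expresses this without edge paths. A label of the vertices is extended over
  the cells of the superlevel set and compared at the ends of a topological path.\<close>

lemma essentially_connected_1_edge_labels:
  assumes height: "height_function G I cdim X act \<Psi> chi h"
    and ess: "essentially_connected 1 G I cdim X act \<Psi> h"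
  shows "\<exists>d T. finite T \<and> T \<subseteq> carrier G \<times> carrier G \<and> (\<forall>\<phi> :: 'g \<Rightarrow> bool.
    (\<forall>g\<in>carrier G. \<forall>(a, b)\<in>T. - d \<le> chi (g \<otimes>\<^bsub>G\<^esub> a) \<longrightarrow> - d \<le> chi (g \<otimes>\<^bsub>G\<^esub> b) \<longrightarrow>
      \<phi> (g \<otimes>\<^bsub>G\<^esub> a) = \<phi> (g \<otimes>\<^bsub>G\<^esub> b)) \<longrightarrow>
    (\<forall>g\<in>carrier G. \<forall>g'\<in>carrier G. 0 \<le> chi g \<longrightarrow> 0 \<le> chi g' \<longrightarrow> \<phi> g = \<phi> g'))"
proof -
  interpret group G by (rule group_G)
  have h: "\<And>g x. g \<in> carrier G \<Longrightarrow> x \<in> topspace X \<Longrightarrow> h (act g x) = chi g + h x"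
    "\<And>g c. g \<in> carrier G \<Longrightarrow> c \<in> I \<Longrightarrow> cdim c = 0 \<Longrightarrow> h (act g (\<Psi> c (\<lambda>_. 0))) = chi g"
    using height unfolding height_function_def by blast+
  obtain c0 where c0: "c0 \<in> I" "cdim c0 = 0" "\<And>c. c \<in> I \<Longrightarrow> cdim c = 0 \<Longrightarrow> c = c0"
    using single_vertex by auto
  define v where "v = \<Psi> c0 (\<lambda>_. 0)"
  have vX: "v \<in> topspace X"
    unfolding v_def by (rule lift_in[OF c0(1)]) (simp add: c0(2) closed_disk_0)
  have hv: "h (act g v) = chi g" if "g \<in> carrier G" for g
    using h(2)[OF that c0(1,2)] by (simp add: v_def)
  have vertex_cell: "cover.ccell (g, c0) = {act g v}" "cover.ocell (g, c0) = {act g v}" for g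
    unfolding cover_ccell cover_ocell by (simp_all add: c0(2) closed_disk_0 v_def)
  \<comment> \<open>Recovers the group element from a vertex; the action is free, so there is only
    one candidate.\<close>
  define idx where "idx x = (SOME g. g \<in> carrier G \<and> x = act g v)" for x
  have idx: "idx (act g v) = g" if g: "g \<in> carrier G" for g
    unfolding idx_def
  proof (rule some_equality)
    show "g \<in> carrier G \<and> act g v = act g v" using g by simp
    fix g' assume g': "g' \<in> carrier G \<and> act g v = act g' v"
    have "act (inv\<^bsub>G\<^esub> g \<otimes>\<^bsub>G\<^esub> g') v = act (inv\<^bsub>G\<^esub> g) (act g v)"
      using composition_rule[OF vX inv_closed[OF g]] g' by simp
    also have "\<dots> = v" using composition_rule[OF vX inv_closed[OF g] g] g act_one[OF vX] by simp
    finally have "inv\<^bsub>G\<^esub> g \<otimes>\<^bsub>G\<^esub> g' = \<one>\<^bsub>G\<^esub>" using act_free[of "inv\<^bsub>G\<^esub> g \<otimes>\<^bsub>G\<^esub> g'" v] g g' vX by simp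
    then show "g' = g" using g g' by (metis inv_equality inv_inv inv_closed)
  qed
  have vertices: "\<exists>g\<in>carrier G. x = act g v" if x: "x \<in> cover.cells (below 1)" for x
  proof -
    obtain g c y where gcy: "g \<in> carrier G" "c \<in> I" "cdim c < 1" "y \<in> topspace (open_disk (cdim c))"
      "x = act g (\<Psi> c y)" using x by (rule in_cells_below)
    then have "c = c0" using c0(3) by simp
    then have "y = (\<lambda>_. 0)" using gcy(4) c0(2) closed_disk_0 by simp
    then show ?thesis using gcy \<open>c = c0\<close> by (auto simp: v_def)
  qed
  define E1 where "E1 = {c \<in> I. cdim c = 1}"
  \<comment> \<open>All ordered pairs of ends of the chosen lifts of the edges of \<open>K\<close>.
    There are finitely many such edges, and every edge of \<open>X\<close> is a translate of one of
    these lifts.\<close>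
  define T where "T = (\<Union>c\<in>E1. (\<lambda>(y, y'). (idx (\<Psi> c y), idx (\<Psi> c y'))) ` (disk_boundary 1 \<times> disk_boundary 1))"
  have finT: "finite T"
    unfolding T_def E1_def using finitely_many_cells[of 1] finite_disk_boundary_1 by simp
  have endpoint: "idx (\<Psi> c y) \<in> carrier G \<and> \<Psi> c y = act (idx (\<Psi> c y)) v"
    if c: "c \<in> E1" and y: "y \<in> disk_boundary 1" for c y
  proof -
    have cI: "c \<in> I" "cdim c = 1" using c by (auto simp: E1_def)
    have "y \<in> topspace (closed_disk 1)" using y by (auto simp: disk_boundary_eq topspace_closed_disk)
    then have "\<Psi> c y \<in> cover.cells (below 1)"
      using lift_boundary_below[OF one_closed cI(1), of y] act_one[OF lift_in[OF cI(1), of y]] cI(2) y by simp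
    then obtain g where "g \<in> carrier G" "\<Psi> c y = act g v" using vertices by blast
    then show ?thesis using idx by simp
  qed
  have TG: "T \<subseteq> carrier G \<times> carrier G" unfolding T_def using endpoint by auto
  obtain d where d: "0 \<le> d" "\<And>i. i < 1 \<Longrightarrow> trivial_on_pi i X
      (superlevel G I cdim X act \<Psi> h 0) (superlevel G I cdim X act \<Psi> h (- d))"
    using ess unfolding essentially_connected_def by blast
  let ?A = "superlevel G I cdim X act \<Psi> h 0" and ?B = "superlevel G I cdim X act \<Psi> h (- d)"
  have vertexA: "act g v \<in> ?A" if g: "g \<in> carrier G" "0 \<le> chi g" for g
  proof (rule superlevelI[where J = "{(g, c0)}"])
    have eq: "cover.cells {(g, c0)} = {act g v}" by (simp add: cover.cells_def vertex_cell)
    show "cover.closed_family {(g, c0)}" unfolding cover.closed_family_def eq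
      using g(1) c0(1) vertex_cell by simp
    show "act g v \<in> cover.cells {(g, c0)}" unfolding eq by simp
    show "0 \<le> h y" if "y \<in> cover.cells {(g, c0)}" for y using that hv g unfolding eq by simp
  qed
  show ?thesis
  proof (intro exI[of _ d] exI[of _ T] conjI allI impI ballI finT TG)
    fix \<phi> :: "'g \<Rightarrow> bool" and g g'
    assume \<phi>: "\<forall>g\<in>carrier G. \<forall>(a, b)\<in>T. - d \<le> chi (g \<otimes>\<^bsub>G\<^esub> a) \<longrightarrow> - d \<le> chi (g \<otimes>\<^bsub>G\<^esub> b) \<longrightarrow> \<phi> (g \<otimes>\<^bsub>G\<^esub> a) = \<phi> (g \<otimes>\<^bsub>G\<^esub> b)"
      and g: "g \<in> carrier G" and g': "g' \<in> carrier G" and pos: "0 \<le> chi g" "0 \<le> chi g'"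
    define F0 where "F0 x = \<phi> (idx x)" for x
    let ?J = "{j \<in> carrier G \<times> I. cover.ocell j \<inter> ?B \<noteq> {}}"
    have J: "cover.closed_family ?J" "?B = cover.cells ?J"
      using cover.subcomplex_eq_cells[OF subcomplex_superlevel] by blast+
    have ccellJ: "cover.ccell j \<subseteq> ?B" if "j \<in> ?J" for j
      using J(1) that unfolding J(2)[symmetric] cover.closed_family_def by blast
    \<comment> \<open>An edge of the superlevel set lies in it with both ends, so these have height
      at least \<open>- d\<close>, as the hypothesis on \<open>\<phi>\<close> requires.\<close>
    have edge_end: "\<exists>a\<in>idx ` \<Psi> c ` disk_boundary 1. k \<otimes>\<^bsub>G\<^esub> a \<in> carrier G \<and> x = act (k \<otimes>\<^bsub>G\<^esub> a) v \<and> - d \<le> chi (k \<otimes>\<^bsub>G\<^esub> a)"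
      if j: "(k, c) \<in> ?J" and c: "c \<in> E1" and x: "x \<in> cover_char act \<Psi> (k, c) ` disk_boundary 1" for k c x
    proof -
      obtain y where y: "y \<in> disk_boundary 1" "x = act k (\<Psi> c y)" using x by (auto simp: cover_char_def)
      have k: "k \<in> carrier G" using j by simp
      let ?a = "idx (\<Psi> c y)"
      have a: "?a \<in> carrier G" "\<Psi> c y = act ?a v" using endpoint[OF c y(1)] by auto
      have xa: "x = act (k \<otimes>\<^bsub>G\<^esub> ?a) v"
        using composition_rule[OF vX k a(1)] y(2) a(2) by simp
      have "y \<in> topspace (closed_disk 1)" using y by (auto simp: disk_boundary_eq topspace_closed_disk)
      then have "x \<in> cover.ccell (k, c)" using y(2) c unfolding cover_ccell E1_def by simp
      then have "- d \<le> h x" using ccellJ[OF j] superlevel_height by blast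
      then have "- d \<le> chi (k \<otimes>\<^bsub>G\<^esub> ?a)" using hv k a(1) xa by simp
      then show ?thesis using xa k a(1) y(1) by blast
    qed
    have edge: "F0 x = F0 y" if j: "j \<in> ?J" "cover_dim cdim j = 1"
      and x: "x \<in> cover_char act \<Psi> j ` disk_boundary 1" and y: "y \<in> cover_char act \<Psi> j ` disk_boundary 1" for j x y
    proof -
      obtain k c where kc: "j = (k, c)" by (cases j)
      have c: "c \<in> E1" and k: "k \<in> carrier G" using j by (auto simp: kc E1_def cover_dim_def)
      obtain a where a: "a \<in> idx ` \<Psi> c ` disk_boundary 1" "k \<otimes>\<^bsub>G\<^esub> a \<in> carrier G" "x = act (k \<otimes>\<^bsub>G\<^esub> a) v" "- d \<le> chi (k \<otimes>\<^bsub>G\<^esub> a)"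
        using edge_end[OF j(1)[unfolded kc] c x[unfolded kc]] by blast
      obtain b where b: "b \<in> idx ` \<Psi> c ` disk_boundary 1" "k \<otimes>\<^bsub>G\<^esub> b \<in> carrier G" "y = act (k \<otimes>\<^bsub>G\<^esub> b) v" "- d \<le> chi (k \<otimes>\<^bsub>G\<^esub> b)"
        using edge_end[OF j(1)[unfolded kc] c y[unfolded kc]] by blast
      have "(a, b) \<in> T" using a(1) b(1) c unfolding T_def by auto
      then have "\<phi> (k \<otimes>\<^bsub>G\<^esub> a) = \<phi> (k \<otimes>\<^bsub>G\<^esub> b)" using \<phi> k a(4) b(4) by blast
      then show ?thesis using a b idx by (simp add: F0_def)
    qed
    have vertex: "F0 x = F0 y" if "j \<in> ?J" "cover_dim cdim j = 0" "x \<in> cover.ccell j" "y \<in> cover.ccell j" for j x y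
    proof -
      obtain k c where kc: "j = (k, c)" by (cases j)
      then have "c = c0" using that c0(3) by (simp add: cover_dim_def)
      then show ?thesis using that(3,4) kc vertex_cell by simp
    qed
    \<comment> \<open>A map of the two-point sphere: the base point 1 goes to the vertex of
      \<open>g\<close>, the point \<open>-1\<close> to that of \<open>g'\<close>. A based null
      homotopy traces a path from the second vertex to the first at the point
      \<open>-1\<close>.\<close>
    define f where "f x = (if 0 < x 0 then act g v else act g' v)" for x :: "nat \<Rightarrow> real"
    have "act g v \<in> topspace (subtopology X ?A)" "act g' v \<in> topspace (subtopology X ?A)"
      using vertexA g g' pos act_in vX by auto
    then have f: "continuous_map (nsphere 0) (subtopology X ?A) f"
      unfolding f_def[abs_def] by (rule continuous_map_nsphere_0)
    have fb: "f sphere_base = act g v" by (simp add: f_def sphere_base_def)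
    have "homotopic_with (\<lambda>f'. f' sphere_base = act g v) (nsphere 0) (subtopology X ?B) f (\<lambda>_. act g v)"
      by (rule d(2)[of 0, OF zero_less_one, unfolded trivial_on_pi_def, rule_format])
        (simp add: f fb vertexA[OF g pos(1)])
    then obtain K where K: "continuous_map (prod_topology unit_interval (nsphere 0)) (subtopology X ?B) K"
      "\<And>x. K (0, x) = f x" "\<And>x. K (1, x) = act g v" unfolding homotopic_with_def by (elim exE conjE) simp
    define e where "e = (\<lambda>i::nat. if i = 0 then - 1 else 0 :: real)"
    have e: "e \<in> topspace (nsphere 0)"
      by (auto simp: e_def topspace_nsphere disk_boundary_eq L2_set_def)
    define q where "q t = K (t, e)" for t
    have "continuous_map unit_interval (prod_topology unit_interval (nsphere 0)) (\<lambda>t. (t, e))"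
      using e by (intro continuous_map_pairedI) auto
    then have qB: "continuous_map unit_interval (subtopology X ?B) q"
      using continuous_map_compose[OF _ K(1)] unfolding q_def[abs_def] by (fastforce simp: o_def)
    then have q: "continuous_map unit_interval X q" and qim: "q ` {0..1} \<subseteq> ?B"
      by (auto simp: continuous_map_in_subtopology)
    have q01: "q 0 = act g' v" "q 1 = act g v" using K(2,3) by (auto simp: q_def f_def e_def)
    have "compactin unit_interval {0..1}" by (simp add: compactin_subtopology)
    then have "compactin X (q ` {0..1})" using q image_compactin by blast
    then have finK: "finite {j \<in> carrier G \<times> I. cover.ocell j \<inter> q ` {0..1} \<noteq> {}}"
      by (rule cover.compactin_finite_cells)
    define L where "L = {j \<in> carrier G \<times> I. cover.ocell j \<inter> q ` {0..1} \<noteq> {}}"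
    have L: "finite L" "L \<subseteq> carrier G \<times> I" "L \<subseteq> ?J"
      using finK qim unfolding L_def by auto
    \<comment> \<open>Labels extend dimension by dimension, and only the dimensions of the finitely
      many cells met by the path matter.\<close>
    define n where "n = Max (insert 0 (cover_dim cdim ` L))"
    have n: "cover_dim cdim j < Suc n" if "j \<in> L" for j
      using that L(1) unfolding n_def by (simp add: le_imp_less_Suc)
    have "\<exists>F. (\<forall>x\<in>cover.cells {j \<in> ?J. cover_dim cdim j < 1}. F x = F0 x) \<and>
      (\<forall>j\<in>?J. cover_dim cdim j < Suc n \<longrightarrow> (\<forall>x\<in>cover.ccell j. \<forall>y\<in>cover.ccell j. F x = F y))"
      by (rule cover.label_extension[OF J(1)]; fact vertex edge)
    then obtain F where F: "\<forall>x\<in>cover.cells {j \<in> ?J. cover_dim cdim j < 1}. F x = F0 x"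
      "\<forall>j\<in>?J. cover_dim cdim j < Suc n \<longrightarrow> (\<forall>x\<in>cover.ccell j. \<forall>y\<in>cover.ccell j. F x = F y)"
      by (elim exE conjE)
    have vF: "F (act k v) = \<phi> k" if k: "k \<in> carrier G" "act k v \<in> ?B" for k
    proof -
      have "(k, c0) \<in> {j \<in> ?J. cover_dim cdim j < 1}"
        using k c0(1,2) vertex_cell(2)[of k] by (simp add: cover_dim_def)
      then have "act k v \<in> cover.cells {j \<in> ?J. cover_dim cdim j < 1}"
        using vertex_cell by (intro cover.in_cellsI[of "(k, c0)"]) auto
      then show ?thesis using F(1) idx[OF k(1)] by (simp add: F0_def)
    qed
    have "F (q 0) = F (q 1)"
    proof (rule cover.label_constant[OF _ q L(1,2)])
      show "connected_space unit_interval" by (simp add: connected_space_subtopology connectedin_iff_connected[symmetric])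
      show "\<exists>k\<in>L. q z \<in> cover.ccell k" if "z \<in> topspace unit_interval" for z
      proof -
        have z: "q z \<in> q ` {0..1}" using that by simp
        then have "q z \<in> topspace X" using q that by (auto simp: continuous_map_def)
        then obtain j where j: "j \<in> carrier G \<times> I" "q z \<in> cover.ocell j" by (rule cover.obtain_cell)
        then have "j \<in> L" using z unfolding L_def by blast
        then show ?thesis using j(2) cover.ocell_subset_ccell[of j] by blast
      qed
      show "F x = F y" if "k \<in> L" "x \<in> cover.ccell k" "y \<in> cover.ccell k" for k x y
        using F(2) n[OF that(1)] L(3) that by blast
    qed simp_all
    moreover have "act g v \<in> ?B" "act g' v \<in> ?B" using qim q01 by (metis image_subset_iff atLeastAtMost_iff zero_le_one order_refl)+
    ultimately show "\<phi> g = \<phi> g'" using vF g g' q01 by simp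
  qed
qed

end

section \<open>Graph groups and free product normal forms\<close>

lemma graph_group_eq_words:
  assumes "graph_group_eq V E u v"
  shows "u \<in> lists (V \<times> UNIV) \<and> v \<in> lists (V \<times> UNIV)"
  using assms by (induction rule: graph_group_eq.induct) auto

lemma equiv_graph_group_rel: "equiv (lists (V \<times> UNIV)) (graph_group_rel V E)"
proof (rule equivI)
  show "graph_group_rel V E \<subseteq> lists (V \<times> UNIV) \<times> lists (V \<times> UNIV)"
    using graph_group_eq_words by (force simp: graph_group_rel_def)
  show "refl_on (lists (V \<times> UNIV)) (graph_group_rel V E)"
    by (rule refl_onI) (simp add: graph_group_rel_def graph_group_eq.refl)
  show "sym (graph_group_rel V E)"
    by (rule symI) (simp add: graph_group_rel_def graph_group_eq.sym)
  show "trans (graph_group_rel V E)"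
    by (rule transI) (auto simp: graph_group_rel_def intro: graph_group_eq.trans)
qed

definition word_class :: "'v set \<Rightarrow> ('v \<times> 'v) set \<Rightarrow> ('v \<times> bool) list \<Rightarrow> ('v \<times> bool) list set" where
  "word_class V E w = graph_group_rel V E `` {w}"

lemma word_class_eq_iff:
  assumes "u \<in> lists (V \<times> UNIV)" "v \<in> lists (V \<times> UNIV)"
  shows "word_class V E u = word_class V E v \<longleftrightarrow> graph_group_eq V E u v"
  using eq_equiv_class_iff[OF equiv_graph_group_rel assms, of E]
  by (simp add: word_class_def graph_group_rel_def)

lemma carrier_graph_group: "carrier (graph_group V E) = word_class V E ` lists (V \<times> UNIV)"
  by (auto simp: graph_group_def word_class_def quotient_def)

lemma one_graph_group: "\<one>\<^bsub>graph_group V E\<^esub> = word_class V E []"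
  by (simp add: graph_group_def word_class_def)

lemma mult_word_class:
  assumes "u \<in> lists (V \<times> UNIV)" "v \<in> lists (V \<times> UNIV)"
  shows "word_class V E u \<otimes>\<^bsub>graph_group V E\<^esub> word_class V E v = word_class V E (u @ v)"
proof -
  have "word_class V E (u' @ v') = word_class V E (u @ v)"
    if "u' \<in> word_class V E u" "v' \<in> word_class V E v" for u' v'
  proof -
    have uv: "graph_group_eq V E u u'" "graph_group_eq V E v v'"
      using that by (auto simp: word_class_def graph_group_rel_def)
    then have "graph_group_eq V E (u' @ v') (u @ v)"
      using graph_group_eq.append[OF graph_group_eq.sym[OF uv(1)] graph_group_eq.sym[OF uv(2)]] by simp
    moreover have "u' \<in> lists (V \<times> UNIV)" "v' \<in> lists (V \<times> UNIV)" using uv graph_group_eq_words by blast+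
    ultimately show ?thesis using assms by (subst word_class_eq_iff) auto
  qed
  moreover have "u \<in> word_class V E u" "v \<in> word_class V E v"
    using assms by (auto simp: word_class_def graph_group_rel_def intro: graph_group_eq.refl)
  moreover have "word_class V E u \<otimes>\<^bsub>graph_group V E\<^esub> word_class V E v =
    (\<Union>u'\<in>word_class V E u. \<Union>v'\<in>word_class V E v. word_class V E (u' @ v'))"
    by (simp add: graph_group_def word_class_def)
  ultimately show ?thesis by blast
qed

lemma word_class_cancel:
  assumes "x \<in> V" shows "word_class V E [(x, b), (x, \<not> b)] = word_class V E []"
  using assms graph_group_eq.cancel[OF assms] by (subst word_class_eq_iff) auto

lemma word_class_in_carrier: "w \<in> lists (V \<times> UNIV) \<Longrightarrow> word_class V E w \<in> carrier (graph_group V E)"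
  unfolding carrier_graph_group by (rule imageI)

lemma carrier_graph_groupE:
  assumes "x \<in> carrier (graph_group V E)"
  obtains w where "w \<in> lists (V \<times> UNIV)" "x = word_class V E w"
  using assms unfolding carrier_graph_group by (rule imageE) blast

lemma group_graph_group: "group (graph_group V E)"
proof (rule groupI)
  let ?G = "graph_group V E" and ?L = "lists (V \<times> (UNIV :: bool set))"
  show "x \<otimes>\<^bsub>?G\<^esub> y \<in> carrier ?G" if x: "x \<in> carrier ?G" and y: "y \<in> carrier ?G" for x y
  proof -
    obtain u v where uv: "u \<in> ?L" "x = word_class V E u" "v \<in> ?L" "y = word_class V E v"
      using carrier_graph_groupE[OF x] carrier_graph_groupE[OF y] by metis
    then show ?thesis using word_class_in_carrier[of "u @ v"] by (simp add: mult_word_class)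
  qed
  show "\<one>\<^bsub>?G\<^esub> \<in> carrier ?G" unfolding one_graph_group by (rule word_class_in_carrier) simp
  show "x \<otimes>\<^bsub>?G\<^esub> y \<otimes>\<^bsub>?G\<^esub> z = x \<otimes>\<^bsub>?G\<^esub> (y \<otimes>\<^bsub>?G\<^esub> z)"
    if x: "x \<in> carrier ?G" and y: "y \<in> carrier ?G" and z: "z \<in> carrier ?G" for x y z
  proof -
    obtain u v w where "u \<in> ?L" "x = word_class V E u" "v \<in> ?L" "y = word_class V E v"
      "w \<in> ?L" "z = word_class V E w"
      using carrier_graph_groupE[OF x] carrier_graph_groupE[OF y] carrier_graph_groupE[OF z] by metis
    then show ?thesis by (simp add: mult_word_class)
  qed
  show "\<one>\<^bsub>?G\<^esub> \<otimes>\<^bsub>?G\<^esub> x = x" if x: "x \<in> carrier ?G" for x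
    using x by (rule carrier_graph_groupE) (simp add: one_graph_group mult_word_class)
  show "\<exists>y\<in>carrier ?G. y \<otimes>\<^bsub>?G\<^esub> x = \<one>\<^bsub>?G\<^esub>" if x: "x \<in> carrier ?G" for x
  proof -
    have "\<exists>u\<in>?L. word_class V E (u @ w) = word_class V E []" if "w \<in> ?L" for w
      using that
    proof (induction w)
      case Nil
      then show ?case by (intro bexI[of _ "[]"]) auto
    next
      case (Cons a w)
      obtain x b where a: "a = (x, b)" "x \<in> V" using Cons.hyps(1) by (cases a) auto
      obtain u where u: "u \<in> ?L" "word_class V E (u @ w) = word_class V E []" using Cons.IH by blast
      have wL: "w \<in> ?L" using Cons.hyps(2) by (simp add: in_lists_conv_set)
      let ?v = "u @ [(x, \<not> b)]"
      have "word_class V E (?v @ a # w) = word_class V E u \<otimes>\<^bsub>?G\<^esub> (word_class V E [(x, \<not> b), (x, b)] \<otimes>\<^bsub>?G\<^esub> word_class V E w)"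
        using u(1) a wL by (simp add: mult_word_class)
      also have "word_class V E [(x, \<not> b), (x, b)] = word_class V E []"
        using word_class_cancel[OF a(2), of E "\<not> b"] by simp
      also have "word_class V E u \<otimes>\<^bsub>?G\<^esub> (word_class V E [] \<otimes>\<^bsub>?G\<^esub> word_class V E w) = word_class V E []"
        using u wL by (simp add: mult_word_class)
      finally show ?case using u(1) a by (intro bexI[of _ ?v]) auto
    qed
    moreover obtain w where w: "w \<in> ?L" "x = word_class V E w" using x by (rule carrier_graph_groupE)
    ultimately obtain u where "u \<in> ?L" "word_class V E (u @ w) = word_class V E []" by blast
    then show ?thesis using w
      by (intro bexI[OF _ word_class_in_carrier[of u]]) (simp_all add: mult_word_class one_graph_group)
  qed
qed

text \<open>Normal forms in the free product of two copies of an abelian group: a list of nonzero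
  syllables with alternating sides, most recent syllable first. \<open>syl s a\<close> is right
  multiplication by the element \<open>a\<close> of the copy \<open>s\<close>.\<close>

fun syl :: "bool \<Rightarrow> 'a::ab_group_add \<Rightarrow> (bool \<times> 'a) list \<Rightarrow> (bool \<times> 'a) list" where
  "syl s a [] = (if a = 0 then [] else [(s, a)])"
| "syl s a ((s', b) # l) = (if a = 0 then (s', b) # l
     else if s = s' then (if a + b = 0 then l else (s, a + b) # l)
     else (s, a) # (s', b) # l)"

fun reduced :: "(bool \<times> 'a::ab_group_add) list \<Rightarrow> bool" where
  "reduced [] = True"
| "reduced [(s, a)] = (a \<noteq> 0)"
| "reduced ((s, a) # (s', b) # l) = (a \<noteq> 0 \<and> s \<noteq> s' \<and> reduced ((s', b) # l))"

lemma reduced_tl: "reduced (x # l) \<Longrightarrow> reduced l"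
  by (cases "x # l" rule: reduced.cases) auto

lemma reduced_Cons: "reduced ((s, b) # l) \<Longrightarrow> a \<noteq> 0 \<Longrightarrow> reduced ((s, a) # l)"
  by (cases l) auto

lemma reduced_syl: "reduced l \<Longrightarrow> reduced (syl s a l)"
proof (cases l)
  case (Cons x l')
  obtain s' b where x: "x = (s', b)" by (cases x)
  assume "reduced l"
  then show ?thesis using Cons x reduced_tl[of x l'] reduced_Cons[of s b l' "a + b"] by auto
qed simp

lemma syl_0: "syl s 0 l = l"
  by (cases "(s, l)" rule: prod.exhaust, cases l) auto

lemma syl_other_side: "reduced ((s, b) # l) \<Longrightarrow> syl s a l = (if a = 0 then l else (s, a) # l)"
  by (cases l) auto

text \<open>Reducedness matters when \<open>b\<close> cancels the newest syllable: what remains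
  below belongs to the other side, so a further \<open>a\<close> starts a new syllable and does not
  merge with it.\<close>

lemma syl_syl:
  assumes "reduced l" shows "syl s a (syl s b l) = syl s (a + b) l"
proof (cases l)
  case Nil
  then show ?thesis by (simp add: syl_0)
next
  case (Cons x l')
  obtain s' c where x: "x = (s', c)" by (cases x)
  show ?thesis
  proof (cases "b = 0 \<or> s \<noteq> s'")
    case True
    then show ?thesis using Cons x by (auto simp: syl_0)
  next
    case False
    then have b: "b \<noteq> 0" and s: "s' = s" by auto
    have red: "reduced ((s, c) # l')" using assms Cons x s by simp
    have c: "c \<noteq> 0" using red by (cases l') auto
    show ?thesis
    proof (cases "b + c = 0")
      case True
      then have l: "syl s b l = l'" using Cons x s b by simp
      define e where "e = a + b"
      have a: "a = e + c" using True by (simp add: e_def add.assoc)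
      have "syl s a (syl s b l) = syl s (e + c) l'"
        unfolding l by (rule arg_cong[OF a, of "\<lambda>a. syl s a l'"])
      also have "\<dots> = syl s e ((s, c) # l')"
        using syl_other_side[OF red, of "e + c"] c by auto
      finally show ?thesis unfolding e_def Cons x s .
    next
      case False
      define d where "d = b + c"
      have d: "d \<noteq> 0" using False by (simp add: d_def)
      have l: "syl s b l = (s, d) # l'" using Cons x s b d by (simp add: d_def)
      have abc: "a + b + c = a + d" by (simp add: d_def add.assoc)
      have r: "syl s (a + b) l =
        (if a + b = 0 then (s, c) # l' else if a + d = 0 then l' else (s, a + d) # l')"
        unfolding Cons x s by (simp add: abc)
      consider "a = 0" | "a \<noteq> 0" "a + b = 0" | "a \<noteq> 0" "a + b \<noteq> 0" by blast
      then show ?thesis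
      proof cases
        case 1
        then show ?thesis using b d unfolding l r by simp
      next
        case 2
        have "a + d = c" using abc 2(2) by simp
        then show ?thesis using 2 c unfolding l r by simp
      next
        case 3
        then show ?thesis unfolding l r by simp
      qed
    qed
  qed
qed

text \<open>The sum of the syllables is the image under folding the two copies together, a
  homomorphism that cancellation does not affect. In its first coordinate it will measure the
  height.\<close>

lemma sum_syl: "sum_list (map snd (syl s a l)) = a + sum_list (map snd l)"
  by (cases "(s, l)" rule: prod.exhaust, cases l) (auto simp: add.assoc[symmetric])

text \<open>The last entry is the oldest syllable. Its value may change, but its side can change
  only after the list has been emptied.\<close>

lemma last_syl: "l \<noteq> [] \<Longrightarrow> syl s a l \<noteq> [] \<Longrightarrow> fst (last (syl s a l)) = fst (last l)"
  by (cases l) (auto split: if_splits)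

section \<open>Words acting on free product normal forms\<close>

definition signed :: "('v \<Rightarrow> 'a::ab_group_add) \<Rightarrow> 'v \<times> bool \<Rightarrow> 'a" where
  "signed \<omega> x = (if snd x then \<omega> (fst x) else - \<omega> (fst x))"

definition run :: "('v \<Rightarrow> bool) \<Rightarrow> ('v \<Rightarrow> 'a::ab_group_add) \<Rightarrow> ('v \<times> bool) list \<Rightarrow> (bool \<times> 'a) list \<Rightarrow> (bool \<times> 'a) list" where
  "run \<sigma> \<omega> w = fold (\<lambda>x. syl (\<sigma> (fst x)) (signed \<omega> x)) w"

lemma run_simps [simp]: "run \<sigma> \<omega> [] l = l" "run \<sigma> \<omega> (x # w) l = run \<sigma> \<omega> w (syl (\<sigma> (fst x)) (signed \<omega> x) l)"
  by (simp_all add: run_def)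

lemma run_append: "run \<sigma> \<omega> (u @ v) l = run \<sigma> \<omega> v (run \<sigma> \<omega> u l)"
  by (simp add: run_def)

lemma reduced_run: "reduced l \<Longrightarrow> reduced (run \<sigma> \<omega> w l)"
  by (induction w arbitrary: l) (auto simp: reduced_syl)

lemma sum_run: "sum_list (map snd (run \<sigma> \<omega> w l)) = sum_list (map (signed \<omega>) w) + sum_list (map snd l)"
  by (induction w arbitrary: l) (auto simp: sum_syl algebra_simps)

lemma run_replicate:
  "reduced l \<Longrightarrow> run \<sigma> \<omega> (replicate n x) l = syl (\<sigma> (fst x)) (sum_list (map (signed \<omega>) (replicate n x))) l"
proof (induction n arbitrary: l)
  case (Suc n)
  then show ?case
    using Suc.IH[OF reduced_syl[OF Suc.prems], of "\<sigma> (fst x)" "signed \<omega> x"]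
    by (simp add: syl_syl add.commute)
qed (simp add: syl_0)

text \<open>Commuting generators are adjacent, hence sent to the same copy, which is abelian. So the
  action of words on reduced lists descends to the graph group.\<close>

lemma run_graph_group_eq:
  assumes "graph_group_eq V E u v" and \<sigma>: "\<And>x y. (x, y) \<in> E \<Longrightarrow> \<sigma> x = \<sigma> y" and "reduced l"
  shows "run \<sigma> \<omega> u l = run \<sigma> \<omega> v l"
  using assms(1,3)
proof (induction arbitrary: l rule: graph_group_eq.induct)
  case (append u u' v v')
  then show ?case by (simp add: run_append reduced_run)
next
  case (cancel x b)
  then show ?case by (simp add: syl_syl signed_def syl_0)
next
  case (commute x y)
  then show ?case using \<sigma>[of x y] by (simp add: syl_syl add.commute)
qed auto

text \<open>The empty list has height 0, and a word cannot lower the height by more than the total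
  variation of its letters. So the list is never emptied on the way and the oldest syllable keeps
  its side.\<close>

lemma run_far_from_empty:
  fixes \<omega> :: "'v \<Rightarrow> real \<times> real"
  assumes "(\<Sum>x\<leftarrow>w. \<bar>fst (signed \<omega> x)\<bar>) < fst (sum_list (map snd l))"
  shows "l \<noteq> [] \<and> run \<sigma> \<omega> w l \<noteq> [] \<and> fst (last (run \<sigma> \<omega> w l)) = fst (last l)"
  using assms
proof (induction w arbitrary: l)
  case Nil
  then show ?case by auto
next
  case (Cons x w)
  let ?l = "syl (\<sigma> (fst x)) (signed \<omega> x) l"
  have "fst (sum_list (map snd ?l)) = fst (signed \<omega> x) + fst (sum_list (map snd l))"
    by (simp add: sum_syl)
  then have "(\<Sum>x\<leftarrow>w. \<bar>fst (signed \<omega> x)\<bar>) < fst (sum_list (map snd ?l))"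
    using Cons.prems by simp
  from Cons.IH[OF this] have *: "?l \<noteq> []" "run \<sigma> \<omega> w ?l \<noteq> []" "fst (last (run \<sigma> \<omega> w ?l)) = fst (last ?l)" by auto
  have "0 \<le> (\<Sum>x\<leftarrow>x # w. \<bar>fst (signed \<omega> x)\<bar>)" by (intro sum_list_nonneg) auto
  then have "l \<noteq> []" using Cons.prems by auto
  then show ?case using * last_syl[of l] by simp
qed

lemma sum_list_replicate_pair:
  fixes a :: "real \<times> real" shows "sum_list (replicate n a) = (real n * fst a, real n * snd a)"
  by (induction n) (auto simp: algebra_simps prod_eq_iff zero_prod_def)

text \<open>The label of \<open>g\<close> is the side of the oldest syllable after \<open>g\<close>
  has acted on a large initial power of \<open>x\<close>. Above height \<open>- d\<close> an element
  of \<open>T\<close> is too short to use up that power, so it cannot change the label. An element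
  that first descends far below \<open>- d\<close> can remove the power and put a syllable of the
  other side in its place.\<close>

lemma disconnected_edge_labels:
  fixes W :: "'w set" and F :: "('w \<times> 'w) set"
  defines "H \<equiv> graph_group W F"
  assumes disc: "disconnected_graph W F" and sym: "sym F"
    and chi: "\<forall>A\<in>carrier H. \<forall>B\<in>carrier H. chi (A \<otimes>\<^bsub>H\<^esub> B) = chi A + (chi B :: real)"
    and nz: "\<exists>A\<in>carrier H. chi A \<noteq> 0"
    and T: "finite T" "T \<subseteq> carrier H"
  shows "\<exists>(\<phi> :: ('w \<times> bool) list set \<Rightarrow> bool) g g'.
    (\<forall>g\<in>carrier H. \<forall>s\<in>T. - d \<le> chi g \<longrightarrow> \<phi> (g \<otimes>\<^bsub>H\<^esub> s) = \<phi> g) \<and>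
    g \<in> carrier H \<and> g' \<in> carrier H \<and> 0 \<le> chi g \<and> 0 \<le> chi g' \<and> \<phi> g \<noteq> \<phi> g'"
proof -
  let ?L = "lists (W \<times> (UNIV :: bool set))" and ?c = "word_class W F"
  interpret group H unfolding H_def by (rule group_graph_group)
  have carr: "carrier H = ?c ` ?L" and one: "\<one>\<^bsub>H\<^esub> = ?c []"
    and mult: "\<And>u v. u \<in> ?L \<Longrightarrow> v \<in> ?L \<Longrightarrow> ?c u \<otimes>\<^bsub>H\<^esub> ?c v = ?c (u @ v)"
    unfolding H_def by (auto simp: carrier_graph_group one_graph_group mult_word_class)
  have chi1: "chi (?c []) = 0" using chi[rule_format, OF one_closed one_closed] mult[of "[]" "[]"] by (simp add: one)
  have chi_app: "chi (?c (u @ v)) = chi (?c u) + chi (?c v)" if "u \<in> ?L" "v \<in> ?L" for u v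
    using chi mult[OF that] that carr by (metis imageI)
  have chi_inv: "chi (?c [(x, False)]) = - chi (?c [(x, True)])" if "x \<in> W" for x
    using chi_app[of "[(x, True)]" "[(x, False)]"] word_class_cancel[OF that, of F True] that chi1 by simp
  have chi_sum: "chi (?c w) = (\<Sum>x\<leftarrow>w. chi (?c [x]))" if "w \<in> ?L" for w
    using that
  proof (induction w)
    case (Cons a w)
    then show ?case using chi_app[of "[a]" w] by simp
  qed (simp add: chi1)
  obtain x where x: "x \<in> W" "chi (?c [(x, True)]) \<noteq> 0"
  proof -
    obtain w where w: "w \<in> ?L" "chi (?c w) \<noteq> 0" using nz carr by auto
    have "\<exists>a\<in>set w. chi (?c [a]) \<noteq> 0"
    proof (rule ccontr)
      assume "\<not> ?thesis"
      then have "(\<Sum>x\<leftarrow>w. chi (?c [x])) = (\<Sum>x\<leftarrow>w. 0)" by (intro arg_cong[where f = sum_list] map_cong) auto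
      then show False using w chi_sum by simp
    qed
    then obtain a where a: "a \<in> set w" "chi (?c [a]) \<noteq> 0" by blast
    obtain v b where vb: "a = (v, b)" by (cases a)
    have "v \<in> W" using a w(1) vb by (auto simp: in_lists_conv_set)
    then show ?thesis using that[of v] a(2) vb chi_inv[of v] by (cases b) auto
  qed
  have symr: "sym (F\<^sup>*)" using sym by (rule sym_rtrancl)
  obtain y where y: "y \<in> W" "(x, y) \<notin> F\<^sup>*"
  proof -
    obtain x0 y0 where "x0 \<in> W" "y0 \<in> W" "(x0, y0) \<notin> F\<^sup>*"
      using disc by (auto simp: disconnected_graph_def)
    then show ?thesis using that symr by (meson rtrancl_trans symE)
  qed
  \<comment> \<open>The component of \<open>x\<close> against all other vertices: two sides are
    enough, and edges never join them.\<close>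
  define \<sigma> where "\<sigma> v \<longleftrightarrow> (x, v) \<in> F\<^sup>*" for v
  have \<sigma>: "\<sigma> u = \<sigma> v" if "(u, v) \<in> F" for u v
    unfolding \<sigma>_def using that sym by (meson rtrancl.rtrancl_into_rtrancl symE)
  \<comment> \<open>The first coordinate is the height. The second keeps the value of
    \<open>y\<close> nonzero even when \<open>chi\<close> vanishes on \<open>y\<close>, so that
    \<open>y\<close> always contributes a syllable.\<close>
  define \<omega> where "\<omega> v = (chi (?c [(v, True)]), if v = y then 1 else 0 :: real)" for v
  have signed: "fst (signed \<omega> a) = chi (?c [a])" if "fst a \<in> W" for a
    using that chi_inv[of "fst a"] by (cases a) (auto simp: signed_def \<omega>_def)
  have sum_signed: "fst (sum_list (map (signed \<omega>) w)) = chi (?c w)" if "w \<in> ?L" for w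
    using that
  proof (induction w)
    case Nil
    then show ?case by (simp add: chi1)
  next
    case (Cons a w)
    then show ?case using signed[of a] chi_app[of "[a]" w] by auto
  qed
  \<comment> \<open>Exponents are chosen so that the letter \<open>(x, b)\<close> ascends and,
    below, the letter \<open>(y, b')\<close> does not descend.\<close>
  obtain b where b: "0 < fst (signed \<omega> (x, b))" and bn: "signed \<omega> (x, \<not> b) = - signed \<omega> (x, b)"
    using x that[of True] that[of False] by (cases "0 < chi (?c [(x, True)])") (auto simp: signed_def \<omega>_def)
  obtain b' where b': "0 \<le> fst (signed \<omega> (y, b'))"
    using that[of True] that[of False] by (cases "0 \<le> chi (?c [(y, True)])") (auto simp: signed_def \<omega>_def)
  have xy: "x \<noteq> y" using y by auto
  define rp where "rp A = (SOME w. w \<in> ?L \<and> A = ?c w)" for A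
  have rp: "rp A \<in> ?L" "?c (rp A) = A" if "A \<in> carrier H" for A
  proof -
    have "\<exists>w. w \<in> ?L \<and> A = ?c w" using that carr by auto
    from someI_ex[OF this] show "rp A \<in> ?L" "?c (rp A) = A" unfolding rp_def by auto
  qed
  define C where "C w = (\<Sum>x\<leftarrow>w. \<bar>fst (signed \<omega> x)\<bar>)" for w
  \<comment> \<open>The initial power has to outweigh the depth \<open>d\<close> together with the
    variation of every element of \<open>T\<close>: at height at least \<open>- d\<close> the list
    then has sum above the variation of any \<open>rp s\<close>.\<close>
  obtain N :: nat where N: "(\<bar>d\<bar> + (\<Sum>s\<in>T. C (rp s)) + 1) / fst (signed \<omega> (x, b)) < real N"
    using reals_Archimedean2 by blast
  define M where "M = real N * fst (signed \<omega> (x, b))"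
  have M: "\<bar>d\<bar> + (\<Sum>s\<in>T. C (rp s)) + 1 < M" using N b by (simp add: M_def divide_less_eq)
  have C0: "0 \<le> C w" for w unfolding C_def by (intro sum_list_nonneg) auto
  have CM: "C (rp s) < M - d" if "s \<in> T" for s
  proof -
    have "C (rp s) \<le> (\<Sum>s\<in>T. C (rp s))" using that T(1) C0 by (intro member_le_sum) auto
    then show ?thesis using M by linarith
  qed
  have M0: "0 < M" using M sum_nonneg[of T "\<lambda>s. C (rp s)"] C0 by auto
  \<comment> \<open>The normal form of the \<open>N\<close>-th power of the letter
    \<open>(x, b)\<close>, a single syllable of height \<open>M\<close>.\<close>
  define l0 where "l0 = [(True, (M, 0 :: real))]"
  have red: "reduced l0" using M0 by (simp add: l0_def zero_prod_def)
  define \<phi> where "\<phi> A = fst (last (run \<sigma> \<omega> (rp A) l0))" for A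
  have \<phi>: "\<phi> (?c w) = fst (last (run \<sigma> \<omega> w l0))" if w: "w \<in> ?L" for w
  proof -
    have "?c w \<in> carrier H" using w carr by blast
    then have "graph_group_eq W F (rp (?c w)) w" using rp w word_class_eq_iff by metis
    from run_graph_group_eq[OF this \<sigma> red]
    show ?thesis unfolding \<phi>_def by (rule arg_cong)
  qed
  have sx: "snd (signed \<omega> (x, c)) = 0" for c using xy by (auto simp: signed_def \<omega>_def)
  have sy: "signed \<omega> (y, b') \<noteq> 0" by (auto simp: signed_def \<omega>_def zero_prod_def)
  have rep: "sum_list (map (signed \<omega>) (replicate N (x, b))) = (M, 0)"
    "sum_list (map (signed \<omega>) (replicate N (x, \<not> b))) = (- M, 0)"
    using sx[of b] by (simp_all add: sum_list_replicate_pair bn M_def)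
  \<comment> \<open>The first block cancels \<open>l0\<close> exactly, so the letter of
    \<open>y\<close> becomes the oldest syllable; the last block climbs back up, which leaves the
    element at the height of the letter of \<open>y\<close>.\<close>
  let ?w = "replicate N (x, \<not> b) @ [(y, b')] @ replicate N (x, b)"
  have wL: "?w \<in> ?L" using x(1) y(1) by (auto simp: in_lists_conv_set)
  have \<sigma>x: "\<sigma> x" "\<not> \<sigma> y" using y by (auto simp: \<sigma>_def)
  have run1: "run \<sigma> \<omega> (replicate N (x, \<not> b)) l0 = []"
    unfolding run_replicate[OF red] rep using \<sigma>x M0 by (simp add: l0_def zero_prod_def)
  have run2: "run \<sigma> \<omega> [(y, b')] [] = [(False, signed \<omega> (y, b'))]"
    using sy \<sigma>x by simp
  have run3: "run \<sigma> \<omega> (replicate N (x, b)) [(False, signed \<omega> (y, b'))] = [(True, (M, 0)), (False, signed \<omega> (y, b'))]"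
    using run_replicate[of "[(False, signed \<omega> (y, b'))]" \<sigma> \<omega> N "(x, b)"] sy \<sigma>x M0
    unfolding rep by (simp add: zero_prod_def)
  show ?thesis
  proof (rule exI[of _ \<phi>], rule exI[of _ "?c []"], rule exI[of _ "?c ?w"], intro conjI ballI impI)
    fix g s assume g: "g \<in> carrier H" and s: "s \<in> T" and d: "- d \<le> chi g"
    have sH: "s \<in> carrier H" using s T by blast
    let ?l = "run \<sigma> \<omega> (rp g) l0"
    have "g \<otimes>\<^bsub>H\<^esub> s = ?c (rp g @ rp s)" using mult[OF rp(1)[OF g] rp(1)[OF sH]] rp(2) g sH by simp
    then have "\<phi> (g \<otimes>\<^bsub>H\<^esub> s) = fst (last (run \<sigma> \<omega> (rp s) ?l))"
      using \<phi>[of "rp g @ rp s"] rp(1) g sH by (simp add: run_append)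
    also have "\<dots> = fst (last ?l)"
    proof -
      have "fst (sum_list (map snd ?l)) = chi g + M"
        using sum_signed[OF rp(1)[OF g]] rp(2)[OF g] by (simp add: sum_run l0_def)
      then have "(\<Sum>x\<leftarrow>rp s. \<bar>fst (signed \<omega> x)\<bar>) < fst (sum_list (map snd ?l))"
        using CM[OF s] d by (simp add: C_def)
      then show ?thesis using run_far_from_empty by blast
    qed
    finally show "\<phi> (g \<otimes>\<^bsub>H\<^esub> s) = \<phi> g" by (simp add: \<phi>_def)
  next
    show "?c [] \<in> carrier H" "?c ?w \<in> carrier H" using wL carr by auto
    show "0 \<le> chi (?c [])" by (simp add: chi1)
    have "chi (?c ?w) = fst (sum_list (map (signed \<omega>) ?w))" using sum_signed[OF wL] by simp
    also have "\<dots> = fst (signed \<omega> (y, b'))"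
      using rep by (simp add: sum_list_replicate_pair bn)
    finally show "0 \<le> chi (?c ?w)" using b' by simp
    have "\<phi> (?c []) = True" using \<phi>[of "[]"] by (simp add: l0_def)
    moreover have "\<phi> (?c ?w) = False" unfolding \<phi>[OF wL] run_append run1 run2 run3 by simp
    ultimately show "\<phi> (?c []) \<noteq> \<phi> (?c ?w)" by simp
  qed
qed

section \<open>Characters of direct products\<close>

text \<open>The complex and the height function that witness membership for \<open>k\<close> are
  reused for \<open>k'\<close>.\<close>

lemma BNS_Sigma_subset:
  fixes G :: "('g, 'b) monoid_scheme"
  assumes "\<And>chi (K :: (nat \<Rightarrow> real) topology) (I :: nat set) cdim \<Phi> (X :: (nat \<Rightarrow> real) topology) p act \<Psi> h.
    chi \<in> characters G \<Longrightarrow> finite_type_K_G_1 G K I cdim \<Phi> X p act \<Psi> \<Longrightarrow>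
    height_function G I cdim X act \<Psi> chi h \<Longrightarrow> essentially_connected k G I cdim X act \<Psi> h \<Longrightarrow>
    essentially_connected k' G I cdim X act \<Psi> h"
  shows "BNS_Sigma k G \<subseteq> BNS_Sigma k' G"
proof
  fix r assume "r \<in> BNS_Sigma k G"
  then obtain chi and K :: "(nat \<Rightarrow> real) topology" and I :: "nat set" and cdim \<Phi>
    and X :: "(nat \<Rightarrow> real) topology" and p act \<Psi> h
    where *: "r = char_ray G chi" "chi \<in> characters G" "finite_type_K_G_1 G K I cdim \<Phi> X p act \<Psi>"
      "height_function G I cdim X act \<Psi> chi h" "essentially_connected k G I cdim X act \<Psi> h"
    unfolding BNS_Sigma_def by (elim CollectE exE conjE) (rule that)
  then have "essentially_connected k' G I cdim X act \<Psi> h" by (intro assms)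
  with * show "r \<in> BNS_Sigma k' G"
    unfolding BNS_Sigma_def by (intro CollectI exI conjI)
qed

lemma character_mult:
  "chi \<in> characters G \<Longrightarrow> x \<in> carrier G \<Longrightarrow> y \<in> carrier G \<Longrightarrow> chi (x \<otimes>\<^bsub>G\<^esub> y) = chi x + chi y"
  by (simp add: characters_def hom_def real_group_def)

text \<open>\<open>labels\<close> is the form in which membership in the first invariant arrives. If
  \<open>chi\<close> vanished on the factor \<open>A\<close>, it would be a character of the graph
  group factor, and the separating label found there, pulled back along the projection, would
  contradict \<open>labels\<close>. Otherwise an element of \<open>A\<close> or its inverse has
  positive value.\<close>

lemma central_element_positive:
  assumes G: "group G" and chi: "chi \<in> characters G"
    and f: "f \<in> iso G (A \<times>\<times> graph_group (W :: 'w set) F)" and A: "comm_group A"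
    and disc: "disconnected_graph W F" and sym: "sym F"
    and T: "finite T" "T \<subseteq> carrier G \<times> carrier G"
    and labels: "\<forall>\<phi> :: 'g \<Rightarrow> bool.
      (\<forall>g\<in>carrier G. \<forall>(a, b)\<in>T. - d \<le> chi (g \<otimes>\<^bsub>G\<^esub> a) \<longrightarrow> - d \<le> chi (g \<otimes>\<^bsub>G\<^esub> b) \<longrightarrow>
        \<phi> (g \<otimes>\<^bsub>G\<^esub> a) = \<phi> (g \<otimes>\<^bsub>G\<^esub> b)) \<longrightarrow>
      (\<forall>g\<in>carrier G. \<forall>g'\<in>carrier G. 0 \<le> chi g \<longrightarrow> 0 \<le> chi g' \<longrightarrow> \<phi> g = \<phi> g')"
  obtains z where "z \<in> carrier G" "\<forall>g\<in>carrier G. z \<otimes>\<^bsub>G\<^esub> g = g \<otimes>\<^bsub>G\<^esub> z" "0 < (chi :: 'g \<Rightarrow> real) z"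
proof -
  let ?H = "graph_group W F"
  interpret G: group G by (rule G)
  interpret A: comm_group A by (rule A)
  interpret H: group ?H by (rule group_graph_group)
  have fhom: "f \<in> hom G (A \<times>\<times> ?H)" and fbij: "bij_betw f (carrier G) (carrier A \<times> carrier ?H)"
    using f by (auto simp: iso_def)
  have fmult: "f (x \<otimes>\<^bsub>G\<^esub> y) = (fst (f x) \<otimes>\<^bsub>A\<^esub> fst (f y), snd (f x) \<otimes>\<^bsub>?H\<^esub> snd (f y))"
    if "x \<in> carrier G" "y \<in> carrier G" for x y
    using hom_mult[OF fhom that] by (simp add: DirProd_def case_prod_unfold)
  have fin: "fst (f x) \<in> carrier A" "snd (f x) \<in> carrier ?H" if "x \<in> carrier G" for x
    using bij_betwE[OF fbij] that by (metis mem_Times_iff)+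
  define e where "e = inv_into (carrier G) f"
  have e: "e (a, h) \<in> carrier G" "f (e (a, h)) = (a, h)" if "a \<in> carrier A" "h \<in> carrier ?H" for a h
  proof -
    have m: "(a, h) \<in> f ` carrier G" using that fbij by (simp add: bij_betw_def)
    show "e (a, h) \<in> carrier G" "f (e (a, h)) = (a, h)"
      unfolding e_def using inv_into_into[OF m] f_inv_into_f[OF m] by simp_all
  qed
  have inj: "x = y" if "x \<in> carrier G" "y \<in> carrier G" "f x = f y" for x y
    using fbij that by (auto simp: bij_betw_def inj_on_def)
  have emult: "e (a, h) \<otimes>\<^bsub>G\<^esub> e (a', h') = e (a \<otimes>\<^bsub>A\<^esub> a', h \<otimes>\<^bsub>?H\<^esub> h')"
    if "a \<in> carrier A" "h \<in> carrier ?H" "a' \<in> carrier A" "h' \<in> carrier ?H" for a h a' h'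
  proof (rule inj)
    show "f (e (a, h) \<otimes>\<^bsub>G\<^esub> e (a', h')) = f (e (a \<otimes>\<^bsub>A\<^esub> a', h \<otimes>\<^bsub>?H\<^esub> h'))"
      using that e fmult by simp
  qed (use that e in auto)
  have ef: "e (fst (f g), snd (f g)) = g" if "g \<in> carrier G" for g
    using e[OF fin[OF that]] inj that by simp
  have "\<exists>a\<in>carrier A. chi (e (a, \<one>\<^bsub>?H\<^esub>)) \<noteq> 0"
  proof (rule ccontr)
    assume "\<not> ?thesis"
    then have zero: "chi (e (a, \<one>\<^bsub>?H\<^esub>)) = 0" if "a \<in> carrier A" for a using that by blast
    define \<eta> where "\<eta> h = chi (e (\<one>\<^bsub>A\<^esub>, h))" for h
    have chi_eq: "chi g = \<eta> (snd (f g))" if g: "g \<in> carrier G" for g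
    proof -
      have "g = e (fst (f g), \<one>\<^bsub>?H\<^esub>) \<otimes>\<^bsub>G\<^esub> e (\<one>\<^bsub>A\<^esub>, snd (f g))"
        using emult[OF fin(1)[OF g] H.one_closed A.one_closed fin(2)[OF g]] ef[OF g] fin[OF g] by simp
      then have "chi g = chi (e (fst (f g), \<one>\<^bsub>?H\<^esub>)) + \<eta> (snd (f g))"
        using character_mult[OF chi e(1)[OF fin(1)[OF g] H.one_closed] e(1)[OF A.one_closed fin(2)[OF g]]]
        by (simp add: \<eta>_def)
      then show ?thesis using zero[OF fin(1)[OF g]] by simp
    qed
    have \<eta>_mult: "\<eta> (B \<otimes>\<^bsub>?H\<^esub> C) = \<eta> B + \<eta> C" if "B \<in> carrier ?H" "C \<in> carrier ?H" for B C
      using emult[OF A.one_closed that(1) A.one_closed that(2)]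
        character_mult[OF chi e(1)[OF A.one_closed that(1)] e(1)[OF A.one_closed that(2)]]
      by (simp add: \<eta>_def)
    obtain g0 where "g0 \<in> carrier G" "chi g0 \<noteq> 0" using chi by (auto simp: characters_def)
    then have nz: "\<exists>B\<in>carrier ?H. \<eta> B \<noteq> 0" using chi_eq fin by auto
    \<comment> \<open>Right multiplication by \<open>a\<inverse> b\<close> leads from
      \<open>g a\<close> to \<open>g b\<close>, so these elements are the projected edge
      steps.\<close>
    define T' where "T' = (\<lambda>(a, b). snd (f (inv\<^bsub>G\<^esub> a \<otimes>\<^bsub>G\<^esub> b))) ` T"
    have T': "finite T'" "T' \<subseteq> carrier ?H" using T fin(2) by (auto simp: T'_def)
    have "\<exists>(\<phi> :: ('w \<times> bool) list set \<Rightarrow> bool) h h'.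
        (\<forall>g\<in>carrier ?H. \<forall>s\<in>T'. - d \<le> \<eta> g \<longrightarrow> \<phi> (g \<otimes>\<^bsub>?H\<^esub> s) = \<phi> g) \<and>
        h \<in> carrier ?H \<and> h' \<in> carrier ?H \<and> 0 \<le> \<eta> h \<and> 0 \<le> \<eta> h' \<and> \<phi> h \<noteq> \<phi> h'"
      by (rule disconnected_edge_labels[OF disc sym _ nz T']) (intro ballI \<eta>_mult)
    then obtain \<phi> :: "('w \<times> bool) list set \<Rightarrow> bool" and h h' where \<phi>: "\<forall>g\<in>carrier ?H. \<forall>s\<in>T'. - d \<le> \<eta> g \<longrightarrow> \<phi> (g \<otimes>\<^bsub>?H\<^esub> s) = \<phi> g"
      and h: "h \<in> carrier ?H" "h' \<in> carrier ?H" "0 \<le> \<eta> h" "0 \<le> \<eta> h'" "\<phi> h \<noteq> \<phi> h'"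
      by (elim exE conjE)
    have "\<forall>g\<in>carrier G. \<forall>(a, b)\<in>T. - d \<le> chi (g \<otimes>\<^bsub>G\<^esub> a) \<longrightarrow> - d \<le> chi (g \<otimes>\<^bsub>G\<^esub> b) \<longrightarrow>
      \<phi> (snd (f (g \<otimes>\<^bsub>G\<^esub> a))) = \<phi> (snd (f (g \<otimes>\<^bsub>G\<^esub> b)))"
    proof (intro ballI, clarify)
      fix g a b assume g: "g \<in> carrier G" and ab: "(a, b) \<in> T" and da: "- d \<le> chi (g \<otimes>\<^bsub>G\<^esub> a)"
      have abG: "a \<in> carrier G" "b \<in> carrier G" using ab T(2) by auto
      let ?s = "inv\<^bsub>G\<^esub> a \<otimes>\<^bsub>G\<^esub> b"
      have "g \<otimes>\<^bsub>G\<^esub> b = (g \<otimes>\<^bsub>G\<^esub> a) \<otimes>\<^bsub>G\<^esub> ?s"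
        using g abG by (simp add: G.m_assoc) (simp add: G.m_assoc[symmetric])
      then have "snd (f (g \<otimes>\<^bsub>G\<^esub> b)) = snd (f (g \<otimes>\<^bsub>G\<^esub> a)) \<otimes>\<^bsub>?H\<^esub> snd (f ?s)"
        using fmult[of "g \<otimes>\<^bsub>G\<^esub> a" ?s] g abG by simp
      moreover have "snd (f ?s) \<in> T'" using ab by (force simp: T'_def)
      moreover have "- d \<le> \<eta> (snd (f (g \<otimes>\<^bsub>G\<^esub> a)))" using da chi_eq g abG by simp
      ultimately show "\<phi> (snd (f (g \<otimes>\<^bsub>G\<^esub> a))) = \<phi> (snd (f (g \<otimes>\<^bsub>G\<^esub> b)))"
        using \<phi> fin(2) g abG by simp
    qed
    from labels[THEN spec, THEN mp, OF this] have "\<forall>g\<in>carrier G. \<forall>g'\<in>carrier G. 0 \<le> chi g \<longrightarrow> 0 \<le> chi g' \<longrightarrow>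
      \<phi> (snd (f g)) = \<phi> (snd (f g'))" .
    moreover have "e (\<one>\<^bsub>A\<^esub>, h) \<in> carrier G" "e (\<one>\<^bsub>A\<^esub>, h') \<in> carrier G" using e(1) h by simp_all
    ultimately have "\<phi> (snd (f (e (\<one>\<^bsub>A\<^esub>, h)))) = \<phi> (snd (f (e (\<one>\<^bsub>A\<^esub>, h'))))"
      using h(3,4) unfolding \<eta>_def by blast
    then show False using e(2)[OF A.one_closed h(1)] e(2)[OF A.one_closed h(2)] h(5) by simp
  qed
  then obtain a where a: "a \<in> carrier A" "chi (e (a, \<one>\<^bsub>?H\<^esub>)) \<noteq> 0" by blast
  have central: "\<forall>g\<in>carrier G. e (b, \<one>\<^bsub>?H\<^esub>) \<otimes>\<^bsub>G\<^esub> g = g \<otimes>\<^bsub>G\<^esub> e (b, \<one>\<^bsub>?H\<^esub>)" if b: "b \<in> carrier A" for b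
  proof
    fix g assume g: "g \<in> carrier G"
    show "e (b, \<one>\<^bsub>?H\<^esub>) \<otimes>\<^bsub>G\<^esub> g = g \<otimes>\<^bsub>G\<^esub> e (b, \<one>\<^bsub>?H\<^esub>)"
    proof (rule inj)
      show "f (e (b, \<one>\<^bsub>?H\<^esub>) \<otimes>\<^bsub>G\<^esub> g) = f (g \<otimes>\<^bsub>G\<^esub> e (b, \<one>\<^bsub>?H\<^esub>))"
        using fmult e[OF b H.one_closed] g fin[OF g] b by (simp add: A.m_comm)
    qed (use e(1)[OF b H.one_closed] g in auto)
  qed
  have "e (a, \<one>\<^bsub>?H\<^esub>) \<otimes>\<^bsub>G\<^esub> e (inv\<^bsub>A\<^esub> a, \<one>\<^bsub>?H\<^esub>) = e (\<one>\<^bsub>A\<^esub>, \<one>\<^bsub>?H\<^esub>)"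
    using emult a(1) by simp
  moreover have "chi (e (\<one>\<^bsub>A\<^esub>, \<one>\<^bsub>?H\<^esub>)) = 0"
  proof -
    have E: "e (\<one>\<^bsub>A\<^esub>, \<one>\<^bsub>?H\<^esub>) \<in> carrier G" using e(1) by simp
    have "e (\<one>\<^bsub>A\<^esub>, \<one>\<^bsub>?H\<^esub>) \<otimes>\<^bsub>G\<^esub> e (\<one>\<^bsub>A\<^esub>, \<one>\<^bsub>?H\<^esub>) = e (\<one>\<^bsub>A\<^esub>, \<one>\<^bsub>?H\<^esub>)" using emult by simp
    then show ?thesis using character_mult[OF chi E E] by simp
  qed
  ultimately have "chi (e (a, \<one>\<^bsub>?H\<^esub>)) + chi (e (inv\<^bsub>A\<^esub> a, \<one>\<^bsub>?H\<^esub>)) = 0"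
    using character_mult[OF chi e(1)[OF a(1) H.one_closed] e(1)[OF A.inv_closed[OF a(1)] H.one_closed]] by simp
  then consider "0 < chi (e (a, \<one>\<^bsub>?H\<^esub>))" | "0 < chi (e (inv\<^bsub>A\<^esub> a, \<one>\<^bsub>?H\<^esub>))" using a(2) by linarith
  then show ?thesis
  proof cases
    case 1
    then show ?thesis using that e(1)[OF a(1) H.one_closed] central[OF a(1)] by blast
  next
    case 2
    then show ?thesis using that e(1)[OF A.inv_closed[OF a(1)] H.one_closed] central[OF A.inv_closed[OF a(1)]] by blast
  qed
qed

theorem theorem8p3:
  fixes V :: "'v set" and E :: "('v \<times> 'v) set"
    and S :: "'s set"
    and W :: "'w set" and F :: "('w \<times> 'w) set"
    and k :: nat
  assumes "finite_simplicial_graph V E"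
    and "S \<noteq> {}"
    and "finite_simplicial_graph W F"
    and "disconnected_graph W F"
    and "graph_group V E \<cong> free_Abelian_group S \<times>\<times> graph_group W F"
    and "k \<ge> 1"
  shows "BNS_Sigma 1 (graph_group V E) = BNS_Sigma k (graph_group V E)"
proof
  let ?G = "graph_group V E"
  \<comment> \<open>As \<open>k \<ge> 1\<close>, degree 0 is among the degrees below
    \<open>k\<close>.\<close>
  show "BNS_Sigma k ?G \<subseteq> BNS_Sigma 1 ?G"
    by (rule BNS_Sigma_subset) (use \<open>k \<ge> 1\<close> in \<open>fastforce simp: essentially_connected_def\<close>)
  obtain f where f: "f \<in> iso ?G (free_Abelian_group S \<times>\<times> graph_group W F)"
    using assms(5) by (auto simp: is_iso_def)
  have sym: "sym F" using assms(3) by (simp add: finite_simplicial_graph_def)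
  show "BNS_Sigma 1 ?G \<subseteq> BNS_Sigma k ?G"
  proof (rule BNS_Sigma_subset)
    fix chi and K :: "(nat \<Rightarrow> real) topology" and I :: "nat set" and cdim \<Phi>
      and X :: "(nat \<Rightarrow> real) topology" and p act \<Psi> h
    assume chi: "chi \<in> characters ?G" and "finite_type_K_G_1 ?G K I cdim \<Phi> X p act \<Psi>"
      and height: "height_function ?G I cdim X act \<Psi> chi h"
      and ess: "essentially_connected 1 ?G I cdim X act \<Psi> h"
    then interpret finite_type_K_G_1 ?G K I cdim \<Phi> X p act \<Psi> by blast
    obtain d T where T: "finite T" "T \<subseteq> carrier ?G \<times> carrier ?G" and labels: "\<forall>\<phi> :: _ \<Rightarrow> bool.
      (\<forall>g\<in>carrier ?G. \<forall>(a, b)\<in>T. - d \<le> chi (g \<otimes>\<^bsub>?G\<^esub> a) \<longrightarrow> - d \<le> chi (g \<otimes>\<^bsub>?G\<^esub> b) \<longrightarrow>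
        \<phi> (g \<otimes>\<^bsub>?G\<^esub> a) = \<phi> (g \<otimes>\<^bsub>?G\<^esub> b)) \<longrightarrow>
      (\<forall>g\<in>carrier ?G. \<forall>g'\<in>carrier ?G. 0 \<le> chi g \<longrightarrow> 0 \<le> chi g' \<longrightarrow> \<phi> g = \<phi> g')"
      using essentially_connected_1_edge_labels[OF height ess] by (elim exE conjE)
    obtain z where "z \<in> carrier ?G" "\<forall>g\<in>carrier ?G. z \<otimes>\<^bsub>?G\<^esub> g = g \<otimes>\<^bsub>?G\<^esub> z" "0 < chi z"
      by (rule central_element_positive[OF group_graph_group chi f abelian_free_Abelian_group
            assms(4) sym T labels])
    then show "essentially_connected k ?G I cdim X act \<Psi> h"
      using essentially_connected_of_central[OF _ _ height] by blast
  qed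
qed

end
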